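(* Let $\Sigma$ be a fixed finite alphabet, let $M$ be a finite monoid and let $m \in \mathbb{N}$. Then: (i) $M \prec \Sigma^*/{\equiv_{m,n}^X}$ for some $n \in \mathbb{N}_0$ if and only if $M \in \mathbf{R}_m$; (ii) $M \prec \Sigma^*/{\equiv_{m,n}^Y}$ for some $n \in \mathbb{N}_0$ if and only if $M \in \mathbf{L}_m$; (iii) $M \prec \Sigma^*/{\equiv_{m,n}^{XY}}$ for some $n \in \mathbb{N}_0$ if and only if $M \in \mathbf{R}_m \vee \mathbf{L}_m$; (iv) $M \prec \Sigma^*/{\equiv_{m,n}^{\mathrm{WI}}}$ for some $n \in \mathbb{N}_0$ if and only if $M \in \mathbf{R}_{m+1} \cap \mathbf{L}_{m+1}$.
   Context: $\mathbb{N}=\{1,2,\dots\}$, $\mathbb{N}_0=\{0,1,\dots\}$. $\Sigma^*$ is the set of all finite words over $\Sigma$. $N \prec M$ means that $N$ is a homomorphic image of a submonoid of $M$. Hierarchy. A variety is a class of finite monoids closed under submonoids, homomorphic images and finite (possibly empty) direct products; $\mathbf{V}\vee\mathbf{W}$ is the smallest variety containing $\mathbf{V}\cup\mathbf{W}$. For elements $x,y$ of a monoid $M$, Green's relations are: $x\mathrel{\mathcal{R}}y$ iff $xM=yM$; $x\mathrel{\mathcal{L}}y$ iff $Mx=My$; $x\mathrel{\mathcal{J}}y$ iff $MxM=MyM$. For a finite monoid $M$ with set of idempotents $E(M)$, define congruences on $M$: $x\sim_K y$ iff for all $e\in E(M)$: ($ex\mathrel{\mathcal{R}}e$ or $ey\mathrel{\mathcal{R}}e$)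 implies $ex=ey$; $x\sim_D y$ iff for all $e\in E(M)$: ($xe\mathrel{\mathcal{L}}e$ or $ye\mathrel{\mathcal{L}}e$) implies $xe=ye$. For a variety $\mathbf{V}$, let $\mathbf{K}\,ⓜ\,\mathbf{V}$ (resp. $\mathbf{D}\,ⓜ\,\mathbf{V}$) be the variety of all finite monoids $M$ with $M/{\sim_K}\in\mathbf{V}$ (resp. $M/{\sim_D}\in\mathbf{V}$). Let $\mathbf{J}$ be the variety of finite $\mathcal{J}$-trivial monoids, and set $\mathbf{R}_1=\mathbf{L}_1=\mathbf{J}$, $\mathbf{R}_{m+1}=\mathbf{K}\,ⓜ\,\mathbf{L}_m$, $\mathbf{L}_{m+1}=\mathbf{D}\,ⓜ\,\mathbf{R}_m$ for $m\in\mathbb{N}$. Factorizations. For a finite word $w\in\Sigma^*$, $\mathrm{alph}(w)$ is the set of letters occurring in $w$. For $a\in\mathrm{alph}(w)$, $w\cdot X_a^L$ and $w\cdot X_a^R$ are the factors of $w$ strictly to the left and strictly to the right of the first occurrence of $a$; $w\cdot Y_a^L$ and $w\cdot Y_a^R$ are the factors strictly to the left and strictly to the right of the last occurrence of $a$. For $a,b\in\mathrm{alph}(w)$, $w\cdot C_{a,b}$ is defined iff the first $a$-position is strictly larger than the last $b$-position, and then it is the factor strictly between the last $b$ and the first $a$. Relations. For finite words $u,v\in\Sigma^*$: $u\equiv_{m,n}^Z v$ always holds if $m=0$ or $n=0$ ($Z\in\{X,Y,\mathrm{WI}\}$). For $m,n\in\mathbb{N}$: - $u\equiv_{m,n}^X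 v$ iff $\mathrm{alph}(u)=\mathrm{alph}(v)$, $u\equiv_{m-1,n-1}^Y v$, and for all $a\in\mathrm{alph}(u)$: $u\cdot X_a^L\equiv_{m-1,n-1}^Y v\cdot X_a^L$ and $u\cdot X_a^R\equiv_{m,n-1}^X v\cdot X_a^R$; - $u\equiv_{m,n}^Y v$ iff $\mathrm{alph}(u)=\mathrm{alph}(v)$, $u\equiv_{m-1,n-1}^X v$, and for all $a\in\mathrm{alph}(u)$: $u\cdot Y_a^L\equiv_{m,n-1}^Y v\cdot Y_a^L$ and $u\cdot Y_a^R\equiv_{m-1,n-1}^X v\cdot Y_a^R$; - $u\equiv_{m,n}^{\mathrm{WI}} v$ iff $\mathrm{alph}(u)=\mathrm{alph}(v)$; for all $a\in\mathrm{alph}(u)$: $u\cdot X_a^L\equiv_{m-1,n-1}^{\mathrm{WI}} v\cdot X_a^L$, $u\cdot X_a^R\equiv_{m,n-1}^{\mathrm{WI}} v\cdot X_a^R$, $u\cdot Y_a^L\equiv_{m,n-1}^{\mathrm{WI}} v\cdot Y_a^L$, $u\cdot Y_a^R\equiv_{m-1,n-1}^{\mathrm{WI}} v\cdot Y_a^R$; and for all $a,b\in\mathrm{alph}(u)$: $u\cdot C_{a,b}$ and $v\cdot C_{a,b}$ are either both undefined, or both defined with $u\cdot C_{a,b}\equiv_{m-1,n-1}^{\mathrm{WI}} v\cdot C_{a,b}$. For all $m,n\in\mathbb{N}_0$: $u\equiv_{m,n}^{XY}v$ iff $u\equiv_{m,n}^X v$ and $u\equiv_{m,n}^Y v$. All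 these relations are congruences of finite index on $\Sigma^*$.
   Formalization: The "if" directions are proved for M a homomorphic image of Σ* (M generated by |Σ| elements); for arbitrary M they fail, e.g. Σ empty and M the two-element semilattice. The "only if" directions are proved for all finite M. *)

theory Defs
  imports "HOL-Algebra.Product_Groups"
begin

definition finite_monoid :: "'a monoid \<Rightarrow> bool" where
  "finite_monoid M \<longleftrightarrow> monoid M \<and> finite (carrier M)"

text \<open>The relation is restricted to the carrier, so that \<open>r\<close> may be any binary predicate on the
  ambient type. If the restriction is a congruence, the product of two classes is the class
  containing all products of representatives.\<close>

definition quotient_monoid :: "'a monoid \<Rightarrow> ('a \<Rightarrow> 'a \<Rightarrow> bool) \<Rightarrow> 'a set monoid" where
  "quotient_monoid M r =
     (let \<rho> = {(x, y). x \<in> carrier M \<and> y \<in> carrier M \<and> r x y} in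
      \<lparr>carrier = carrier M // \<rho>,
       mult = (\<lambda>A B. \<rho> `` (A <#>\<^bsub>M\<^esub> B)),
       one = \<rho> `` {\<one>\<^bsub>M\<^esub>}\<rparr>)"

text \<open>Elements of \<^const>\<open>hom\<close> need not preserve the unit, but surjective homomorphisms between
  monoids do, so \<^const>\<open>epi\<close> consists of surjective monoid homomorphisms.\<close>

definition monoid_divides :: "'a monoid \<Rightarrow> 'b monoid \<Rightarrow> bool" where
  "monoid_divides N M \<longleftrightarrow> (\<exists>H. submonoid H M \<and> epi (M\<lparr>carrier := H\<rparr>) N \<noteq> {})"

definition free_monoid :: "'a set \<Rightarrow> 'a list monoid" where
  "free_monoid \<Sigma> = \<lparr>carrier = lists \<Sigma>, mult = (@), one = []\<rparr>"

text \<open>An isomorphism-closed class of finite monoids is represented by the set of its members whose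
  elements are natural numbers; every finite monoid is isomorphic to one of these. The predicate
  \<open>in_class M V\<close> expresses membership of a monoid \<open>M\<close>, with elements of any type, in the class
  represented by \<open>V\<close>.\<close>

type_synonym monoid_class = "nat monoid set"

definition in_class :: "'a monoid \<Rightarrow> monoid_class \<Rightarrow> bool" where
  "in_class M V \<longleftrightarrow> finite_monoid M \<and> (\<exists>N\<in>V. M \<cong> N)"

text \<open>Despite its name, \<^const>\<open>product_group\<close> is the direct product of an arbitrary family of
  monoids.\<close>

definition is_variety :: "monoid_class \<Rightarrow> bool" where
  "is_variety V \<longleftrightarrow>
     (\<forall>M\<in>V. finite_monoid M) \<and>
     (\<forall>M\<in>V. \<forall>H. submonoid H M \<longrightarrow> M\<lparr>carrier := H\<rparr> \<in> V) \<and>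
     (\<forall>M\<in>V. \<forall>N. monoid N \<and> epi M N \<noteq> {} \<longrightarrow> N \<in> V) \<and>
     (\<forall>(I :: nat set) F. finite I \<and> (\<forall>i\<in>I. F i \<in> V) \<longrightarrow> in_class (product_group I F) V)"

definition variety_join :: "monoid_class \<Rightarrow> monoid_class \<Rightarrow> monoid_class" where
  "variety_join V W = \<Inter>{U. is_variety U \<and> V \<union> W \<subseteq> U}"

definition green_R :: "'a monoid \<Rightarrow> 'a \<Rightarrow> 'a \<Rightarrow> bool" where
  "green_R M x y \<longleftrightarrow> x <#\<^bsub>M\<^esub> carrier M = y <#\<^bsub>M\<^esub> carrier M"

definition green_L :: "'a monoid \<Rightarrow> 'a \<Rightarrow> 'a \<Rightarrow> bool" where
  "green_L M x y \<longleftrightarrow> carrier M #>\<^bsub>M\<^esub> x = carrier M #>\<^bsub>M\<^esub> y"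

definition green_J :: "'a monoid \<Rightarrow> 'a \<Rightarrow> 'a \<Rightarrow> bool" where
  "green_J M x y \<longleftrightarrow>
     (carrier M #>\<^bsub>M\<^esub> x) <#>\<^bsub>M\<^esub> carrier M = (carrier M #>\<^bsub>M\<^esub> y) <#>\<^bsub>M\<^esub> carrier M"

definition idempotents :: "'a monoid \<Rightarrow> 'a set" where
  "idempotents M = {e \<in> carrier M. e \<otimes>\<^bsub>M\<^esub> e = e}"

definition sim_K :: "'a monoid \<Rightarrow> 'a \<Rightarrow> 'a \<Rightarrow> bool" where
  "sim_K M x y \<longleftrightarrow>
     (\<forall>e\<in>idempotents M.
        green_R M (e \<otimes>\<^bsub>M\<^esub> x) e \<or> green_R M (e \<otimes>\<^bsub>M\<^esub> y) e \<longrightarrow> e \<otimes>\<^bsub>M\<^esub> x = e \<otimes>\<^bsub>M\<^esub> y)"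

definition sim_D :: "'a monoid \<Rightarrow> 'a \<Rightarrow> 'a \<Rightarrow> bool" where
  "sim_D M x y \<longleftrightarrow>
     (\<forall>e\<in>idempotents M.
        green_L M (x \<otimes>\<^bsub>M\<^esub> e) e \<or> green_L M (y \<otimes>\<^bsub>M\<^esub> e) e \<longrightarrow> x \<otimes>\<^bsub>M\<^esub> e = y \<otimes>\<^bsub>M\<^esub> e)"

definition malcev_K :: "monoid_class \<Rightarrow> monoid_class" where
  "malcev_K V = {M. finite_monoid M \<and> in_class (quotient_monoid M (sim_K M)) V}"

definition malcev_D :: "monoid_class \<Rightarrow> monoid_class" where
  "malcev_D V = {M. finite_monoid M \<and> in_class (quotient_monoid M (sim_D M)) V}"

definition variety_J :: monoid_class where
  "variety_J = {M. finite_monoid M \<and> (\<forall>x\<in>carrier M. \<forall>y\<in>carrier M. green_J M x y \<longrightarrow> x = y)}"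

text \<open>The hierarchy starts at level 1; the value at level 0 is a dummy.\<close>

fun variety_R :: "nat \<Rightarrow> monoid_class" and variety_L :: "nat \<Rightarrow> monoid_class" where
  "variety_R 0 = {}"
| "variety_R (Suc 0) = variety_J"
| "variety_R (Suc (Suc m)) = malcev_K (variety_L (Suc m))"
| "variety_L 0 = {}"
| "variety_L (Suc 0) = variety_J"
| "variety_L (Suc (Suc m)) = malcev_D (variety_R (Suc m))"

text \<open>The alphabet of a word \<open>w\<close> is \<open>set w\<close>. Positions are counted from 0, and all functions below
  are meaningful only for letters occurring in \<open>w\<close>.\<close>

definition first_pos :: "'a \<Rightarrow> 'a list \<Rightarrow> nat" where
  "first_pos a w = (LEAST i. i < length w \<and> w ! i = a)"

definition last_pos :: "'a \<Rightarrow> 'a list \<Rightarrow> nat" where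
  "last_pos a w = (GREATEST i. i < length w \<and> w ! i = a)"

definition X_left :: "'a \<Rightarrow> 'a list \<Rightarrow> 'a list" where
  "X_left a w = take (first_pos a w) w"

definition X_right :: "'a \<Rightarrow> 'a list \<Rightarrow> 'a list" where
  "X_right a w = drop (Suc (first_pos a w)) w"

definition Y_left :: "'a \<Rightarrow> 'a list \<Rightarrow> 'a list" where
  "Y_left a w = take (last_pos a w) w"

definition Y_right :: "'a \<Rightarrow> 'a list \<Rightarrow> 'a list" where
  "Y_right a w = drop (Suc (last_pos a w)) w"

definition C_mid :: "'a \<Rightarrow> 'a \<Rightarrow> 'a list \<Rightarrow> 'a list option" where
  "C_mid a b w =
     (if last_pos b w < first_pos a w
      then Some (drop (Suc (last_pos b w)) (take (first_pos a w) w))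
      else None)"

fun eq_X :: "nat \<Rightarrow> nat \<Rightarrow> 'a list \<Rightarrow> 'a list \<Rightarrow> bool"
  and eq_Y :: "nat \<Rightarrow> nat \<Rightarrow> 'a list \<Rightarrow> 'a list \<Rightarrow> bool" where
  "eq_X 0 n u v \<longleftrightarrow> True"
| "eq_X (Suc m) 0 u v \<longleftrightarrow> True"
| "eq_X (Suc m) (Suc n) u v \<longleftrightarrow>
     set u = set v \<and> eq_Y m n u v \<and>
     (\<forall>a\<in>set u. eq_Y m n (X_left a u) (X_left a v) \<and>
                eq_X (Suc m) n (X_right a u) (X_right a v))"
| "eq_Y 0 n u v \<longleftrightarrow> True"
| "eq_Y (Suc m) 0 u v \<longleftrightarrow> True"
| "eq_Y (Suc m) (Suc n) u v \<longleftrightarrow>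
     set u = set v \<and> eq_X m n u v \<and>
     (\<forall>a\<in>set u. eq_Y (Suc m) n (Y_left a u) (Y_left a v) \<and>
                eq_X m n (Y_right a u) (Y_right a v))"

definition eq_XY :: "nat \<Rightarrow> nat \<Rightarrow> 'a list \<Rightarrow> 'a list \<Rightarrow> bool" where
  "eq_XY m n u v \<longleftrightarrow> eq_X m n u v \<and> eq_Y m n u v"

text \<open>Here \<^const>\<open>rel_option\<close> says that both factors are undefined, or both are defined and related.\<close>

fun eq_WI :: "nat \<Rightarrow> nat \<Rightarrow> 'a list \<Rightarrow> 'a list \<Rightarrow> bool" where
  "eq_WI 0 n u v \<longleftrightarrow> True"
| "eq_WI (Suc m) 0 u v \<longleftrightarrow> True"
| "eq_WI (Suc m) (Suc n) u v \<longleftrightarrow>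
     set u = set v \<and>
     (\<forall>a\<in>set u. eq_WI m n (X_left a u) (X_left a v) \<and>
                eq_WI (Suc m) n (X_right a u) (X_right a v) \<and>
                eq_WI (Suc m) n (Y_left a u) (Y_left a v) \<and>
                eq_WI m n (Y_right a u) (Y_right a v)) \<and>
     (\<forall>a\<in>set u. \<forall>b\<in>set u. rel_option (\<lambda>p q. eq_WI m n p q) (C_mid a b u) (C_mid a b v))"

end

theory Submission
  imports Defs "HOL-Library.Sublist"
begin

text \<open>From varieties to words. All the varieties lie in DA, where \<open>s h(u)\<close> can leave the \<open>\<R>\<close>-class of
  \<open>s\<close> only at the first occurrence of a letter in \<open>u\<close>. As there are boundedly many such descents,
  \<open>X\<close>-factorizations reduce \<^const>\<open>eq_X\<close> at level \<open>m + 1\<close> to the congruence \<^const>\<open>sim_K\<close>, hence to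
  \<^const>\<open>eq_Y\<close> at level \<open>m\<close>. For \<^const>\<open>eq_WI\<close> one cuts at the \<open>\<R>\<close>-descents from the left and the
  \<open>\<L>\<close>-descents from the right; between the cuts it suffices to control the join of \<^const>\<open>sim_K\<close> and
  \<^const>\<open>sim_D\<close>, whose quotient lies one level below. The first level of this argument is Simon's
  theorem on piecewise testable languages, which also starts the induction for \<^const>\<open>eq_X\<close>.

  From words to varieties. After a high power of a word containing all letters of \<open>u\<close> and \<open>v\<close>, first
  occurrences fall into the power, so \<open>eq_Y m\<close> for \<open>u\<close> and \<open>v\<close> yields both \<open>eq_X (m + 1)\<close> and
  \<open>eq_WI m\<close> for the extended words. This bounds the quotient by \<^const>\<open>sim_K\<close>.

  The statements for \<open>\<^bold>L\<close> and \<open>Y\<close> are those for \<open>\<^bold>R\<close> and \<open>X\<close> in opposite monoids and reversed words. For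
  the join, the monoids all of whose homomorphisms from words factor through some
  \<^const>\<open>eq_XY\<close> form a variety.\<close>

section \<open>Words\<close>

text \<open>For the intersection, the induction cannot follow one of the two congruences alone: for
  \<open>M\<close> in both varieties of level \<open>m + 2\<close>, the quotient by
  \<open>sim_K\<close> is only known to lie in \<open>variety_L (m + 1)\<close> and the quotient by
  \<open>sim_D\<close> in \<open>variety_R (m + 1)\<close>. The quotient by their join is an image
  of both, so it lies in both varieties and fits the induction hypothesis. The price is that related
  elements may be exchanged only between a left and a right factor that are both stable. This forces
  the two-sided cutting of words and the two measures \<open>rank\<close> and \<open>corank\<close>.
  The depth \<open>n\<close> is a budget. Each factorization costs one unit, and the sizes of
  principal one-sided ideals bound the number of descents, so the depth is fixed before the words
  are. In the other direction the exponent of a power pays for the depth. Classes are sets of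
  monoids on natural numbers, whereas quotients consist of sets. Membership is therefore tested on
  copies and transported by division, which absorbs isomorphisms, submonoids and images at
  once.\<close>

lemma first_pos_append:
  assumes "a \<notin> set x"
  shows "first_pos a (x @ a # y) = length x"
  unfolding first_pos_def
proof (rule Least_equality)
  fix i assume "i < length (x @ a # y) \<and> (x @ a # y) ! i = a"
  then show "length x \<le> i"
    using assms by (metis linorder_not_le nth_append nth_mem)
qed simp

lemma last_pos_append:
  assumes "a \<notin> set y"
  shows "last_pos a (x @ a # y) = length x"
  unfolding last_pos_def
proof (rule Greatest_equality)
  fix i assume i: "i < length (x @ a # y) \<and> (x @ a # y) ! i = a"
  show "i \<le> length x"
  proof (rule ccontr)
    assume "\<not> i \<le> length x"
    then obtain j where "i = length x + Suc j"
      by (metis add_Suc_right less_imp_Suc_add not_le)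
    with i have "y ! j = a" "j < length y" by (auto simp: nth_append)
    then show False using assms by auto
  qed
qed simp

lemma X_decomp:
  assumes "a \<notin> set x"
  shows "X_left a (x @ a # y) = x" "X_right a (x @ a # y) = y"
  using assms by (simp_all add: X_left_def X_right_def first_pos_append)

lemma Y_decomp:
  assumes "a \<notin> set y"
  shows "Y_left a (x @ a # y) = x" "Y_right a (x @ a # y) = y"
  using assms by (simp_all add: Y_left_def Y_right_def last_pos_append)

lemma X_split:
  assumes "a \<in> set w"
  shows "w = X_left a w @ a # X_right a w" "a \<notin> set (X_left a w)"
  using assms split_list_first[of a w] by (auto simp: X_decomp)

lemma Y_split:
  assumes "a \<in> set w"
  shows "w = Y_left a w @ a # Y_right a w" "a \<notin> set (Y_right a w)"
  using assms split_list_last[of a w] by (auto simp: Y_decomp)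

lemma C_mid_decomp:
  assumes "b \<notin> set c" "b \<notin> set y" "a \<notin> set x" "a \<notin> set c" "a \<noteq> b"
  shows "C_mid a b (x @ b # c @ a # y) = Some c"
proof -
  have "first_pos a (x @ b # c @ a # y) = length (x @ b # c)"
    using first_pos_append[of a "x @ b # c" y] assms by simp
  moreover have "last_pos b (x @ b # c @ a # y) = length x"
    by (rule last_pos_append) (use assms in auto)
  ultimately show ?thesis by (simp add: C_mid_def)
qed

text \<open>This is how the order of two positions is seen through alphabets: the first
  \<open>a\<close> lies behind the last \<open>b\<close> exactly if \<open>a \<noteq> b\<close> and
  \<open>a\<close> is missing from \<open>Y_left b w\<close>. The relations compare alphabets of
  factors, so definedness of \<open>C_mid\<close> is always decided in this form.\<close>

lemma C_mid_None:
  assumes "a \<in> set w" "b \<in> set w" "a = b \<or> a \<in> set (Y_left b w)"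
  shows "C_mid a b w = None"
proof -
  have w: "w = X_left a w @ a # X_right a w" "w = Y_left b w @ b # Y_right b w"
    using X_split Y_split assms by metis+
  have f: "first_pos a w = length (X_left a w)" "last_pos b w = length (Y_left b w)"
    using first_pos_append[OF X_split(2)[OF assms(1)]] last_pos_append[OF Y_split(2)[OF assms(2)]]
      w by metis+
  \<comment> \<open>Otherwise \<open>Y_left b w @ [b]\<close> would be a prefix of
    \<open>X_left a w\<close>, a word without \<open>a\<close>.\<close>
  have "length (X_left a w) \<le> length (Y_left b w)"
  proof (rule ccontr)
    assume *: "\<not> ?thesis"
    let ?k = "Suc (length (Y_left b w))"
    have "take ?k w = Y_left b w @ [b]"
      using arg_cong[OF w(2), of "take ?k"] by simp
    moreover have "take ?k w = take ?k (X_left a w)"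
      using arg_cong[OF w(1), of "take ?k"] * by simp
    ultimately have "set (Y_left b w @ [b]) \<subseteq> set (X_left a w)"
      by (metis set_take_subset)
    then show False using assms(3) X_split(2)[OF assms(1)] by auto
  qed
  then show ?thesis using f by (simp add: C_mid_def)
qed

lemma C_mid_Some:
  assumes "a \<in> set w" "b \<in> set w" "a \<noteq> b" "a \<notin> set (Y_left b w)"
  obtains x c y where "w = x @ b # c @ a # y" "b \<notin> set c" "b \<notin> set y" "a \<notin> set x" "a \<notin> set c"
    "C_mid a b w = Some c"
proof -
  let ?x = "Y_left b w" and ?r = "Y_right b w"
  have w: "w = ?x @ b # ?r" "b \<notin> set ?r" using Y_split assms(2) by metis+
  then have "a \<in> set ?r" using assms by (metis Un_iff set_ConsD set_append)
  then obtain c y where "?r = c @ a # y" "a \<notin> set c" using split_list_first by metis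
  then show ?thesis using that[of ?x c y] w assms C_mid_decomp[of b c y a ?x] by auto
qed

lemma X_append_in:
  assumes "a \<in> set u"
  shows "X_left a (u @ v) = X_left a u" "X_right a (u @ v) = X_right a u @ v"
proof -
  obtain x y where "u = x @ a # y" "a \<notin> set x" using assms split_list_first by metis
  then show "X_left a (u @ v) = X_left a u" "X_right a (u @ v) = X_right a u @ v"
    by (simp_all add: X_decomp)
qed

lemma X_append_notin:
  assumes "a \<notin> set u" "a \<in> set v"
  shows "X_left a (u @ v) = u @ X_left a v" "X_right a (u @ v) = X_right a v"
proof -
  obtain x y where v: "v = x @ a # y" "a \<notin> set x" using assms split_list_first by metis
  then show "X_left a (u @ v) = u @ X_left a v" "X_right a (u @ v) = X_right a v"
    using X_decomp[of a "u @ x" y] assms by (simp_all add: X_decomp)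
qed

lemma X_rev:
  assumes "a \<in> set w"
  shows "X_left a (rev w) = rev (Y_right a w)" "X_right a (rev w) = rev (Y_left a w)"
proof -
  obtain x y where "w = x @ a # y" "a \<notin> set y" using assms split_list_last by metis
  then show "X_left a (rev w) = rev (Y_right a w)" "X_right a (rev w) = rev (Y_left a w)"
    by (simp_all add: X_decomp Y_decomp)
qed

lemma Y_rev:
  assumes "a \<in> set w"
  shows "Y_left a (rev w) = rev (X_right a w)" "Y_right a (rev w) = rev (X_left a w)"
  using X_rev[of a "rev w"] assms by simp_all

lemma Y_append_in:
  assumes "a \<in> set v"
  shows "Y_left a (u @ v) = u @ Y_left a v" "Y_right a (u @ v) = Y_right a v"
proof -
  obtain x y where "v = x @ a # y" "a \<notin> set y" using assms split_list_last by metis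
  then show "Y_left a (u @ v) = u @ Y_left a v" "Y_right a (u @ v) = Y_right a v"
    using Y_decomp[of a y "u @ x"] by (simp_all add: Y_decomp)
qed

lemma Y_append_notin:
  assumes "a \<in> set u" "a \<notin> set v"
  shows "Y_left a (u @ v) = Y_left a u" "Y_right a (u @ v) = Y_right a u @ v"
proof -
  obtain x y where "u = x @ a # y" "a \<notin> set y" using assms split_list_last by metis
  then show "Y_left a (u @ v) = Y_left a u" "Y_right a (u @ v) = Y_right a u @ v"
    using Y_decomp[of a "y @ v" x] assms by (simp_all add: Y_decomp)
qed

lemma C_mid_rev:
  assumes "a \<in> set w" "b \<in> set w"
  shows "C_mid a b (rev w) = map_option rev (C_mid b a w)"
proof (cases "a = b \<or> b \<in> set (Y_left a w)")
  case True
  have "a \<in> set (Y_left b (rev w))" if "b \<in> set (Y_left a w)"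
  proof -
    have w: "w = Y_left a w @ a # Y_right a w" using Y_split assms by metis
    have "a \<in> set (X_right b w)" using that X_append_in(2)[OF that, of "a # Y_right a w"] w
      by simp
    then show ?thesis using assms by (simp add: Y_rev)
  qed
  then show ?thesis using True C_mid_None[of a "rev w" b] C_mid_None[of b w a] assms by auto
next
  case False
  then obtain x c y where *: "w = x @ a # c @ b # y" "a \<notin> set c" "a \<notin> set y" "b \<notin> set x"
    "b \<notin> set c" "C_mid b a w = Some c"
    using C_mid_Some[of b w a] assms by metis
  have "C_mid a b (rev w) = Some (rev c)"
    using C_mid_decomp[of b "rev c" "rev x" a "rev y"] * False by simp
  then show ?thesis using * by simp
qed

lemma set_X_left: "a \<in> set w \<Longrightarrow> set (X_left a w) \<subseteq> set w"
  by (metis Un_upper1 X_split(1) set_append)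

lemma set_X_right: "a \<in> set w \<Longrightarrow> set (X_right a w) \<subseteq> set w"
  by (metis X_split(1) set_append set_subset_Cons Un_upper2 dual_order.trans)

lemma set_Y_left: "a \<in> set w \<Longrightarrow> set (Y_left a w) \<subseteq> set w"
  by (metis Un_upper1 Y_split(1) set_append)

lemma set_Y_right: "a \<in> set w \<Longrightarrow> set (Y_right a w) \<subseteq> set w"
  by (metis Y_split(1) set_append set_subset_Cons Un_upper2 dual_order.trans)

section \<open>The word relations as congruences, monotone in the depth\<close>

lemma eq_zero [simp]: "eq_X m 0 u v" "eq_Y m 0 u v" "eq_WI m 0 u v"
  by (cases m; simp)+

lemma eq_XI:
  assumes "set u = set v" "eq_Y m n u v"
    "\<And>a. a \<in> set u \<Longrightarrow> a \<in> set v \<Longrightarrow> eq_Y m n (X_left a u) (X_left a v)"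
    "\<And>a. a \<in> set u \<Longrightarrow> a \<in> set v \<Longrightarrow> eq_X (Suc m) n (X_right a u) (X_right a v)"
  shows "eq_X (Suc m) (Suc n) u v"
  using assms by simp

lemma eq_XD:
  assumes "eq_X (Suc m) (Suc n) u v"
  shows "set u = set v" "eq_Y m n u v"
    "a \<in> set u \<Longrightarrow> eq_Y m n (X_left a u) (X_left a v)"
    "a \<in> set u \<Longrightarrow> eq_X (Suc m) n (X_right a u) (X_right a v)"
  using assms by simp_all

lemma eq_YI:
  assumes "set u = set v" "eq_X m n u v"
    "\<And>a. a \<in> set u \<Longrightarrow> a \<in> set v \<Longrightarrow> eq_Y (Suc m) n (Y_left a u) (Y_left a v)"
    "\<And>a. a \<in> set u \<Longrightarrow> a \<in> set v \<Longrightarrow> eq_X m n (Y_right a u) (Y_right a v)"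
  shows "eq_Y (Suc m) (Suc n) u v"
  using assms by simp

lemma eq_YD:
  assumes "eq_Y (Suc m) (Suc n) u v"
  shows "set u = set v" "eq_X m n u v"
    "a \<in> set u \<Longrightarrow> eq_Y (Suc m) n (Y_left a u) (Y_left a v)"
    "a \<in> set u \<Longrightarrow> eq_X m n (Y_right a u) (Y_right a v)"
  using assms by simp_all

lemma eq_WII:
  assumes "set u = set v"
    "\<And>a. a \<in> set u \<Longrightarrow> a \<in> set v \<Longrightarrow> eq_WI m n (X_left a u) (X_left a v)"
    "\<And>a. a \<in> set u \<Longrightarrow> a \<in> set v \<Longrightarrow> eq_WI (Suc m) n (X_right a u) (X_right a v)"
    "\<And>a. a \<in> set u \<Longrightarrow> a \<in> set v \<Longrightarrow> eq_WI (Suc m) n (Y_left a u) (Y_left a v)"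
    "\<And>a. a \<in> set u \<Longrightarrow> a \<in> set v \<Longrightarrow> eq_WI m n (Y_right a u) (Y_right a v)"
    "\<And>a b. a \<in> set u \<Longrightarrow> a \<in> set v \<Longrightarrow> b \<in> set u \<Longrightarrow> b \<in> set v \<Longrightarrow>
       rel_option (eq_WI m n) (C_mid a b u) (C_mid a b v)"
  shows "eq_WI (Suc m) (Suc n) u v"
  using assms by simp

lemma eq_WID:
  assumes "eq_WI (Suc m) (Suc n) u v"
  shows "set u = set v"
    "a \<in> set u \<Longrightarrow> eq_WI m n (X_left a u) (X_left a v)"
    "a \<in> set u \<Longrightarrow> eq_WI (Suc m) n (X_right a u) (X_right a v)"
    "a \<in> set u \<Longrightarrow> eq_WI (Suc m) n (Y_left a u) (Y_left a v)"
    "a \<in> set u \<Longrightarrow> eq_WI m n (Y_right a u) (Y_right a v)"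
    "a \<in> set u \<Longrightarrow> b \<in> set u \<Longrightarrow> rel_option (eq_WI m n) (C_mid a b u) (C_mid a b v)"
  using assms by simp_all

lemma eq_rev:
  "eq_X m n (rev u) (rev v) = eq_Y m n u v \<and> eq_Y m n (rev u) (rev v) = eq_X m n u v"
proof (induction n arbitrary: m u v)
  case (Suc n)
  show ?case
    by (cases m) (auto simp: X_rev Y_rev Suc)
qed simp

lemmas eq_X_rev = eq_rev[THEN conjunct1] and eq_Y_rev = eq_rev[THEN conjunct2]

lemma eq_WI_rev: "eq_WI m n (rev u) (rev v) = eq_WI m n u v"
proof (induction n arbitrary: m u v)
  case (Suc n)
  show ?case
    by (cases m) (auto simp: X_rev Y_rev C_mid_rev Suc option.rel_map)
qed simp

lemma eq_refl: "eq_X m n u u \<and> eq_Y m n u u"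
proof (induction n arbitrary: m u)
  case (Suc n)
  then show ?case by (cases m) auto
qed simp

lemma eq_WI_refl: "eq_WI m n u u"
proof (induction n arbitrary: m u)
  case (Suc n)
  then show ?case by (cases m) (auto intro!: option.rel_refl)
qed simp

lemma eq_sym: "(eq_X m n u v \<longrightarrow> eq_X m n v u) \<and> (eq_Y m n u v \<longrightarrow> eq_Y m n v u)"
proof (induction n arbitrary: m u v)
  case (Suc n)
  then show ?case by (cases m) auto
qed simp

lemma rel_option_sym:
  assumes "\<And>p q. r p q \<Longrightarrow> r q p" "rel_option r x y"
  shows "rel_option r y x"
  using assms by (cases x; cases y) auto

lemma rel_option_trans:
  assumes "\<And>p q s. r p q \<Longrightarrow> r q s \<Longrightarrow> r p s" "rel_option r x y" "rel_option r y z"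
  shows "rel_option r x z"
  using assms(2,3) by (cases x; cases y; cases z) (auto intro: assms(1))

lemma eq_WI_sym: "eq_WI m n u v \<Longrightarrow> eq_WI m n v u"
proof (induction n arbitrary: m u v)
  case (Suc n)
  then show ?case by (cases m) (auto intro: rel_option_sym)
qed simp

lemma eq_trans:
  fixes u :: "'a list"
  shows "(eq_X m n u v \<longrightarrow> eq_X m n v w \<longrightarrow> eq_X m n u w) \<and> (eq_Y m n u v \<longrightarrow> eq_Y m n v w \<longrightarrow> eq_Y m n u w)"
proof (induction n arbitrary: m u v w)
  case (Suc n)
  have X: "eq_X k n x z" if "eq_X k n x y" "eq_X k n y z" for k and x y z :: "'a list"
    using Suc that by blast
  have Y: "eq_Y k n x z" if "eq_Y k n x y" "eq_Y k n y z" for k and x y z :: "'a list"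
    using Suc that by blast
  show ?case
  proof (cases m)
    case (Suc k)
    have "eq_X m (Suc n) u w" if "eq_X m (Suc n) u v" "eq_X m (Suc n) v w"
      using that X Y unfolding Suc eq_X.simps by metis
    moreover have "eq_Y m (Suc n) u w" if "eq_Y m (Suc n) u v" "eq_Y m (Suc n) v w"
      using that X Y unfolding Suc eq_Y.simps by metis
    ultimately show ?thesis by blast
  qed simp
qed simp

lemma eq_WI_trans:
  fixes u :: "'a list"
  shows "eq_WI m n u v \<Longrightarrow> eq_WI m n v w \<Longrightarrow> eq_WI m n u w"
proof (induction n arbitrary: m u v w)
  case (Suc n)
  show ?case
  proof (cases m)
    case (Suc k)
    have t: "rel_option (\<lambda>p q. eq_WI k n p q) x z"
      if "rel_option (\<lambda>p q. eq_WI k n p q) x y" "rel_option (\<lambda>p q. eq_WI k n p q) y z"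
        for x y z :: "'a list option"
      using rel_option_trans[OF _ that] Suc.IH by blast
    show ?thesis using Suc.prems Suc.IH t unfolding Suc eq_WI.simps by metis
  qed simp
qed simp

declare eq_X.simps(3) [simp del] eq_Y.simps(3) [simp del] eq_WI.simps(3) [simp del]

lemma eq_mono1:
  fixes u :: "'a list"
  shows "(eq_X m (Suc n) u v \<longrightarrow> eq_X m n u v) \<and> (eq_Y m (Suc n) u v \<longrightarrow> eq_Y m n u v)"
proof (induction n arbitrary: m u v)
  case (Suc n)
  show ?case
  proof (cases m)
    case m: (Suc k)
    have "eq_X m (Suc n) u v" if "eq_X m (Suc (Suc n)) u v"
      using eq_XD[OF that[unfolded m]] unfolding m by (intro eq_XI) (use Suc.IH in blast)+
    moreover have "eq_Y m (Suc n) u v" if "eq_Y m (Suc (Suc n)) u v"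
      using eq_YD[OF that[unfolded m]] unfolding m by (intro eq_YI) (use Suc.IH in blast)+
    ultimately show ?thesis by blast
  qed simp
qed simp

lemma rel_option_mono:
  assumes "\<And>p q. r p q \<Longrightarrow> r' p q" "rel_option r x y"
  shows "rel_option r' x y"
  using assms(2) by (cases x; cases y) (auto intro: assms(1))

lemma eq_WI_mono1:
  fixes u :: "'a list"
  shows "eq_WI m (Suc n) u v \<Longrightarrow> eq_WI m n u v"
proof (induction n arbitrary: m u v)
  case (Suc n)
  show ?case
  proof (cases m)
    case m: (Suc k)
    have "rel_option (eq_WI k n) x y" if "rel_option (eq_WI k (Suc n)) x y"
      for x y :: "'a list option"
      by (rule rel_option_mono[OF _ that]) (rule Suc.IH)
    then show ?thesis using eq_WID[OF Suc.prems[unfolded m]]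
      unfolding m by (intro eq_WII) (simp_all add: Suc.IH)
  qed simp
qed simp

lemma eq_X_mono: "eq_X m n u v \<Longrightarrow> k \<le> n \<Longrightarrow> eq_X m k u v"
proof (rotate_tac, induction n rule: dec_induct)
  case (step n)
  then show ?case using eq_mono1[of m n u v] by blast
qed

lemma eq_Y_mono: "eq_Y m n u v \<Longrightarrow> k \<le> n \<Longrightarrow> eq_Y m k u v"
proof (rotate_tac, induction n rule: dec_induct)
  case (step n)
  then show ?case using eq_mono1[of m n u v] by blast
qed

lemma eq_WI_mono: "eq_WI m n u v \<Longrightarrow> k \<le> n \<Longrightarrow> eq_WI m k u v"
proof (rotate_tac, induction n rule: dec_induct)
  case (step n)
  then show ?case using eq_WI_mono1[of m n u v] by blast
qed

text \<open>A letter that is new in \<open>x\<close> has the left factor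
  \<open>u @ X_left a x\<close>; the clause \<open>eq_Y m n u v\<close> in the definition of
  \<open>eq_X\<close> covers this case. For \<open>eq_Y\<close> the corresponding factor
  \<open>u @ Y_left a x\<close> stays on the same level, so the relation between \<open>u\<close>
  and \<open>v\<close> itself is used with its depth lowered by one.\<close>

lemma eq_append_right:
  "(eq_X m n u v \<longrightarrow> eq_X m n (u @ x) (v @ x)) \<and> (eq_Y m n u v \<longrightarrow> eq_Y m n (u @ x) (v @ x))"
proof (induction n arbitrary: m u v x)
  case (Suc n)
  show ?case
  proof (cases m)
    case m: (Suc k)
    have "eq_X m (Suc n) (u @ x) (v @ x)" if "eq_X m (Suc n) u v"
    proof -
      note d = eq_XD[OF that[unfolded m]]
      have "eq_Y k n (X_left a (u @ x)) (X_left a (v @ x)) \<and>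
        eq_X (Suc k) n (X_right a (u @ x)) (X_right a (v @ x))" if "a \<in> set (u @ x)" for a
        using that Suc.IH d by (cases "a \<in> set u") (auto simp: X_append_in X_append_notin eq_refl)
      then show ?thesis unfolding m using d Suc.IH by (intro eq_XI) auto
    qed
    moreover have "eq_Y m (Suc n) (u @ x) (v @ x)" if uv: "eq_Y m (Suc n) u v"
    proof -
      note d = eq_YD[OF uv[unfolded m]]
      have uv': "eq_Y (Suc k) n u v" using eq_mono1[of "Suc k" n u v] uv m by blast
      have "eq_Y (Suc k) n (Y_left a (u @ x)) (Y_left a (v @ x)) \<and>
        eq_X k n (Y_right a (u @ x)) (Y_right a (v @ x))" if "a \<in> set (u @ x)" for a
        using that Suc.IH d uv'
        by (cases "a \<in> set x") (auto simp: Y_append_in Y_append_notin eq_refl)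
      then show ?thesis unfolding m using d Suc.IH by (intro eq_YI) auto
    qed
    ultimately show ?thesis by blast
  qed simp
qed simp

lemmas eq_X_append_right = eq_append_right[THEN conjunct1, rule_format]
  and eq_Y_append_right = eq_append_right[THEN conjunct2, rule_format]

lemma eq_X_append_left: "eq_X m n u v \<Longrightarrow> eq_X m n (x @ u) (x @ v)"
  using eq_Y_append_right[of m n "rev u" "rev v" "rev x"] by (simp flip: eq_Y_rev)

lemma eq_Y_append_left: "eq_Y m n u v \<Longrightarrow> eq_Y m n (x @ u) (x @ v)"
  using eq_X_append_right[of m n "rev u" "rev v" "rev x"] by (simp flip: eq_X_rev)

text \<open>Only one case crosses the seam: the last \<open>b\<close> in \<open>u\<close> and the
  first \<open>a\<close> in \<open>x\<close>. The factor then starts with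
  \<open>Y_right b u\<close>, which the relation controls one level below, as it does the middle
  factors.\<close>

lemma C_mid_append:
  assumes "a \<in> set (u @ x)" "b \<in> set (u @ x)"
  shows "C_mid a b (u @ x) =
    (if b \<in> set x then if a \<in> set u then None else C_mid a b x
     else if a \<in> set u then C_mid a b u else Some (Y_right b u @ X_left a x))"
proof -
  consider (1) "b \<in> set x" "a \<in> set u" | (2) "b \<in> set x" "a \<notin> set u" "a \<in> set x"
    | (3) "b \<notin> set x" "a \<in> set u" "b \<in> set u" | (4) "b \<notin> set x" "b \<in> set u" "a \<notin> set u" "a \<in> set x"
    using assms by auto
  then show ?thesis
  proof cases
    case 1
    then show ?thesis using assms by (simp add: C_mid_None Y_append_in)
  next
    case 2
    show ?thesis
    proof (cases "a = b \<or> a \<in> set (Y_left b x)")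
      case True
      then show ?thesis using 2 assms C_mid_None[of a "u @ x" b] C_mid_None[of a x b]
        by (auto simp: Y_append_in)
    next
      case False
      with 2 obtain p c y where "x = p @ b # c @ a # y" "b \<notin> set c" "b \<notin> set y" "a \<notin> set p"
        "a \<notin> set c" "C_mid a b x = Some c"
        using C_mid_Some[of a x b] by metis
      then show ?thesis using C_mid_decomp[of b c y a "u @ p"] False 2 by simp
    qed
  next
    case 3
    show ?thesis
    proof (cases "a = b \<or> a \<in> set (Y_left b u)")
      case True
      then show ?thesis using 3 assms C_mid_None[of a "u @ x" b] C_mid_None[of a u b]
        by (auto simp: Y_append_notin)
    next
      case False
      with 3 obtain p c y where "u = p @ b # c @ a # y" "b \<notin> set c" "b \<notin> set y" "a \<notin> set p"
        "a \<notin> set c" "C_mid a b u = Some c"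
        using C_mid_Some[of a u b] by metis
      then show ?thesis using C_mid_decomp[of b c "y @ x" a p] False 3 by simp
    qed
  next
    case 4
    have u: "u = Y_left b u @ b # Y_right b u" "b \<notin> set (Y_right b u)" using Y_split 4 by metis+
    have x: "x = X_left a x @ a # X_right a x" "a \<notin> set (X_left a x)" using X_split 4 by metis+
    have s: "b \<notin> set (X_left a x)" "b \<notin> set (X_right a x)"
      "a \<notin> set (Y_left b u)" "a \<notin> set (Y_right b u)"
      using 4 set_X_left[of a x] set_X_right[of a x] set_Y_left[of b u] set_Y_right[of b u]
        by auto
    have "a \<noteq> b" using 4 by auto
    then have "C_mid a b (Y_left b u @ b # (Y_right b u @ X_left a x) @ a # X_right a x)
      = Some (Y_right b u @ X_left a x)"
      using s u x by (intro C_mid_decomp) auto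
    moreover have "Y_left b u @ b # (Y_right b u @ X_left a x) @ a # X_right a x = u @ x"
      using u(1) x(1) by (metis append.assoc append_Cons)
    ultimately show ?thesis using 4 by simp
  qed
qed

text \<open>Unlike \<open>eq_X\<close>, the relation \<open>eq_WI\<close> has no clause comparing
  \<open>u\<close> and \<open>v\<close> themselves one level below. The congruence proof recovers
  this comparison from monotonicity in the level.\<close>

lemma eq_WI_level1:
  fixes u :: "'a list"
  shows "eq_WI (Suc m) n u v \<Longrightarrow> eq_WI m n u v"
proof (induction n arbitrary: m u v)
  case (Suc n)
  show ?case
  proof (cases m)
    case m: (Suc k)
    have "rel_option (eq_WI k n) x y" if "rel_option (eq_WI (Suc k) n) x y"
      for x y :: "'a list option"
      by (rule rel_option_mono[OF _ that]) (rule Suc.IH)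
    then show ?thesis using eq_WID[OF Suc.prems[unfolded m]]
      unfolding m by (intro eq_WII) (simp_all add: Suc.IH)
  qed simp
qed simp

lemma eq_WI_append_right:
  fixes u :: "'a list"
  shows "eq_WI m n u v \<Longrightarrow> eq_WI m n (u @ x) (v @ x)"
proof (induction n arbitrary: m u v x)
  case (Suc n)
  show ?case
  proof (cases m)
    case m: (Suc k)
    note d = eq_WID[OF Suc.prems[unfolded m]]
    have uv: "eq_WI (Suc k) n u v" "eq_WI k n u v"
      using eq_WI_mono1[OF Suc.prems] eq_WI_level1 unfolding m by blast+
    have X: "eq_WI k n (X_left a (u @ x)) (X_left a (v @ x)) \<and>
      eq_WI (Suc k) n (X_right a (u @ x)) (X_right a (v @ x))" if "a \<in> set (u @ x)" for a
      using that Suc.IH d uv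
      by (cases "a \<in> set u") (auto simp: X_append_in X_append_notin eq_WI_refl)
    have Y: "eq_WI (Suc k) n (Y_left a (u @ x)) (Y_left a (v @ x)) \<and>
      eq_WI k n (Y_right a (u @ x)) (Y_right a (v @ x))" if "a \<in> set (u @ x)" for a
      using that Suc.IH d uv
      by (cases "a \<in> set x") (auto simp: Y_append_in Y_append_notin eq_WI_refl)
    have C: "rel_option (eq_WI k n) (C_mid a b (u @ x)) (C_mid a b (v @ x))"
      if "a \<in> set (u @ x)" "b \<in> set (u @ x)" for a b
    proof -
      have *: "a \<in> set (v @ x)" "b \<in> set (v @ x)" using that d(1) by auto
      have r: "rel_option (eq_WI k n) z z" for z :: "'a list option"
        by (rule option.rel_refl) (rule eq_WI_refl)
      have "b \<in> set u" if "b \<notin> set x" using that \<open>b \<in> set (u @ x)\<close> by auto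
      then show ?thesis unfolding C_mid_append[OF that] C_mid_append[OF *]
        using d(1) d(6)[of a b] Suc.IH[OF d(5)[of b], of "X_left a x"] by (simp add: r)
    qed
    show ?thesis unfolding m using d X Y C by (intro eq_WII) auto
  qed simp
qed simp

lemma eq_WI_append_left: "eq_WI m n u v \<Longrightarrow> eq_WI m n (x @ u) (x @ v)"
  using eq_WI_append_right[of m n "rev u" "rev v" "rev x"]
    by (simp flip: rev_append add: eq_WI_rev)

section \<open>Level one: subwords of bounded length\<close>

lemma subseq_Cons_X:
  "subseq (a # x) u \<longleftrightarrow> a \<in> set u \<and> subseq x (X_right a u)"
proof (cases "a \<in> set u")
  case True
  then obtain p q where u: "u = p @ a # q" "a \<notin> set p" using split_list_first by metis
  have "subseq (a # x) (p @ a # q) \<longleftrightarrow> subseq x q" using u(2) by (induction p) auto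
  then show ?thesis using u True by (simp add: X_decomp)
next
  case False
  have "\<not> subseq (a # x) u"
  proof
    assume "subseq (a # x) u"
    from list_emb_set[OF this, of a] False show False by auto
  qed
  then show ?thesis using False by simp
qed

lemma subseq_rev: "subseq (rev x) (rev u) \<longleftrightarrow> subseq x u"
proof -
  have "subseq (rev x) (rev u)" if "subseq x u" for x u :: "'a list"
    using that by (induction rule: list_emb.induct) (auto intro: list_emb_append_mono)
  from this[of "rev x" "rev u"] this show ?thesis by auto
qed

text \<open>All comparisons on level zero hold, so only the descent into \<open>X_right\<close>
  remains. Following it embeds a subword greedily, one letter per unit of depth; hence the depth is
  the length of the subwords compared.\<close>

lemma eq_X_1_iff_subseq:
  fixes u :: "'a list"
  shows "eq_X (Suc 0) n u v \<longleftrightarrow> (\<forall>x. length x \<le> n \<longrightarrow> subseq x u = subseq x v)"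
proof (induction n arbitrary: u v)
  case (Suc n)
  show ?case
  proof
    assume *: "eq_X (Suc 0) (Suc n) u v"
    show "\<forall>x. length x \<le> Suc n \<longrightarrow> subseq x u = subseq x v"
    proof (intro allI impI)
      fix x :: "'a list" assume "length x \<le> Suc n"
      then show "subseq x u = subseq x v"
        using eq_XD[OF *] Suc.IH by (cases x) (auto simp: subseq_Cons_X)
    qed
  next
    assume *: "\<forall>x. length x \<le> Suc n \<longrightarrow> subseq x u = subseq x v"
    have "set u = set v"
      using *[rule_format, of "[a]" for a] by (auto simp: subseq_Cons_X)
    moreover have "eq_X (Suc 0) n (X_right a u) (X_right a v)" if "a \<in> set u" "a \<in> set v" for a
      using *[rule_format, of "a # x" for x] that Suc.IH by (auto simp: subseq_Cons_X)
    ultimately show "eq_X (Suc 0) (Suc n) u v" by (intro eq_XI) auto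
  qed
qed simp

text \<open>Reversal exchanges \<open>X\<close> and \<open>Y\<close>, while comparing all short
  subwords is insensitive to it.\<close>

lemma eq_Y_1_iff_eq_X_1: "eq_Y (Suc 0) n u v \<longleftrightarrow> eq_X (Suc 0) n u v"
  unfolding eq_X_rev[symmetric, of "Suc 0"] eq_X_1_iff_subseq
  by (metis length_rev rev_rev_ident subseq_rev)

lemma rel_option_trivial: "rel_option (eq_WI 0 n) x y \<longleftrightarrow> (x = None \<longleftrightarrow> y = None)"
  by (cases x; cases y) auto

lemma C_mid_None_iff:
  assumes "a \<in> set w" "b \<in> set w"
  shows "C_mid a b w = None \<longleftrightarrow> a = b \<or> a \<in> set (Y_left b w)"
  using assms C_mid_None C_mid_Some by (metis option.distinct(1))

text \<open>On level one, middle factors matter only through their definedness. This depends on the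
  alphabet of \<open>Y_left b\<close>, which becomes visible after one factorization; hence one unit
  of depth is lost.\<close>

lemma eq_WI_1_if_eq_X_1: "eq_X (Suc 0) (Suc n) u v \<Longrightarrow> eq_WI (Suc 0) n u v"
proof (induction n arbitrary: u v)
  case (Suc n)
  note X = eq_XD[OF Suc.prems] 
  have "eq_Y (Suc 0) (Suc (Suc n)) u v" using Suc.prems by (simp add: eq_Y_1_iff_eq_X_1)
  note Y = eq_YD[OF this]
  show ?case
  proof (rule eq_WII)
    fix a b assume "a \<in> set u" "a \<in> set v" "b \<in> set u" "b \<in> set v"
    then show "rel_option (eq_WI 0 n) (C_mid a b u) (C_mid a b v)"
      using eq_YD(1)[OF Y(3)] by (simp add: rel_option_trivial C_mid_None_iff)
  qed (use X Y Suc.IH in \<open>auto simp: eq_Y_1_iff_eq_X_1\<close>)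
qed simp

section \<open>Finite index over a finite alphabet\<close>

definition finite_index :: "'a set \<Rightarrow> ('a list \<Rightarrow> 'a list \<Rightarrow> bool) \<Rightarrow> bool" where
  "finite_index A r \<longleftrightarrow> (\<exists>f :: 'a list \<Rightarrow> nat. finite (f ` lists A) \<and>
     (\<forall>u\<in>lists A. \<forall>v\<in>lists A. f u = f v \<longrightarrow> r u v))"

lemma finite_indexI:
  assumes "f ` lists A \<subseteq> B" "finite B"
    "\<And>u v. u \<in> lists A \<Longrightarrow> v \<in> lists A \<Longrightarrow> f u = f v \<Longrightarrow> r u v"
  shows "finite_index A r"
proof -
  obtain g :: "_ \<Rightarrow> nat" where g: "inj_on g B"
    using finite_imp_inj_to_nat_seg[OF assms(2)] by blast
  have "finite ((g \<circ> f) ` lists A)"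
    using assms finite_subset by (metis finite_imageI image_comp)
  moreover have "r u v" if "u \<in> lists A" "v \<in> lists A" "(g \<circ> f) u = (g \<circ> f) v" for u v
    using that assms(1,3) inj_onD[OF g, of "f u" "f v"] by auto
  ultimately show ?thesis unfolding finite_index_def by blast
qed

lemma finite_index_trivial: "(\<And>u v. r u v) \<Longrightarrow> finite_index A r"
  by (rule finite_indexI[of "\<lambda>_. ()" _ "{()}"]) auto

lemma X_lists: "u \<in> lists A \<Longrightarrow> X_left a u \<in> lists A" "u \<in> lists A \<Longrightarrow> X_right a u \<in> lists A"
  "u \<in> lists A \<Longrightarrow> Y_left a u \<in> lists A" "u \<in> lists A \<Longrightarrow> Y_right a u \<in> lists A"
  by (auto simp: X_left_def X_right_def Y_left_def Y_right_def dest: in_set_takeD in_set_dropD)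

lemma finite_index_eq:
  assumes "finite A"
  shows "finite_index A (eq_X m n) \<and> finite_index A (eq_Y m n)"
proof -
  have Y: "finite_index A (eq_Y m n)" if "finite_index A (eq_X m n)" for m n
  proof -
    from that obtain f :: "'a list \<Rightarrow> nat" where f: "finite (f ` lists A)"
      "\<forall>u\<in>lists A. \<forall>v\<in>lists A. f u = f v \<longrightarrow> eq_X m n u v" unfolding finite_index_def by blast
    show ?thesis
    proof (rule finite_indexI[of "f \<circ> rev" _ "f ` lists A"])
      fix u v assume "u \<in> lists A" "v \<in> lists A" "(f \<circ> rev) u = (f \<circ> rev) v"
      then show "eq_Y m n u v" using f(2)[rule_format, of "rev u" "rev v"]
        by (simp add: eq_X_rev in_lists_conv_set)
    qed (use f(1) in auto)
  qed
  have "finite_index A (eq_X m n)"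
  proof (induction n arbitrary: m)
    case 0
    show ?case by (simp add: finite_index_trivial)
  next
    case (Suc n)
    show ?case
    proof (cases m)
      case 0
      then show ?thesis by (simp add: finite_index_trivial)
    next
      case m: (Suc k)
      obtain f g :: "'a list \<Rightarrow> nat" where
        f: "finite (f ` lists A)" "\<And>u v. u \<in> lists A \<Longrightarrow> v \<in> lists A \<Longrightarrow> f u = f v \<Longrightarrow> eq_Y k n u v" and
        g: "finite (g ` lists A)" "\<And>u v. u \<in> lists A \<Longrightarrow> v \<in> lists A \<Longrightarrow> g u = g v \<Longrightarrow> eq_X (Suc k) n u v"
        using Suc.IH[of "Suc k"] Y[OF Suc.IH[of k]] unfolding finite_index_def by blast
      \<comment> \<open>The colour at depth \<open>n + 1\<close> records the alphabet of
        \<open>u\<close>, the colour of \<open>u\<close> itself one level below, and the colours at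
        depth \<open>n\<close> of its factors. Restricting the last component to letters of
        \<open>A\<close> keeps the set of colours finite.\<close>
      let ?h = "\<lambda>u. (set u, f u, \<lambda>a\<in>A. (f (X_left a u), g (X_right a u)))"
      let ?B = "Pow A \<times> f ` lists A \<times> (\<Pi>\<^sub>E a\<in>A. f ` lists A \<times> g ` lists A)"
      show ?thesis
      proof (rule finite_indexI[of ?h _ ?B])
        show "?h ` lists A \<subseteq> ?B"
        proof (rule image_subsetI)
          fix u assume u: "u \<in> lists A"
          then have "set u \<in> Pow A" by auto
          then show "?h u \<in> ?B" using u by (simp add: imageI X_lists del: in_lists_conv_set)
        qed
        show "finite ?B" using assms f(1) g(1) by (intro finite_cartesian_product finite_PiE) auto
        fix u v assume uv: "u \<in> lists A" "v \<in> lists A" "?h u = ?h v"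
        have h: "snd (snd (?h u)) = snd (snd (?h v))" using uv(3) by simp
        have "f (X_left a u) = f (X_left a v) \<and> g (X_right a u) = g (X_right a v)"
          if "a \<in> set u" for a
        proof -
          have "a \<in> A" using uv(1) that by auto
          then show ?thesis using fun_cong[OF h, of a] by simp
        qed
        then show "eq_X m (Suc n) u v"
          unfolding m using uv(3)
          by (intro eq_XI) (simp_all add: f(2) g(2) X_lists uv(1,2) del: in_lists_conv_set)
      qed
    qed
  qed
  then show ?thesis using Y by blast
qed

lemma C_mid_lists: "u \<in> lists A \<Longrightarrow> C_mid a b u = Some c \<Longrightarrow> c \<in> lists A"
  by (auto simp: C_mid_def split: if_splits dest!: in_set_dropD in_set_takeD)

lemma finite_index_eq_WI:
  assumes "finite A"
  shows "finite_index A (eq_WI m n)"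
proof (induction n arbitrary: m)
  case 0
  show ?case by (simp add: finite_index_trivial)
next
  case (Suc n)
  show ?case
  proof (cases m)
    case 0
    then show ?thesis by (simp add: finite_index_trivial)
  next
    case m: (Suc k)
    obtain f g :: "'a list \<Rightarrow> nat" where
      f: "finite (f ` lists A)" "\<And>u v. u \<in> lists A \<Longrightarrow> v \<in> lists A \<Longrightarrow> f u = f v \<Longrightarrow> eq_WI k n u v" and
      g: "finite (g ` lists A)" "\<And>u v. u \<in> lists A \<Longrightarrow> v \<in> lists A \<Longrightarrow> g u = g v \<Longrightarrow> eq_WI (Suc k) n u v"
      using Suc.IH[of "Suc k"] Suc.IH[of k] unfolding finite_index_def by blast
    let ?F = "f ` lists A" and ?G = "g ` lists A"
    let ?h1 = "\<lambda>u. \<lambda>a\<in>A. (f (X_left a u), g (X_right a u), g (Y_left a u), f (Y_right a u))"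
    let ?h2 = "\<lambda>u. \<lambda>a\<in>A. \<lambda>b\<in>A. map_option f (C_mid a b u)"
    let ?h = "\<lambda>u. (set u, ?h1 u, ?h2 u)"
    let ?B1 = "\<Pi>\<^sub>E a\<in>A. ?F \<times> ?G \<times> ?G \<times> ?F"
    let ?B2 = "\<Pi>\<^sub>E a\<in>A. \<Pi>\<^sub>E b\<in>A. insert None (Some ` ?F)"
    show ?thesis
    proof (rule finite_indexI[of ?h _ "Pow A \<times> ?B1 \<times> ?B2"])
      show "?h ` lists A \<subseteq> Pow A \<times> ?B1 \<times> ?B2"
      proof (rule image_subsetI)
        fix u assume u: "u \<in> lists A"
        have "set u \<in> Pow A" using u by auto
        moreover have "?h1 u \<in> ?B1" by (simp add: imageI X_lists[OF u] del: in_lists_conv_set)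
        moreover have "map_option f (C_mid a b u) \<in> insert None (Some ` ?F)" for a b
          using u C_mid_lists[of u A a b] by (cases "C_mid a b u") auto
        then have "?h2 u \<in> ?B2" by simp
        ultimately show "?h u \<in> Pow A \<times> ?B1 \<times> ?B2" by blast
      qed
      show "finite (Pow A \<times> ?B1 \<times> ?B2)"
        using assms f(1) g(1) by (intro finite_cartesian_product finite_PiE) auto
      fix u v assume uv: "u \<in> lists A" "v \<in> lists A" "?h u = ?h v"
      have h1: "?h1 u = ?h1 v" and h2: "?h2 u = ?h2 v" using uv(3) by (simp_all only: prod.inject)
      have S: "a \<in> A" if "a \<in> set u" for a using uv that by auto
      have 1: "f (X_left a u) = f (X_left a v) \<and> g (X_right a u) = g (X_right a v) \<and>
        g (Y_left a u) = g (Y_left a v) \<and> f (Y_right a u) = f (Y_right a v)"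
        if "a \<in> set u" for a
        using S[OF that] fun_cong[OF h1, of a] by simp
      have 2: "rel_option (eq_WI k n) (C_mid a b u) (C_mid a b v)" if "a \<in> set u" "b \<in> set u"
        for a b
      proof -
        have "map_option f (C_mid a b u) = map_option f (C_mid a b v)"
          using S that fun_cong[OF fun_cong[OF h2, of a], of b] by simp
        then show ?thesis using f(2) uv C_mid_lists[of _ A a b]
          by (cases "C_mid a b u"; cases "C_mid a b v") auto
      qed
      show "eq_WI m (Suc n) u v"
        unfolding m using uv(3)
        by (intro eq_WII) (simp_all add: 1 2 f(2) g(2) X_lists uv(1,2) del: in_lists_conv_set)
    qed
  qed
qed

section \<open>Comparing \<open>eq_WI\<close> with \<open>eq_X\<close> and \<open>eq_Y\<close> one
  level above\<close>

inductive prefix_pair :: "nat \<Rightarrow> 'a list \<Rightarrow> 'a list \<Rightarrow> 'a list \<Rightarrow> 'a list \<Rightarrow> bool" where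
  whole: "prefix_pair j u u v v"
| first: "a \<in> set u \<Longrightarrow> a \<in> set v \<Longrightarrow> prefix_pair j u (X_left a u) v (X_left a v)"
| last: "prefix_pair j u p v q \<Longrightarrow> c \<in> set p \<Longrightarrow> c \<in> set q \<Longrightarrow>
    prefix_pair (Suc j) u (Y_left c p) v (Y_left c q)"

lemma prefix_pair_prefix:
  "prefix_pair j u p v q \<Longrightarrow> (\<exists>s. u = p @ s) \<and> (\<exists>t. v = q @ t)"
proof (induction rule: prefix_pair.induct)
  case (first a u v j)
  then show ?case by (metis X_split(1))
next
  case (last j u p v q c)
  then obtain s t where "u = p @ s" "v = q @ t" by blast
  then show ?case using Y_split(1)[of c p] Y_split(1)[of c q] last(2,3)
    by (metis append.assoc)
qed auto

lemma prefix_pair_X_left: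
  assumes "prefix_pair j u p v q" "d \<in> set p" "d \<in> set q"
  shows "X_left d p = X_left d u" "X_left d q = X_left d v" "d \<in> set u" "d \<in> set v"
  using prefix_pair_prefix[OF assms(1)] assms(2,3) by (auto simp: X_append_in)

lemma X_right_X_left:
  assumes "a \<in> set u" "d \<in> set (X_left a u)"
  shows "X_right d (X_left a u) = X_left a (X_right d u)" "a \<in> set (X_right d u)"
proof -
  let ?l = "X_left a u" and ?r = "X_right a u"
  have u: "u = ?l @ a # ?r" "a \<notin> set ?l" using X_split assms(1) by metis+
  have "X_right d (?l @ a # ?r) = X_right d ?l @ a # ?r" using assms(2) by (simp add: X_append_in)
  then have *: "X_right d u = X_right d ?l @ a # ?r" using u(1) by simp
  moreover have "a \<notin> set (X_right d ?l)" using u(2) set_X_right assms(2) by fastforce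
  ultimately show "X_right d (X_left a u) = X_left a (X_right d u)" "a \<in> set (X_right d u)"
    by (simp_all add: X_decomp)
qed

lemma X_right_Y_left:
  assumes "c \<in> set p" "d \<in> set (Y_left c p)"
  shows "X_right d (Y_left c p) = Y_left c (X_right d p)" "c \<in> set (X_right d p)"
proof -
  let ?l = "Y_left c p" and ?r = "Y_right c p"
  have u: "p = ?l @ c # ?r" "c \<notin> set ?r" using Y_split assms(1) by metis+
  have "X_right d (?l @ c # ?r) = X_right d ?l @ c # ?r" using assms(2) by (simp add: X_append_in)
  then have *: "X_right d p = X_right d ?l @ c # ?r" using u(1) by simp
  then show "X_right d (Y_left c p) = Y_left c (X_right d p)" "c \<in> set (X_right d p)"
    using u(2) by (simp_all add: Y_decomp)
qed

lemma prefix_pair_X_right: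
  "prefix_pair j u p v q \<Longrightarrow> d \<in> set p \<Longrightarrow> d \<in> set q \<Longrightarrow>
    prefix_pair j (X_right d u) (X_right d p) (X_right d v) (X_right d q)"
proof (induction rule: prefix_pair.induct)
  case (last j u p v q c)
  have "d \<in> set p" "d \<in> set q" using last set_Y_left by fastforce+
  then show ?case using last X_right_Y_left[of c p d] X_right_Y_left[of c q d]
    by (simp add: prefix_pair.last)
qed (auto intro: prefix_pair.intros simp: X_right_X_left)

text \<open>The index \<open>j\<close> bounds the number of cuts at last occurrences. The cases
  \<open>whole\<close> and \<open>first\<close> are the two \<open>eq_Y\<close> clauses of
  \<open>eq_X\<close>; every later cut stays inside \<open>eq_Y\<close> and costs one unit of depth,
  so \<open>j\<close> units are paid in advance.\<close>

lemma prefix_pair_eq_Y: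
  "prefix_pair j u p v q \<Longrightarrow> eq_X (Suc (Suc k)) (Suc (n + j)) u v \<Longrightarrow> eq_Y (Suc k) n p q"
proof (induction arbitrary: n rule: prefix_pair.induct)
  case (whole j u v)
  then have "eq_Y (Suc k) (n + j) u v" by (rule eq_XD(2))
  then show ?case by (rule eq_Y_mono) simp
next
  case (first a u v j)
  have "eq_Y (Suc k) (n + j) (X_left a u) (X_left a v)" using eq_XD(3)[OF first(3,1)] .
  then show ?case by (rule eq_Y_mono) simp
next
  case (last j u p v q c)
  then have "eq_Y (Suc k) (Suc n) p q" by simp
  from eq_YD(3)[OF this last.hyps(2)] show ?case .
qed

text \<open>Why an \<open>X\<close>-factorization at one level more controls comparisons: the factor between the last
  \<open>b\<close> and the first \<open>a\<close> of a prefix \<open>p\<close> of \<open>u\<close> is \<open>Y_right b (X_left a u)\<close>, and the reversed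
  statement one level below applies to \<open>X_left a u\<close>. Allowing prefixes instead of \<open>u\<close> alone is
  what makes this recursion close.\<close>

lemma eq_WI_prefix_pair:
  "prefix_pair j u p v q \<Longrightarrow> eq_X (Suc m) (n + 2 + j) u v \<Longrightarrow> eq_WI m n p q"
proof (induction n arbitrary: m j u p v q)
  case (Suc n)
  show ?case
  proof (cases m)
    case m: (Suc k)
    note pp = Suc.prems(1)
    have Y: "eq_Y (Suc k) (Suc (Suc n)) p q"
      by (rule prefix_pair_eq_Y[OF pp]) (use Suc.prems(2) in \<open>simp add: m\<close>)
    note d = eq_YD[OF Y]
    have X: "eq_X (Suc (Suc k)) (Suc (n + 2 + j)) u v" using Suc.prems(2) by (simp add: m)
    \<comment> \<open>Reversal turns \<open>eq_Y (Suc k)\<close> into \<open>eq_X (Suc k)\<close>,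
      to which the induction hypothesis applies on level \<open>k\<close>, one below the
      goal.\<close>
    have dual: "eq_WI k n z z'" if "eq_Y (Suc k) (n + 2) z z'" for z z' :: "'a list"
    proof -
      have "eq_WI k n (rev z) (rev z')"
        by (rule Suc.IH[OF whole[of 0]]) (use that in \<open>simp add: eq_X_rev\<close>)
      then show ?thesis by (simp add: eq_WI_rev)
    qed
    have dual': "eq_WI k n (Y_right c z) (Y_right c z')"
      if "eq_Y (Suc k) (n + 2) z z'" "c \<in> set z" "c \<in> set z'" for c and z z' :: "'a list"
    proof -
      have "eq_WI k n (X_left c (rev z)) (X_left c (rev z'))"
        by (rule Suc.IH[OF first[of c _ _ 0]]) (use that in \<open>simp_all add: eq_X_rev\<close>)
      then show ?thesis using that by (simp add: X_rev eq_WI_rev)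
    qed
    have left: "eq_Y (Suc k) (n + 2) (X_left a p) (X_left a q)" if "a \<in> set p" "a \<in> set q" for a
      using prefix_pair_X_left[OF pp that] eq_XD(3)[OF X] eq_Y_mono le_add1 by metis
    show ?thesis unfolding m
    proof (rule eq_WII)
      show "set p = set q" by (rule d(1))
    next
      fix a assume a: "a \<in> set p" "a \<in> set q"
      show "eq_WI k n (X_left a p) (X_left a q)" using dual left a by blast
      show "eq_WI (Suc k) n (X_right a p) (X_right a q)"
        using Suc.IH[OF prefix_pair_X_right[OF pp a]] eq_XD(4)[OF X] prefix_pair_X_left[OF pp a]
        by blast
      \<comment> \<open>The new cut raises \<open>j\<close> while the depth drops, and
        \<open>Suc n + 2 + j = n + 2 + Suc j\<close>, so the same relation between \<open>u\<close>
        and \<open>v\<close> still suffices.\<close>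
      show "eq_WI (Suc k) n (Y_left a p) (Y_left a q)"
        using Suc.IH[OF prefix_pair.last[OF pp a]] X by simp
      show "eq_WI k n (Y_right a p) (Y_right a q)" using dual'[OF _ a] Y by simp
    next
      fix a b assume ab: "a \<in> set p" "a \<in> set q" "b \<in> set p" "b \<in> set q"
      have s: "set (Y_left b p) = set (Y_left b q)"
        using d(3) ab eq_YD(1) by blast
      show "rel_option (eq_WI k n) (C_mid a b p) (C_mid a b q)"
      proof (cases "a = b \<or> a \<in> set (Y_left b p)")
        case True
        then show ?thesis using C_mid_None[of a p b] C_mid_None[of a q b] ab s by simp
      next
        case False
        have C: "C_mid a b w = Some (Y_right b (X_left a w)) \<and> b \<in> set (X_left a w)"
          if w: "a \<in> set w" "b \<in> set w" "a \<noteq> b" "a \<notin> set (Y_left b w)" for w :: "'a list"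
        proof -
          obtain x c y where "w = x @ b # c @ a # y" "b \<notin> set c" "b \<notin> set y" "a \<notin> set x" "a \<notin> set c"
            "C_mid a b w = Some c" by (rule C_mid_Some[OF w])
          then show ?thesis using X_decomp[of a "x @ b # c" y] w(3) by (simp add: Y_decomp)
        qed
        show ?thesis using C[of p] C[of q] ab False s dual'[OF left, of a b] by auto
      qed
    qed
  qed simp
qed simp

corollary eq_WI_if_eq_X: "eq_X (Suc m) (n + 2) u v \<Longrightarrow> eq_WI m n u v"
  using eq_WI_prefix_pair[OF whole[of 0]] by simp

corollary eq_WI_if_eq_Y: "eq_Y (Suc m) (n + 2) u v \<Longrightarrow> eq_WI m n u v"
  using eq_WI_if_eq_X[of m n "rev u" "rev v"] by (simp add: eq_X_rev eq_WI_rev)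

text \<open>By \<open>eq_YD\<close> the right factors are only related by \<open>eq_X m\<close>,
  which yields \<open>eq_WI\<close> one level lower than claimed. Reversed, however, these factors
  are the prefixes before the first \<open>a\<close>, and as a prefix pair of the reversed words
  they keep the level.\<close>

corollary eq_WI_Y_right_if_eq_Y:
  assumes "eq_Y (Suc m) (n + 2) u v" "a \<in> set u" "a \<in> set v"
  shows "eq_WI m n (Y_right a u) (Y_right a v)"
  using eq_WI_prefix_pair[OF first[of a "rev u" "rev v" 0], of m n] assms
  by (simp add: eq_X_rev eq_WI_rev X_rev)

section \<open>Words behind a high power\<close>

abbreviation power_word :: "'a list \<Rightarrow> nat \<Rightarrow> 'a list" where
  "power_word e k \<equiv> concat (replicate k e)"

lemma set_power_word: "set (power_word e k) \<subseteq> set e"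
  by (induction k) auto

text \<open>Each letter of the whole word already occurs in \<open>p @ e\<close>. So left factors
  coincide, and right factors have the same shape again, with the rest of \<open>p @ e\<close> as
  new \<open>p\<close> and one copy of \<open>e\<close> less. The free prefix \<open>p\<close>
  absorbs these remainders.\<close>

lemma eq_X_after_power:
  assumes "set u \<subseteq> set e" "set v \<subseteq> set e"
  shows "eq_Y m k u v \<Longrightarrow> eq_X (Suc m) k (p @ power_word e k @ u) (p @ power_word e k @ v)"
proof (induction k arbitrary: p)
  case (Suc k)
  let ?w = "\<lambda>u. (p @ e) @ power_word e k @ u"
  have s: "set (?w u) = set (p @ e)" "set (?w v) = set (p @ e)"
    using assms set_power_word[of k e] by auto
  have "eq_X (Suc m) (Suc k) (?w u) (?w v)"
  proof (rule eq_XI)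
    show "set (?w u) = set (?w v)" using s by simp
    show "eq_Y m k (?w u) (?w v)"
      using eq_Y_append_left[OF eq_Y_mono[OF Suc.prems, of k], of "(p @ e) @ power_word e k"]
        by simp
    fix a assume "a \<in> set (?w u)"
    then have a: "a \<in> set (p @ e)" using s by blast
    show "eq_Y m k (X_left a (?w u)) (X_left a (?w v))"
      unfolding X_append_in[OF a] by (simp add: eq_refl)
    show "eq_X (Suc m) k (X_right a (?w u)) (X_right a (?w v))"
      unfolding X_append_in[OF a] by (intro Suc.IH eq_Y_mono[OF Suc.prems]) simp
  qed
  then show ?case by simp
qed simp

text \<open>The exponent exceeds the depth strictly: behind the copy of \<open>e\<close> that a
  factorization consumes, one more must remain to make \<open>C_mid\<close> independent of
  \<open>u\<close> and \<open>v\<close>. A cut at a last occurrence inside \<open>u\<close> keeps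
  the power and lowers the depth; what stands behind such a cut is compared one level below, for
  which depth \<open>n + 2\<close> of \<open>eq_Y\<close> is enough.\<close>

lemma eq_WI_after_power:
  assumes "n < k" "set u \<subseteq> set e" "set v \<subseteq> set e" "eq_Y (Suc m) (n + 2) u v"
  shows "eq_WI (Suc m) n (p @ power_word e k @ u) (p @ power_word e k @ v)"
  using assms
proof (induction n arbitrary: k u v p)
  case (Suc n)
  obtain l where k: "k = Suc (Suc l)" using Suc.prems(1) by (cases k; cases "k - 1") auto
  let ?w = "\<lambda>u. (p @ e) @ power_word e (Suc l) @ u"
  have s: "set (?w u) = set (p @ e)" "set (?w v) = set (p @ e)"
    using Suc.prems(2,3) set_power_word[of "Suc l" e] by auto
  have Y: "eq_Y (Suc m) (Suc (n + 2)) u v" using Suc.prems(4) by simp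
  note d = eq_YD[OF Y]
  have suffix: "eq_WI m n (x @ u) (x @ v)" for x
    by (rule eq_WI_if_eq_Y[OF eq_Y_append_left[OF eq_Y_mono[OF Y]]]) simp
  have "eq_WI (Suc m) (Suc n) (?w u) (?w v)"
  proof (rule eq_WII)
    show "set (?w u) = set (?w v)" using s by simp
  next
    fix a assume "a \<in> set (?w u)"
    then have a: "a \<in> set (p @ e)" using s by blast
    show "eq_WI m n (X_left a (?w u)) (X_left a (?w v))"
      unfolding X_append_in[OF a] by (rule eq_WI_refl)
    show "eq_WI (Suc m) n (X_right a (?w u)) (X_right a (?w v))"
      unfolding X_append_in[OF a] using Suc.prems k eq_Y_mono[OF Y]
      by (intro Suc.IH) auto
    let ?x = "(p @ e) @ power_word e (Suc l)"
    have x: "a \<in> set ?x" using a by auto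
    have "eq_WI (Suc m) n (Y_left a (?x @ u)) (Y_left a (?x @ v)) \<and>
      eq_WI m n (Y_right a (?x @ u)) (Y_right a (?x @ v))"
    proof (cases "a \<in> set u")
      case True
      then have v: "a \<in> set v" using d(1) by simp
      have "eq_WI (Suc m) n (p @ power_word e k @ Y_left a u) (p @ power_word e k @ Y_left a v)"
        using Suc.prems set_Y_left[OF True] set_Y_left[OF v] d(3)[OF True]
        by (intro Suc.IH) auto
      moreover have "eq_WI m n (Y_right a u) (Y_right a v)"
        by (rule eq_WI_Y_right_if_eq_Y[OF eq_Y_mono[OF Y] True v]) simp
      ultimately show ?thesis unfolding Y_append_in[OF True] Y_append_in[OF v] by (simp add: k)
    next
      case False
      then have v: "a \<notin> set v" using d(1) by simp
      show ?thesis unfolding Y_append_notin[OF x False] Y_append_notin[OF x v]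
        using suffix eq_WI_refl by blast
    qed
    then show "eq_WI (Suc m) n (Y_left a (?w u)) (Y_left a (?w v))"
      "eq_WI m n (Y_right a (?w u)) (Y_right a (?w v))" by simp_all
  next
    fix a b assume "a \<in> set (?w u)" "b \<in> set (?w u)"
    then have ab: "a \<in> set (p @ e)" "b \<in> set (p @ e)" using s by blast+
    \<comment> \<open>A letter \<open>b\<close> of \<open>e\<close> recurs behind
      \<open>p @ e\<close> and thus behind the first \<open>a\<close>. Any other \<open>b\<close>
      occurs in \<open>p\<close> only, so the factor is already determined inside
      \<open>p @ e\<close>. In both cases \<open>z\<close> has no influence.\<close>
    have C: "C_mid a b (?w z) = (if b \<in> set e then None else C_mid a b (p @ e))"
      if "set z \<subseteq> set e" for z
    proof -
      have "b \<in> set (power_word e (Suc l) @ z) \<longleftrightarrow> b \<in> set e"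
        using that set_power_word[of "Suc l" e] by auto
      then show ?thesis using ab C_mid_append[of a "p @ e" "power_word e (Suc l) @ z" b] by auto
    qed
    have r: "rel_option (eq_WI m n) z z" for z :: "'a list option"
      by (rule option.rel_refl) (rule eq_WI_refl)
    show "rel_option (eq_WI m n) (C_mid a b (?w u)) (C_mid a b (?w v))"
      unfolding C[OF Suc.prems(2)] C[OF Suc.prems(3)] by (rule r)
  qed
  then show ?case by (simp add: k)
qed simp

section \<open>Quotients and division of monoids\<close>

definition opposite :: "'a monoid \<Rightarrow> 'a monoid" where
  "opposite M = M\<lparr>mult := \<lambda>x y. y \<otimes>\<^bsub>M\<^esub> x\<rparr>"

lemma opposite_simps [simp]:
  "carrier (opposite M) = carrier M" "x \<otimes>\<^bsub>opposite M\<^esub> y = y \<otimes>\<^bsub>M\<^esub> x"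
  "\<one>\<^bsub>opposite M\<^esub> = \<one>\<^bsub>M\<^esub>" "opposite (opposite M) = M"
  "idempotents (opposite M) = idempotents M"
  by (simp_all add: opposite_def idempotents_def)

lemma monoid_opposite: "monoid M \<Longrightarrow> monoid (opposite M)"
  by (rule monoidI) (auto simp: monoid.m_closed monoid.m_assoc)

lemma finite_monoid_opposite [simp]: "finite_monoid (opposite M) = finite_monoid M"
  unfolding finite_monoid_def using monoid_opposite opposite_simps(1,4) by metis

lemma green_L_eq: "green_L M = green_R (opposite M)"
  by (intro ext) (simp add: green_L_def green_R_def l_coset_def r_coset_def)

lemma sim_D_eq: "sim_D M = sim_K (opposite M)"
  by (intro ext) (simp add: sim_D_def sim_K_def green_L_eq)

lemma quotient_monoid_opposite: "quotient_monoid (opposite M) r = opposite (quotient_monoid M r)"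
  by (auto simp: quotient_monoid_def opposite_def Let_def set_mult_def fun_eq_iff)

lemma iso_opposite: "M \<cong> N \<Longrightarrow> opposite M \<cong> opposite N"
  by (auto simp: is_iso_def iso_def hom_def)

locale fin_monoid =
  fixes M :: "'a monoid" (structure)
  assumes finite_monoid: "finite_monoid M"
begin

sublocale monoid M
  using finite_monoid by (simp add: finite_monoid_def)

lemma finite_carrier: "finite (carrier M)"
  using finite_monoid by (simp add: finite_monoid_def)

lemma fin_monoid_opposite: "fin_monoid (opposite M)"
  by unfold_locales (simp add: finite_monoid)

lemma idempotent_power:
  assumes x: "x \<in> carrier M"
  shows "\<exists>k>0. x [^] (k::nat) \<otimes> x [^] k = x [^] k"
proof -
  have "\<not> inj_on (\<lambda>i::nat. x [^] i) UNIV"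
    using finite_carrier x finite_imageD[of "\<lambda>i::nat. x [^] i" UNIV]
    by (metis (no_types, lifting) finite_subset image_subset_iff infinite_UNIV_nat nat_pow_closed)
  then obtain i j :: nat where "i < j" "x [^] i = x [^] j"
    unfolding inj_on_def by (metis nat_neq_iff)
  then obtain p where p: "p > 0" "x [^] (i + p) = x [^] i"
    by (metis less_imp_add_positive)
  have step: "x [^] (i + l + p) = x [^] (i + l)" for l
  proof -
    have "x [^] (i + l + p) = x [^] (i + p) \<otimes> x [^] l"
      using x by (simp add: nat_pow_mult ac_simps)
    then show ?thesis using p(2) x by (simp add: nat_pow_mult)
  qed
  have *: "x [^] (i + l + k * p) = x [^] (i + l)" for l k
  proof (induction k)
    case (Suc k)
    then show ?case using step[of "l + k * p"] by (simp add: ac_simps)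
  qed simp
  \<comment> \<open>A multiple of the period \<open>p\<close> that is at least \<open>i\<close>;
    doubling it adds \<open>Suc i\<close> whole periods.\<close>
  let ?k = "Suc i * p"
  have "i \<le> ?k" using p(1) by (cases p) auto
  then obtain l where l: "?k = i + l" using le_Suc_ex by blast
  have "x [^] ?k \<otimes> x [^] ?k = x [^] (?k + Suc i * p)" using x by (simp only: nat_pow_mult)
  also have "\<dots> = x [^] ?k" using *[of l "Suc i"] unfolding l .
  finally show ?thesis using p(1) by (intro exI[of _ ?k]) simp
qed

lemma uniform_idempotent_power:
  obtains k :: nat where "k > 0" "\<And>x. x \<in> carrier M \<Longrightarrow> x [^] k \<otimes> x [^] k = x [^] k"
proof -
  obtain f :: "'a \<Rightarrow> nat" where f: "\<And>x. x \<in> carrier M \<Longrightarrow> f x > 0"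
    "\<And>x. x \<in> carrier M \<Longrightarrow> x [^] f x \<otimes> x [^] f x = x [^] f x"
    using idempotent_power by metis
  let ?k = "\<Prod>x\<in>carrier M. f x"
  have "x [^] ?k \<otimes> x [^] ?k = x [^] ?k" if x: "x \<in> carrier M" for x
  proof -
    have k0: "?k > 0" using f(1) by (simp add: prod_pos)
    have "f x dvd ?k" using finite_carrier x by (rule dvd_prodI)
    then obtain l where l: "?k = f x * Suc l" using k0
      by (metis dvd_def mult_0_right not0_implies_Suc not_less_iff_gr_or_eq)
    have "x [^] (f x * Suc j) = x [^] f x" for j
      using f(2)[OF x] x by (induction j) (simp_all add: nat_pow_mult[symmetric])
    then show ?thesis using f(2)[OF x] l by metis
  qed
  moreover have "?k > 0" using f(1) by (simp add: prod_pos)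
  ultimately show ?thesis using that by blast
qed

end

text \<open>\<open>r_stable M s z\<close> says that \<open>s z\<close> is \<open>\<R>\<close>-equivalent to \<open>s\<close>.\<close>

definition r_stable :: "'a monoid \<Rightarrow> 'a \<Rightarrow> 'a \<Rightarrow> bool" where
  "r_stable M s z \<longleftrightarrow> (\<exists>y\<in>carrier M. s \<otimes>\<^bsub>M\<^esub> z \<otimes>\<^bsub>M\<^esub> y = s)"

abbreviation l_stable :: "'a monoid \<Rightarrow> 'a \<Rightarrow> 'a \<Rightarrow> bool" where
  "l_stable M z t \<equiv> r_stable (opposite M) t z"

definition congruence :: "'a monoid \<Rightarrow> ('a \<Rightarrow> 'a \<Rightarrow> bool) \<Rightarrow> bool" where
  "congruence M r \<longleftrightarrow>
     (\<forall>x\<in>carrier M. r x x) \<and>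
     (\<forall>x\<in>carrier M. \<forall>y\<in>carrier M. r x y \<longrightarrow> r y x) \<and>
     (\<forall>x\<in>carrier M. \<forall>y\<in>carrier M. \<forall>z\<in>carrier M. r x y \<longrightarrow> r y z \<longrightarrow> r x z) \<and>
     (\<forall>x\<in>carrier M. \<forall>y\<in>carrier M. \<forall>z\<in>carrier M. r x y \<longrightarrow>
        r (x \<otimes>\<^bsub>M\<^esub> z) (y \<otimes>\<^bsub>M\<^esub> z) \<and> r (z \<otimes>\<^bsub>M\<^esub> x) (z \<otimes>\<^bsub>M\<^esub> y))"

lemma congruence_opposite: "congruence M r \<Longrightarrow> congruence (opposite M) r"
  unfolding congruence_def opposite_simps by (elim conjE, intro conjI; (assumption | blast))

lemma congruenceD:
  assumes "congruence M r"
  shows "x \<in> carrier M \<Longrightarrow> r x x"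
    "r x y \<Longrightarrow> x \<in> carrier M \<Longrightarrow> y \<in> carrier M \<Longrightarrow> r y x"
    "r x y \<Longrightarrow> r y z \<Longrightarrow> x \<in> carrier M \<Longrightarrow> y \<in> carrier M \<Longrightarrow> z \<in> carrier M \<Longrightarrow> r x z"
    "r x y \<Longrightarrow> x \<in> carrier M \<Longrightarrow> y \<in> carrier M \<Longrightarrow> z \<in> carrier M \<Longrightarrow> r (x \<otimes>\<^bsub>M\<^esub> z) (y \<otimes>\<^bsub>M\<^esub> z)"
    "r x y \<Longrightarrow> x \<in> carrier M \<Longrightarrow> y \<in> carrier M \<Longrightarrow> z \<in> carrier M \<Longrightarrow> r (z \<otimes>\<^bsub>M\<^esub> x) (z \<otimes>\<^bsub>M\<^esub> y)"
  using assms unfolding congruence_def by meson+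

section \<open>Surjective homomorphisms and quotient monoids\<close>

definition surj_hom :: "('a \<Rightarrow> 'b) \<Rightarrow> 'a monoid \<Rightarrow> 'b monoid \<Rightarrow> bool" where
  "surj_hom q M N \<longleftrightarrow> q ` carrier M = carrier N \<and> q \<one>\<^bsub>M\<^esub> = \<one>\<^bsub>N\<^esub> \<and>
     (\<forall>x\<in>carrier M. \<forall>y\<in>carrier M. q (x \<otimes>\<^bsub>M\<^esub> y) = q x \<otimes>\<^bsub>N\<^esub> q y)"

lemma surj_hom_opposite: "surj_hom q M N \<Longrightarrow> surj_hom q (opposite M) (opposite N)"
  unfolding surj_hom_def by auto

lemma surj_hom_comp: "surj_hom f M N \<Longrightarrow> surj_hom g N K \<Longrightarrow> surj_hom (g \<circ> f) M K"
  unfolding surj_hom_def image_comp[symmetric] by (simp, blast)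

lemma surj_homD:
  assumes "surj_hom q M N"
  shows "x \<in> carrier M \<Longrightarrow> q x \<in> carrier N" "q \<one>\<^bsub>M\<^esub> = \<one>\<^bsub>N\<^esub>"
    "x \<in> carrier M \<Longrightarrow> y \<in> carrier M \<Longrightarrow> q (x \<otimes>\<^bsub>M\<^esub> y) = q x \<otimes>\<^bsub>N\<^esub> q y"
    "z \<in> carrier N \<Longrightarrow> \<exists>x\<in>carrier M. q x = z"
  using assms unfolding surj_hom_def by (blast, blast, blast, metis imageE)

lemma monoid_surj_hom:
  assumes "monoid M" "surj_hom q M N"
  shows "monoid N"
proof -
  interpret monoid M by fact
  note q = surj_homD[OF assms(2)]
  show ?thesis
  proof (rule monoidI)
    show "\<one>\<^bsub>N\<^esub> \<in> carrier N" using q(1,2) one_closed by metis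
    fix x y assume xy: "x \<in> carrier N" "y \<in> carrier N"
    then obtain a b where ab: "a \<in> carrier M" "b \<in> carrier M" "x = q a" "y = q b" using q(4)
      by metis
    show "x \<otimes>\<^bsub>N\<^esub> y \<in> carrier N" using ab q(1,3) m_closed by metis
    show "\<one>\<^bsub>N\<^esub> \<otimes>\<^bsub>N\<^esub> x = x" using ab q(2,3) l_one one_closed by metis
    show "x \<otimes>\<^bsub>N\<^esub> \<one>\<^bsub>N\<^esub> = x" using ab q(2,3) r_one one_closed by metis
    fix z assume "z \<in> carrier N"
    then obtain c where "c \<in> carrier M" "z = q c" using q(4) by metis
    then show "x \<otimes>\<^bsub>N\<^esub> y \<otimes>\<^bsub>N\<^esub> z = x \<otimes>\<^bsub>N\<^esub> (y \<otimes>\<^bsub>N\<^esub> z)"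
      using ab q(3) m_closed m_assoc by metis
  qed
qed

lemma finite_monoid_surj_hom: "finite_monoid M \<Longrightarrow> surj_hom q M N \<Longrightarrow> finite_monoid N"
  unfolding finite_monoid_def using monoid_surj_hom
  by (metis finite_imageI surj_hom_def)

text \<open>From here on a quotient is handled through a surjection with prescribed kernel and no
  longer through its classes.\<close>

lemma quotient_monoid_proj:
  assumes "monoid M" "congruence M r"
  obtains q where "surj_hom q M (quotient_monoid M r)"
    "\<And>x y. x \<in> carrier M \<Longrightarrow> y \<in> carrier M \<Longrightarrow> q x = q y \<longleftrightarrow> r x y"
proof -
  interpret monoid M by fact
  let ?q = "\<lambda>x. {y \<in> carrier M. r x y}"
  let ?R = "{(x, y). x \<in> carrier M \<and> y \<in> carrier M \<and> r x y}"
  note refl = congruenceD(1)[OF assms(2)] and sym = congruenceD(2)[OF assms(2)]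
    and trans = congruenceD(3)[OF assms(2)]
  have mult: "r (x \<otimes>\<^bsub>M\<^esub> z) (y \<otimes>\<^bsub>M\<^esub> t)"
    if "r x y" "r z t" "x \<in> carrier M" "y \<in> carrier M" "z \<in> carrier M" "t \<in> carrier M" for x y z t
  proof -
    have "r (x \<otimes>\<^bsub>M\<^esub> z) (y \<otimes>\<^bsub>M\<^esub> z)" "r (y \<otimes>\<^bsub>M\<^esub> z) (y \<otimes>\<^bsub>M\<^esub> t)"
      using congruenceD(4,5)[OF assms(2)] that by blast+
    then show ?thesis by (rule trans) (use that in simp_all)
  qed
  have img: "?R `` {x} = ?q x" if "x \<in> carrier M" for x using that by auto
  have eq: "?q x = ?q y \<longleftrightarrow> r x y" if xy: "x \<in> carrier M" "y \<in> carrier M" for x y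
  proof
    assume "?q x = ?q y"
    then have "y \<in> ?q x" using xy refl by blast
    then show "r x y" by simp
  next
    assume "r x y"
    then have "r x z \<longleftrightarrow> r y z" if "z \<in> carrier M" for z
      using that xy trans[of x y z] trans[of y x z] sym[of x y] by blast
    then show "?q x = ?q y" by blast
  qed
  have "?R `` (?q x <#>\<^bsub>M\<^esub> ?q y) = ?q (x \<otimes>\<^bsub>M\<^esub> y)" if xy: "x \<in> carrier M" "y \<in> carrier M" for x y
  proof safe
    fix a b z assume "a \<in> ?q x <#>\<^bsub>M\<^esub> ?q y" "a \<in> carrier M" "z \<in> carrier M" "r a z"
    then obtain x' y' where "x' \<in> carrier M" "y' \<in> carrier M" "r x x'" "r y y'" "a = x' \<otimes>\<^bsub>M\<^esub> y'"
      unfolding set_mult_def by blast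
    then show "r (x \<otimes>\<^bsub>M\<^esub> y) z"
      using trans[OF mult[of x x' y y'] \<open>r a z\<close>[unfolded \<open>a = _\<close>]] xy \<open>z \<in> carrier M\<close> by simp
  next
    fix z assume z: "z \<in> carrier M" "r (x \<otimes>\<^bsub>M\<^esub> y) z"
    have "x \<otimes>\<^bsub>M\<^esub> y \<in> ?q x <#>\<^bsub>M\<^esub> ?q y" using xy refl by (auto simp: set_mult_def)
    then show "z \<in> ?R `` (?q x <#>\<^bsub>M\<^esub> ?q y)" using z xy by auto
  qed
  then have "surj_hom ?q M (quotient_monoid M r)"
    by (auto simp: surj_hom_def quotient_monoid_def Let_def quotient_def img)
  then show ?thesis using that eq by blast
qed

lemma surj_hom_if_epi:
  assumes "monoid M" "monoid N" "f \<in> epi M N"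
  shows "surj_hom f M N"
proof -
  interpret M: monoid M by fact
  interpret N: monoid N by fact
  have f: "f \<in> hom M N" "f ` carrier M = carrier N" using assms(3) by (auto simp: epi_def)
  obtain e where e: "e \<in> carrier M" "f e = \<one>\<^bsub>N\<^esub>" using f(2) by (metis N.one_closed imageE)
  have "f \<one>\<^bsub>M\<^esub> = f \<one>\<^bsub>M\<^esub> \<otimes>\<^bsub>N\<^esub> f e"
    using e f(2) by (metis M.one_closed N.r_one imageI)
  also have "\<dots> = f e" using hom_mult[OF f(1) M.one_closed e(1)] e(1) by simp
  finally show ?thesis using e f hom_mult[OF f(1)] unfolding surj_hom_def by auto
qed

lemma iso_iff_surj_hom:
  assumes "monoid M" "monoid N"
  shows "M \<cong> N \<longleftrightarrow> (\<exists>f. surj_hom f M N \<and> inj_on f (carrier M))"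
proof
  assume "M \<cong> N"
  then obtain f where "f \<in> epi M N" "inj_on f (carrier M)"
    unfolding is_iso_def iso_def epi_def bij_betw_def by blast
  then show "\<exists>f. surj_hom f M N \<and> inj_on f (carrier M)" using surj_hom_if_epi[OF assms] by blast
next
  assume "\<exists>f. surj_hom f M N \<and> inj_on f (carrier M)"
  then show "M \<cong> N"
    unfolding is_iso_def iso_def hom_def surj_hom_def bij_betw_def by blast
qed

text \<open>Removes the set-valued quotient from membership statements: a surjection with kernel
  \<open>r\<close> onto a member of \<open>V\<close> carries the same information and can be
  compared with other maps out of \<open>M\<close>.\<close>

lemma in_class_quotient:
  assumes "finite_monoid M" "congruence M r" "\<And>N. N \<in> V \<Longrightarrow> monoid N"
  shows "in_class (quotient_monoid M r) V \<longleftrightarrow>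
    (\<exists>N\<in>V. \<exists>q. surj_hom q M N \<and> (\<forall>x\<in>carrier M. \<forall>y\<in>carrier M. q x = q y \<longleftrightarrow> r x y))"
proof -
  let ?Q = "quotient_monoid M r"
  have M: "monoid M" using assms(1) by (simp add: finite_monoid_def)
  obtain p where p: "surj_hom p M ?Q"
    "\<And>x y. x \<in> carrier M \<Longrightarrow> y \<in> carrier M \<Longrightarrow> p x = p y \<longleftrightarrow> r x y"
    using quotient_monoid_proj[OF M assms(2)] by blast
  have fin: "finite_monoid ?Q"
    using finite_monoid_surj_hom[OF assms(1) p(1)] .
  have Q: "monoid ?Q" using fin by (simp add: finite_monoid_def)
  show ?thesis
  proof
    assume "in_class ?Q V"
    then obtain N where N: "N \<in> V" "?Q \<cong> N" unfolding in_class_def by blast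
    then obtain f where f: "surj_hom f ?Q N" "inj_on f (carrier ?Q)"
      using iso_iff_surj_hom[OF Q assms(3)] by blast
    have "(f \<circ> p) x = (f \<circ> p) y \<longleftrightarrow> r x y" if "x \<in> carrier M" "y \<in> carrier M" for x y
      using that p(2) f(2) surj_homD(1)[OF p(1)] by (metis comp_apply inj_onD)
    then show "\<exists>N\<in>V. \<exists>q. surj_hom q M N \<and> (\<forall>x\<in>carrier M. \<forall>y\<in>carrier M. q x = q y \<longleftrightarrow> r x y)"
      using N(1) surj_hom_comp[OF p(1) f(1)] by blast
  next
    assume "\<exists>N\<in>V. \<exists>q. surj_hom q M N \<and> (\<forall>x\<in>carrier M. \<forall>y\<in>carrier M. q x = q y \<longleftrightarrow> r x y)"
    then obtain N q where N: "N \<in> V" and q: "surj_hom q M N"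
      "\<And>x y. x \<in> carrier M \<Longrightarrow> y \<in> carrier M \<Longrightarrow> q x = q y \<longleftrightarrow> r x y" by blast
    let ?f = "q \<circ> inv_into (carrier M) p"
    have f: "?f (p x) = q x" if "x \<in> carrier M" for x
    proof -
      have "p x \<in> p ` carrier M" using that by simp
      then have "inv_into (carrier M) p (p x) \<in> carrier M" "p (inv_into (carrier M) p (p x)) = p x"
        by (rule inv_into_into, rule f_inv_into_f)
      then have "q (inv_into (carrier M) p (p x)) = q x" using p(2) q(2) that by metis
      then show ?thesis by simp
    qed
    have c: "carrier ?Q = p ` carrier M" using p(1) by (simp add: surj_hom_def)
    interpret monoid M by fact
    have "surj_hom ?f ?Q N"
      unfolding surj_hom_def
    proof (intro conjI ballI)
      show "?f ` carrier ?Q = carrier N"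
        using f q(1) unfolding c surj_hom_def image_image by simp
      show "?f \<one>\<^bsub>?Q\<^esub> = \<one>\<^bsub>N\<^esub>"
        using f[of "\<one>\<^bsub>M\<^esub>"] surj_homD(2)[OF p(1)] surj_homD(2)[OF q(1)] by simp
      fix x y assume "x \<in> carrier ?Q" "y \<in> carrier ?Q"
      then obtain a b where ab: "a \<in> carrier M" "b \<in> carrier M" "x = p a" "y = p b" unfolding c
        by blast
      then have "x \<otimes>\<^bsub>?Q\<^esub> y = p (a \<otimes>\<^bsub>M\<^esub> b)" using surj_homD(3)[OF p(1)] by simp
      then show "?f (x \<otimes>\<^bsub>?Q\<^esub> y) = ?f x \<otimes>\<^bsub>N\<^esub> ?f y"
        using f ab surj_homD(3)[OF q(1)] by (metis m_closed)
    qed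
    moreover have "inj_on ?f (carrier ?Q)"
      unfolding c using f p(2) q(2) by (intro inj_onI) (metis imageE)
    ultimately show "in_class ?Q V"
      unfolding in_class_def using fin N iso_iff_surj_hom[OF Q assms(3)[OF N]] by blast
  qed
qed

section \<open>Stability under right multiplication and the congruence \<open>sim_K\<close>\<close>

context fin_monoid
begin

lemma nat_pow_pred:
  assumes "k > 0" "x \<in> carrier M"
  shows "x [^] (k::nat) = x \<otimes> x [^] (k - 1)"
  using assms nat_pow_Suc2[of x "k - 1"] by simp

lemma green_R_iff_r_stable:
  assumes "s \<in> carrier M" "z \<in> carrier M"
  shows "green_R M (s \<otimes> z) s \<longleftrightarrow> r_stable M s z"
proof
  assume "green_R M (s \<otimes> z) s"
  moreover have "s \<in> s <# carrier M" using assms by (auto simp: l_coset_def intro!: bexI[of _ \<one>])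
  ultimately have "s \<in> (s \<otimes> z) <# carrier M" by (simp add: green_R_def)
  then obtain y where "y \<in> carrier M" "s = s \<otimes> z \<otimes> y" by (auto simp: l_coset_def)
  then show "r_stable M s z" unfolding r_stable_def by metis
next
  assume "r_stable M s z"
  then obtain y where y: "y \<in> carrier M" "s \<otimes> z \<otimes> y = s" by (auto simp: r_stable_def)
  have "s \<otimes> z \<otimes> h \<in> s <# carrier M" if "h \<in> carrier M" for h
    using that assms by (auto simp: l_coset_def m_assoc)
  moreover have "s \<otimes> h \<in> (s \<otimes> z) <# carrier M" if "h \<in> carrier M" for h
  proof -
    have "s \<otimes> h = s \<otimes> z \<otimes> (y \<otimes> h)" using y that assms by (metis m_assoc m_closed)
    then show ?thesis using y(1) that by (auto simp: l_coset_def)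
  qed
  ultimately show "green_R M (s \<otimes> z) s" by (auto simp: green_R_def l_coset_def)
qed

lemma r_stable_mult:
  assumes "r_stable M s (z \<otimes> z')" "s \<in> carrier M" "z \<in> carrier M" "z' \<in> carrier M"
  shows "r_stable M s z" "r_stable M (s \<otimes> z) z'"
proof -
  obtain y where y: "y \<in> carrier M" "s \<otimes> (z \<otimes> z') \<otimes> y = s"
    using assms(1) by (auto simp: r_stable_def)
  have "s \<otimes> z \<otimes> (z' \<otimes> y) = s" using y assms by (simp add: m_assoc)
  then show "r_stable M s z" using y assms by (auto simp: r_stable_def)
  have "s \<otimes> z \<otimes> z' \<otimes> (y \<otimes> z) = s \<otimes> (z \<otimes> z') \<otimes> y \<otimes> z" using y(1) assms by (simp add: m_assoc)
  then show "r_stable M (s \<otimes> z) z'" using y assms by (auto simp: r_stable_def)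
qed

lemma r_stable_comp:
  assumes "r_stable M s z" "r_stable M (s \<otimes> z) z'" "s \<in> carrier M" "z \<in> carrier M" "z' \<in> carrier M"
  shows "r_stable M s (z \<otimes> z')"
proof -
  obtain y y' where y: "y \<in> carrier M" "s \<otimes> z \<otimes> y = s" "y' \<in> carrier M" "s \<otimes> z \<otimes> z' \<otimes> y' = s \<otimes> z"
    using assms(1,2) by (auto simp: r_stable_def)
  have "s \<otimes> (z \<otimes> z') \<otimes> (y' \<otimes> y) = s \<otimes> z \<otimes> z' \<otimes> y' \<otimes> y" using y(1,3) assms by (simp add: m_assoc)
  then show ?thesis using y by (auto simp: r_stable_def)
qed

text \<open>If \<open>z y\<close> fixes \<open>s\<close>, then so does its idempotent power
  \<open>e\<close>. As \<open>e\<close> starts with \<open>z\<close>, it is itself stable under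
  \<open>z\<close>. This reduces stability at an arbitrary \<open>s\<close> to stability at an
  idempotent.\<close>

lemma r_stable_obtain_idempotent:
  assumes "r_stable M s z" "s \<in> carrier M" "z \<in> carrier M"
  obtains e y where "e \<in> idempotents M" "e \<in> carrier M" "y \<in> carrier M" "e = z \<otimes> y" "s \<otimes> e = s"
    "r_stable M e z"
proof -
  obtain y where y: "y \<in> carrier M" "s \<otimes> z \<otimes> y = s" using assms(1)
    by (auto simp: r_stable_def)
  have zy: "z \<otimes> y \<in> carrier M" using y assms by simp
  obtain k :: nat where k: "k > 0" "(z \<otimes> y) [^] k \<otimes> (z \<otimes> y) [^] k = (z \<otimes> y) [^] k"
    using idempotent_power[OF zy] by blast
  let ?e = "(z \<otimes> y) [^] k" and ?y = "y \<otimes> (z \<otimes> y) [^] (k - 1)"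
  have e: "?e = z \<otimes> ?y" using nat_pow_pred[OF k(1) zy] y assms by (simp add: m_assoc)
  have "s \<otimes> (z \<otimes> y) [^] j = s" for j :: nat
  proof (induction j)
    case (Suc j)
    have "s \<otimes> (z \<otimes> y) [^] Suc j = s \<otimes> (z \<otimes> y) [^] j \<otimes> z \<otimes> y"
      using assms y by (simp add: m_assoc)
    then show ?case using Suc y by simp
  qed (use assms in simp)
  moreover have "?e \<otimes> z \<otimes> ?y = ?e \<otimes> ?e"
    using e y(1) assms by (simp add: m_assoc)
  then have "r_stable M ?e z"
    using k(2) y assms unfolding r_stable_def by (intro bexI[of _ ?y]) auto
  moreover have "?e \<in> idempotents M" using k(2) zy by (simp add: idempotents_def)
  moreover have "?y \<in> carrier M" "?e \<in> carrier M" using y zy by simp_all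
  ultimately show ?thesis using that e by blast
qed

text \<open>Quantifying over all elements instead of idempotents makes the congruence laws immediate.\<close>

lemma sim_K_iff:
  assumes "x \<in> carrier M" "y \<in> carrier M"
  shows "sim_K M x y \<longleftrightarrow>
    (\<forall>s\<in>carrier M. r_stable M s x \<or> r_stable M s y \<longrightarrow> s \<otimes> x = s \<otimes> y)"
proof -
  have *: "sim_K M x y \<longleftrightarrow>
    (\<forall>e\<in>idempotents M. r_stable M e x \<or> r_stable M e y \<longrightarrow> e \<otimes> x = e \<otimes> y)"
    unfolding sim_K_def using assms green_R_iff_r_stable by (auto simp: idempotents_def)
  have "s \<otimes> x = s \<otimes> y" if H: "sim_K M x y"
    and s: "s \<in> carrier M" "r_stable M s x \<or> r_stable M s y" for s
  proof -
    obtain e where e: "e \<in> idempotents M" "e \<in> carrier M" "s \<otimes> e = s" "r_stable M e x \<or> r_stable M e y"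
      using s(2) r_stable_obtain_idempotent[OF _ s(1)] assms by metis
    have "s \<otimes> x = s \<otimes> e \<otimes> x" "s \<otimes> y = s \<otimes> e \<otimes> y" using e(3) by simp_all
    moreover have "e \<otimes> x = e \<otimes> y" using H e * by blast
    ultimately show ?thesis using s(1) e(2) assms by (simp add: m_assoc)
  qed
  moreover have "idempotents M \<subseteq> carrier M" by (auto simp: idempotents_def)
  ultimately show ?thesis using * by (meson subsetD)
qed

lemma sim_K_D:
  assumes "sim_K M x y" "x \<in> carrier M" "y \<in> carrier M" "s \<in> carrier M" "r_stable M s x \<or> r_stable M s y"
  shows "s \<otimes> x = s \<otimes> y"
  using assms sim_K_iff by blast

lemma r_stable_cong:
  "s \<otimes> x = s \<otimes> y \<Longrightarrow> r_stable M s x \<longleftrightarrow> r_stable M s y"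
  by (simp add: r_stable_def)

lemma congruence_sim_K: "congruence M (sim_K M)"
  unfolding congruence_def
proof (intro conjI ballI impI)
  fix x y assume xy: "x \<in> carrier M" "y \<in> carrier M"
  show "sim_K M x x" using xy by (simp add: sim_K_iff)
  assume s: "sim_K M x y"
  show "sim_K M y x" using s xy sim_K_iff by metis
next
  fix x y z assume xyz: "x \<in> carrier M" "y \<in> carrier M" "z \<in> carrier M"
    and s: "sim_K M x y" "sim_K M y z"
  have "t \<otimes> x = t \<otimes> z" if t: "t \<in> carrier M" "r_stable M t x \<or> r_stable M t z" for t
    using sim_K_D[OF s(1) xyz(1,2) t(1)] sim_K_D[OF s(2) xyz(2,3) t(1)] t(2)
      r_stable_cong[of t x y] r_stable_cong[of t y z] by argo
  then show "sim_K M x z" using xyz by (simp add: sim_K_iff)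
next
  fix x y z assume xyz: "x \<in> carrier M" "y \<in> carrier M" "z \<in> carrier M" and s: "sim_K M x y"
  have "t \<otimes> (x \<otimes> z) = t \<otimes> (y \<otimes> z)"
    if t: "t \<in> carrier M" "r_stable M t (x \<otimes> z) \<or> r_stable M t (y \<otimes> z)" for t
  proof -
    have "r_stable M t x \<or> r_stable M t y" using t xyz r_stable_mult(1) by blast
    then have "t \<otimes> x \<otimes> z = t \<otimes> y \<otimes> z" using sim_K_D[OF s] xyz t(1) by simp
    then show ?thesis using xyz t(1) by (simp add: m_assoc)
  qed
  then show "sim_K M (x \<otimes> z) (y \<otimes> z)" using xyz by (simp add: sim_K_iff)
  have "t \<otimes> (z \<otimes> x) = t \<otimes> (z \<otimes> y)"
    if t: "t \<in> carrier M" "r_stable M t (z \<otimes> x) \<or> r_stable M t (z \<otimes> y)" for t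
  proof -
    have "r_stable M (t \<otimes> z) x \<or> r_stable M (t \<otimes> z) y" using t xyz r_stable_mult(2)
      by blast
    then have "t \<otimes> z \<otimes> x = t \<otimes> z \<otimes> y" using sim_K_D[OF s] xyz t(1) by simp
    then show ?thesis using xyz t(1) by (simp add: m_assoc)
  qed
  then show "sim_K M (z \<otimes> x) (z \<otimes> y)" using xyz by (simp add: sim_K_iff)
qed

lemma congruence_sim_D: "congruence M (sim_D M)"
  using congruence_opposite[OF fin_monoid.congruence_sim_K[OF fin_monoid_opposite]]
    by (simp add: sim_D_eq)

text \<open>Classes contain monoids on natural numbers only, so a monoid on another type is
  represented by such a copy whenever its membership is at stake.\<close>

lemma nat_copy:
  obtains N :: "nat monoid" and f where "surj_hom f M N" "inj_on f (carrier M)"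
proof -
  obtain f :: "'a \<Rightarrow> nat" where f: "inj_on f (carrier M)"
    using finite_imp_inj_to_nat_seg[OF finite_carrier] by blast
  let ?g = "inv_into (carrier M) f"
  let ?N = "\<lparr>carrier = f ` carrier M, mult = \<lambda>a b. f (?g a \<otimes> ?g b), one = f \<one>\<rparr>"
  have "surj_hom f M ?N" unfolding surj_hom_def using f by (simp add: inv_into_f_f)
  then show ?thesis using that f by blast
qed

lemma nat_quotient:
  assumes "congruence M r"
  obtains N :: "nat monoid" and q where "surj_hom q M N"
    "\<forall>x\<in>carrier M. \<forall>y\<in>carrier M. q x = q y \<longleftrightarrow> r x y"
proof -
  obtain q where q: "surj_hom q M (quotient_monoid M r)"
    "\<And>x y. x \<in> carrier M \<Longrightarrow> y \<in> carrier M \<Longrightarrow> q x = q y \<longleftrightarrow> r x y"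
    using quotient_monoid_proj[OF monoid_axioms assms] by blast
  interpret Q: fin_monoid "quotient_monoid M r"
    by unfold_locales (rule finite_monoid_surj_hom[OF finite_monoid q(1)])
  obtain N :: "nat monoid" and f where f: "surj_hom f (quotient_monoid M r) N"
    "inj_on f (carrier (quotient_monoid M r))" using Q.nat_copy by blast
  have "\<forall>x\<in>carrier M. \<forall>y\<in>carrier M. (f \<circ> q) x = (f \<circ> q) y \<longleftrightarrow> r x y"
    using q(2) f(2) surj_homD(1)[OF q(1)] by (metis comp_apply inj_onD)
  then show ?thesis using that surj_hom_comp[OF q(1) f(1)] by blast
qed

lemma green_J_iff:
  assumes "x \<in> carrier M" "y \<in> carrier M"
  shows "green_J M x y \<longleftrightarrow> (\<exists>p\<in>carrier M. \<exists>q\<in>carrier M. x = p \<otimes> y \<otimes> q) \<and>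
    (\<exists>p\<in>carrier M. \<exists>q\<in>carrier M. y = p \<otimes> x \<otimes> q)"
proof -
  let ?J = "\<lambda>x. (carrier M #> x) <#> carrier M"
  have mem: "z \<in> ?J x \<longleftrightarrow> (\<exists>p\<in>carrier M. \<exists>q\<in>carrier M. z = p \<otimes> x \<otimes> q)" for z x
    by (auto simp: set_mult_def r_coset_def)
  have self: "x \<in> ?J x" if "x \<in> carrier M" for x
    unfolding mem using that by (auto intro!: bexI[of _ \<one>])
  have sub: "?J x \<subseteq> ?J y" if xy: "x \<in> ?J y" "y \<in> carrier M" for x y
  proof
    fix z assume "z \<in> ?J x"
    then obtain p q where "p \<in> carrier M" "q \<in> carrier M" "z = p \<otimes> x \<otimes> q" unfolding mem by blast
    moreover obtain p' q' where "p' \<in> carrier M" "q' \<in> carrier M" "x = p' \<otimes> y \<otimes> q'"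
      using xy(1) unfolding mem by blast
    ultimately have "z = (p \<otimes> p') \<otimes> y \<otimes> (q' \<otimes> q)" "p \<otimes> p' \<in> carrier M" "q' \<otimes> q \<in> carrier M"
      using xy(2) by (simp_all add: m_assoc)
    then show "z \<in> ?J y" unfolding mem by blast
  qed
  have "green_J M x y \<longleftrightarrow> x \<in> ?J y \<and> y \<in> ?J x"
  proof
    assume "green_J M x y"
    then show "x \<in> ?J y \<and> y \<in> ?J x" unfolding green_J_def using self assms by metis
  next
    assume "x \<in> ?J y \<and> y \<in> ?J x"
    then show "green_J M x y" unfolding green_J_def using sub assms by (intro equalityI) simp_all
  qed
  then show ?thesis unfolding mem .
qed

end

section \<open>The hierarchy: duality and closure under division\<close>

definition J_trivial :: "'a monoid \<Rightarrow> bool" where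
  "J_trivial M \<longleftrightarrow> (\<forall>x\<in>carrier M. \<forall>y\<in>carrier M. green_J M x y \<longrightarrow> x = y)"

lemma variety_J_iff: "M \<in> variety_J \<longleftrightarrow> finite_monoid M \<and> J_trivial M"
  by (simp add: variety_J_def J_trivial_def)

lemma variety_J_opposite: "opposite M \<in> variety_J \<longleftrightarrow> M \<in> variety_J"
proof -
  have "M \<in> variety_J" if M: "opposite M \<in> variety_J" for M
  proof -
    interpret fin_monoid M using M by unfold_locales (simp add: variety_J_def)
    interpret opp: fin_monoid "opposite M" by (rule fin_monoid_opposite)
    have "green_J (opposite M) x y" if xy: "x \<in> carrier M" "y \<in> carrier M" "green_J M x y" for x y
    proof -
      obtain p q p' q' where "p \<in> carrier M" "q \<in> carrier M" "p' \<in> carrier M" "q' \<in> carrier M"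
        "x = p \<otimes>\<^bsub>M\<^esub> y \<otimes>\<^bsub>M\<^esub> q" "y = p' \<otimes>\<^bsub>M\<^esub> x \<otimes>\<^bsub>M\<^esub> q'"
        using xy(3) green_J_iff[OF xy(1,2)] by blast
      then show ?thesis using xy opp.green_J_iff[of x y] by (metis m_assoc opposite_simps(1,2))
    qed
    then show ?thesis using M by (auto simp: variety_J_def)
  qed
  from this[of M] this[of "opposite M"] show ?thesis by auto
qed

lemma in_class_opposite:
  assumes "\<And>N. N \<in> V \<Longrightarrow> opposite N \<in> W" "in_class M V"
  shows "in_class (opposite M) W"
  using assms iso_opposite unfolding in_class_def by (metis finite_monoid_opposite)

lemma variety_opposite:
  "(opposite M \<in> variety_R m \<longleftrightarrow> M \<in> variety_L m) \<and> (opposite M \<in> variety_L m \<longleftrightarrow> M \<in> variety_R m)"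
proof (induction m arbitrary: M rule: nat_less_induct)
  case (1 m)
  consider "m = 0" | "m = Suc 0" | k where "m = Suc (Suc k)" by (metis not0_implies_Suc)
  then show ?case
  proof cases
    case (3 k)
    have R: "opposite N \<in> variety_L (Suc k)" if "N \<in> variety_R (Suc k)" for N
      using that 1[rule_format, of "Suc k" N] 3 by simp
    have L: "opposite N \<in> variety_R (Suc k)" if "N \<in> variety_L (Suc k)" for N
      using that 1[rule_format, of "Suc k" N] 3 by simp
    have K: "opposite M \<in> malcev_K (variety_L (Suc k))" if "M \<in> malcev_D (variety_R (Suc k))"
      for M
      using that in_class_opposite[OF R, where M = "quotient_monoid M (sim_D M)"]
      by (simp add: malcev_K_def malcev_D_def sim_D_eq quotient_monoid_opposite)
    have D: "opposite M \<in> malcev_D (variety_R (Suc k))" if "M \<in> malcev_K (variety_L (Suc k))"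
      for M
      using that in_class_opposite[OF L, where M = "quotient_monoid M (sim_K M)"]
      by (simp add: malcev_K_def malcev_D_def sim_D_eq quotient_monoid_opposite)
    show ?thesis using K[of M] D[of M] K[of "opposite M"] D[of "opposite M"] 3 by auto
  qed (simp_all add: variety_J_opposite)
qed

lemma variety_L_iff: "M \<in> variety_L m \<longleftrightarrow> opposite M \<in> variety_R m"
  using variety_opposite by blast

lemma variety_R_finite:
  assumes "M \<in> variety_R m"
  shows "finite_monoid M"
proof -
  consider "m = 0" | "m = Suc 0" | k where "m = Suc (Suc k)" by (metis not0_implies_Suc)
  then show ?thesis using assms by cases (auto simp: variety_J_def malcev_K_def)
qed

lemma variety_L_finite: "M \<in> variety_L m \<Longrightarrow> finite_monoid M"
  using variety_R_finite variety_L_iff by fastforce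

lemma variety_R_Suc:
  assumes "finite_monoid M"
  shows "M \<in> variety_R (Suc (Suc m)) \<longleftrightarrow> (\<exists>N\<in>variety_L (Suc m). \<exists>q. surj_hom q M N \<and>
    (\<forall>x\<in>carrier M. \<forall>y\<in>carrier M. q x = q y \<longleftrightarrow> sim_K M x y))"
proof -
  interpret fin_monoid M by unfold_locales fact
  show ?thesis
    using in_class_quotient[OF assms congruence_sim_K, of "variety_L (Suc m)"] variety_L_finite assms
    by (auto simp: malcev_K_def finite_monoid_def)
qed

text \<open>Division \<open>N \<prec> M\<close> as a relation from \<open>M\<close> onto \<open>N\<close>: the graph of a homomorphism from a
  submonoid of \<open>M\<close> onto \<open>N\<close>.\<close>

definition division :: "('a \<times> 'b) set \<Rightarrow> 'b monoid \<Rightarrow> 'a monoid \<Rightarrow> bool" where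
  "division R N M \<longleftrightarrow> R \<subseteq> carrier M \<times> carrier N \<and> (\<one>\<^bsub>M\<^esub>, \<one>\<^bsub>N\<^esub>) \<in> R \<and>
     (\<forall>x y x' y'. (x, y) \<in> R \<longrightarrow> (x', y') \<in> R \<longrightarrow> (x \<otimes>\<^bsub>M\<^esub> x', y \<otimes>\<^bsub>N\<^esub> y') \<in> R) \<and>
     (\<forall>x y y'. (x, y) \<in> R \<longrightarrow> (x, y') \<in> R \<longrightarrow> y = y') \<and>
     carrier N \<subseteq> Range R"

lemma divisionD:
  assumes "division R N M"
  shows "(x, y) \<in> R \<Longrightarrow> x \<in> carrier M" "(x, y) \<in> R \<Longrightarrow> y \<in> carrier N"
    "(\<one>\<^bsub>M\<^esub>, \<one>\<^bsub>N\<^esub>) \<in> R"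
    "(x, y) \<in> R \<Longrightarrow> (x', y') \<in> R \<Longrightarrow> (x \<otimes>\<^bsub>M\<^esub> x', y \<otimes>\<^bsub>N\<^esub> y') \<in> R"
    "(x, y) \<in> R \<Longrightarrow> (x, y') \<in> R \<Longrightarrow> y = y'"
    "y \<in> carrier N \<Longrightarrow> \<exists>x. (x, y) \<in> R"
  using assms unfolding division_def by (blast, blast, blast, blast, blast, blast)

lemma division_opposite: "division R N M \<Longrightarrow> division R (opposite N) (opposite M)"
  unfolding division_def by auto

lemma division_comp:
  assumes "division R N M" "division \<sigma> K N"
  shows "division (R O \<sigma>) K M"
  unfolding division_def
proof (intro conjI allI impI)
  note r = divisionD[OF assms(1)] and s = divisionD[OF assms(2)]
  show "R O \<sigma> \<subseteq> carrier M \<times> carrier K" using r(1) s(2) by blast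
  show "(\<one>\<^bsub>M\<^esub>, \<one>\<^bsub>K\<^esub>) \<in> R O \<sigma>" using r(3) s(3) by blast
  show "carrier K \<subseteq> Range (R O \<sigma>)" using r(6) s(6) s(1) by blast
  fix x y assume xy: "(x, y) \<in> R O \<sigma>"
  show "y = y'" if "(x, y') \<in> R O \<sigma>" for y' using xy that r(5) s(5) by blast
  show "(x \<otimes>\<^bsub>M\<^esub> x', y \<otimes>\<^bsub>K\<^esub> y') \<in> R O \<sigma>" if "(x', y') \<in> R O \<sigma>" for x' y'
    using xy that r(4) s(4) by blast
qed

lemma division_image:
  assumes "monoid M" "surj_hom f M N"
  shows "division {(x, f x) | x. x \<in> carrier M} N M"
proof -
  interpret monoid M by fact
  note f = surj_homD[OF assms(2)]
  show ?thesis unfolding division_def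
  proof (intro conjI allI impI)
    show "(\<one>\<^bsub>M\<^esub>, \<one>\<^bsub>N\<^esub>) \<in> {(x, f x) | x. x \<in> carrier M}" using f(2) by force
    show "carrier N \<subseteq> Range {(x, f x) | x. x \<in> carrier M}" using f(4) by blast
  qed (use f(1,3) in auto)
qed

text \<open>The image of \<open>f\<close>, which may be smaller than \<open>N\<close>, is the
  submonoid in the division, and the last hypothesis makes the relation single-valued. With a free
  monoid for \<open>M\<close> this compares two quotients of words.\<close>

lemma division_factor:
  assumes "monoid M" "surj_hom g M K"
    and f: "\<And>x. x \<in> carrier M \<Longrightarrow> f x \<in> carrier N" "f \<one>\<^bsub>M\<^esub> = \<one>\<^bsub>N\<^esub>"
      "\<And>x y. x \<in> carrier M \<Longrightarrow> y \<in> carrier M \<Longrightarrow> f (x \<otimes>\<^bsub>M\<^esub> y) = f x \<otimes>\<^bsub>N\<^esub> f y"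
    and "\<And>x y. x \<in> carrier M \<Longrightarrow> y \<in> carrier M \<Longrightarrow> f x = f y \<Longrightarrow> g x = g y"
  shows "division {(f x, g x) | x. x \<in> carrier M} K N"
proof -
  interpret monoid M by fact
  note g = surj_homD[OF assms(2)]
  show ?thesis unfolding division_def
  proof (intro conjI allI impI)
    show "(\<one>\<^bsub>N\<^esub>, \<one>\<^bsub>K\<^esub>) \<in> {(f x, g x) | x. x \<in> carrier M}" using f(2) g(2) by force
    show "carrier K \<subseteq> Range {(f x, g x) | x. x \<in> carrier M}" using g(4) by blast
    show "{(f x, g x) | x. x \<in> carrier M} \<subseteq> carrier N \<times> carrier K" using f(1) g(1) by blast
    fix x y assume xy: "(x, y) \<in> {(f x, g x) | x. x \<in> carrier M}"
    then obtain a where a: "a \<in> carrier M" "x = f a" "y = g a" by blast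
    show "y = y'" if "(x, y') \<in> {(f x, g x) | x. x \<in> carrier M}" for y'
      using a that assms(6) by blast
    show "(x \<otimes>\<^bsub>N\<^esub> x', y \<otimes>\<^bsub>K\<^esub> y') \<in> {(f x, g x) | x. x \<in> carrier M}"
      if xy': "(x', y') \<in> {(f x, g x) | x. x \<in> carrier M}" for x' y'
    proof -
      obtain b where b: "b \<in> carrier M" "x' = f b" "y' = g b" using xy' by blast
      then have "x \<otimes>\<^bsub>N\<^esub> x' = f (a \<otimes>\<^bsub>M\<^esub> b)" "y \<otimes>\<^bsub>K\<^esub> y' = g (a \<otimes>\<^bsub>M\<^esub> b)"
        using a f(3) g(3) by simp_all
      then show ?thesis using a b by blast
    qed
  qed
qed

lemma division_inj:
  assumes "monoid M" "surj_hom f M N" "inj_on f (carrier M)"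
  shows "division {(f x, x) | x. x \<in> carrier M} M N"
  using division_factor[OF assms(1), of "\<lambda>x. x" M f N] surj_homD[OF assms(2)] assms(3)
  by (simp add: surj_hom_def inj_onD)

lemma division_finite:
  assumes "division R N M" "finite_monoid M" "monoid N"
  shows "finite_monoid N"
proof -
  have "finite (Range R)"
  proof -
    have "\<forall>y\<in>Range R. \<exists>x. (x, y) \<in> R" by blast
    from bchoice[OF this] obtain g where g: "\<And>y. y \<in> Range R \<Longrightarrow> (g y, y) \<in> R" by blast
    have "inj_on g (Range R)" using g divisionD(5)[OF assms(1)] by (metis inj_onI)
    moreover have "g ` Range R \<subseteq> carrier M" using g divisionD(1)[OF assms(1)] by blast
    ultimately show ?thesis using assms(2) unfolding finite_monoid_def by (metis inj_on_finite)
  qed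
  then show ?thesis using assms finite_subset unfolding division_def finite_monoid_def by blast
qed

lemma monoid_divides_iff:
  assumes "monoid M" "monoid N"
  shows "monoid_divides N M \<longleftrightarrow> (\<exists>R. division R N M)"
proof
  assume "monoid_divides N M"
  then obtain H f where H: "submonoid H M" and f: "f \<in> epi (M\<lparr>carrier := H\<rparr>) N"
    unfolding monoid_divides_def by blast
  interpret H: submonoid H M by fact
  have "monoid (M\<lparr>carrier := H\<rparr>)" using H.submonoid_is_monoid assms(1) by blast
  then have "division {(x, f x) | x. x \<in> H} N (M\<lparr>carrier := H\<rparr>)"
    using division_image[OF _ surj_hom_if_epi[OF _ assms(2) f]] by simp
  then have "division {(x, f x) | x. x \<in> H} N M" using H.subset unfolding division_def by auto
  then show "\<exists>R. division R N M" by blast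
next
  assume "\<exists>R. division R N M"
  then obtain R where r: "division R N M" by blast
  note r = divisionD[OF this]
  let ?f = "\<lambda>x. THE y. (x, y) \<in> R"
  have f: "?f x = y" if "(x, y) \<in> R" for x y using that r(5) by blast
  have H: "submonoid (Domain R) M"
    by unfold_locales (use r(1,3,4) in blast)+
  have "?f \<in> epi (M\<lparr>carrier := Domain R\<rparr>) N"
    unfolding epi_def hom_def
  proof (intro CollectI conjI ballI Pi_I)
    fix x assume "x \<in> carrier (M\<lparr>carrier := Domain R\<rparr>)"
    then obtain y where xy: "(x, y) \<in> R" by auto
    then show "?f x \<in> carrier N" using f r(2) by metis
    fix x' assume "x' \<in> carrier (M\<lparr>carrier := Domain R\<rparr>)"
    then obtain y' where "(x', y') \<in> R" by auto
    then show "?f (x \<otimes>\<^bsub>M\<lparr>carrier := Domain R\<rparr>\<^esub> x') = ?f x \<otimes>\<^bsub>N\<^esub> ?f x'"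
      using xy f r(4) by simp
  next
    show "?f ` carrier (M\<lparr>carrier := Domain R\<rparr>) = carrier N"
    proof (intro equalityI subsetI)
      fix y assume "y \<in> carrier N"
      then obtain x where "(x, y) \<in> R" using r(6) by blast
      then show "y \<in> ?f ` carrier (M\<lparr>carrier := Domain R\<rparr>)" using f by force
    next
      fix y assume "y \<in> ?f ` carrier (M\<lparr>carrier := Domain R\<rparr>)"
      then show "y \<in> carrier N" using f r(2) by auto
    qed
  qed
  then show "monoid_divides N M" unfolding monoid_divides_def using H by blast
qed

lemma divisionD_pow:
  assumes "division R N M" "(x, y) \<in> R"
  shows "(x [^]\<^bsub>M\<^esub> (k::nat), y [^]\<^bsub>N\<^esub> k) \<in> R"
  by (induction k) (use divisionD(3,4)[OF assms(1)] assms(2) in \<open>auto simp: nat_pow_def\<close>)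

context fin_monoid
begin

text \<open>Stability has to be lifted first. Let \<open>s y t = s\<close>, and let
  \<open>a\<close>, \<open>b\<close> lie over \<open>s\<close>, \<open>t\<close>. Then
  \<open>S = a (x b)^k\<close> still lies over \<open>s\<close>, and for an idempotent power it is
  stable under \<open>x\<close>. Hence \<open>S x = S x'\<close>, and this element lies over both
  \<open>s y\<close> and \<open>s y'\<close>.\<close>

lemma sim_K_division:
  assumes "finite_monoid N" "division R N M" "(x, y) \<in> R" "(x', y') \<in> R" "sim_K M x x'"
  shows "sim_K N y y'"
proof -
  interpret N: fin_monoid N by unfold_locales fact
  note r = divisionD[OF assms(2)]
  have *: "s \<otimes>\<^bsub>N\<^esub> y = s \<otimes>\<^bsub>N\<^esub> y'"
    if xy: "(x, y) \<in> R" "(x', y') \<in> R" "sim_K M x x'" and s: "s \<in> carrier N" "r_stable N s y"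
      for s x x' y y'
  proof -
    obtain t where t: "t \<in> carrier N" "s \<otimes>\<^bsub>N\<^esub> y \<otimes>\<^bsub>N\<^esub> t = s" using s(2)
      by (auto simp: r_stable_def)
    obtain a b where ab: "(a, s) \<in> R" "(b, t) \<in> R" using r(6) s(1) t(1) by blast
    have c: "a \<in> carrier M" "b \<in> carrier M" "x \<in> carrier M" "x' \<in> carrier M" "y \<in> carrier N"
      using ab xy r(1,2) by blast+
    let ?z = "x \<otimes> b" and ?w = "y \<otimes>\<^bsub>N\<^esub> t"
    have z: "?z \<in> carrier M" using c by simp
    obtain k :: nat where k: "k > 0" "?z [^] k \<otimes> ?z [^] k = ?z [^] k"
      using idempotent_power[OF z] by blast
    have "s \<otimes>\<^bsub>N\<^esub> ?w [^]\<^bsub>N\<^esub> j = s" for j :: nat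
    proof (induction j)
      case (Suc j)
      have "s \<otimes>\<^bsub>N\<^esub> ?w [^]\<^bsub>N\<^esub> Suc j = s \<otimes>\<^bsub>N\<^esub> ?w [^]\<^bsub>N\<^esub> j \<otimes>\<^bsub>N\<^esub> y \<otimes>\<^bsub>N\<^esub> t"
        using s(1) t(1) c by (simp add: N.m_assoc)
      then show ?case using Suc t by simp
    qed (use s(1) in simp)
    then have S: "(a \<otimes> ?z [^] k, s) \<in> R"
      using r(4)[OF ab(1) divisionD_pow[OF assms(2) r(4)[OF xy(1) ab(2)]]] by metis
    let ?S = "a \<otimes> ?z [^] k"
    have "?S \<otimes> x \<otimes> (b \<otimes> ?z [^] (k - 1)) = a \<otimes> (?z [^] k \<otimes> (?z \<otimes> ?z [^] (k - 1)))"
      using c by (simp add: m_assoc)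
    also have "\<dots> = ?S" using nat_pow_pred[OF k(1) z] k(2) by simp
    finally have "r_stable M ?S x" using c unfolding r_stable_def by blast
    moreover have "?S \<in> carrier M" using c z by simp
    ultimately have "?S \<otimes> x = ?S \<otimes> x'" using sim_K_D[OF xy(3) c(3,4)] by blast
    then show ?thesis using r(4)[OF S xy(1)] r(4)[OF S xy(2)] r(5) by metis
  qed
  have c: "x \<in> carrier M" "x' \<in> carrier M" "y \<in> carrier N" "y' \<in> carrier N"
    using assms(3,4) r(1,2) by blast+
  have "sim_K M x' x" using congruenceD(2)[OF congruence_sim_K assms(5)] c by blast
  then have "s \<otimes>\<^bsub>N\<^esub> y = s \<otimes>\<^bsub>N\<^esub> y'" if "s \<in> carrier N" "r_stable N s y \<or> r_stable N s y'"
    for s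
    using *[OF assms(3,4,5) that(1)] *[OF assms(4,3) _ that(1)] that(2) by metis
  then show ?thesis using c by (simp add: N.sim_K_iff)
qed

text \<open>From \<open>x = p y q\<close> and \<open>y = p' x q'\<close> follows
  \<open>x = (p p')^j x (q' q)^j\<close> for all \<open>j\<close>. Lifted to \<open>M\<close> with
  an idempotent exponent, the right side becomes an element \<open>e\<close> over \<open>x\<close>
  that can be recovered from \<open>c e d\<close>, an element over \<open>y\<close>. These two are
  \<open>J\<close>-equivalent, hence equal.\<close>

lemma J_trivial_division:
  assumes "J_trivial M" "finite_monoid N" "division R N M"
  shows "J_trivial N"
proof -
  interpret N: fin_monoid N by unfold_locales fact
  note r = divisionD[OF assms(3)]
  have "x = y" if xy: "x \<in> carrier N" "y \<in> carrier N" "green_J N x y" for x y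
  proof -
    obtain p q where pq: "p \<in> carrier N" "q \<in> carrier N" "x = p \<otimes>\<^bsub>N\<^esub> y \<otimes>\<^bsub>N\<^esub> q"
      using xy(3) N.green_J_iff[OF xy(1,2)] by blast
    obtain p' q' where pq': "p' \<in> carrier N" "q' \<in> carrier N" "y = p' \<otimes>\<^bsub>N\<^esub> x \<otimes>\<^bsub>N\<^esub> q'"
      using xy(3) N.green_J_iff[OF xy(1,2)] by blast
    obtain a b c d z where l: "(a, p) \<in> R" "(b, q) \<in> R" "(c, p') \<in> R" "(d, q') \<in> R" "(z, x) \<in> R"
      using r(6) pq pq' xy by meson
    have cl: "a \<in> carrier M" "b \<in> carrier M" "c \<in> carrier M" "d \<in> carrier M" "z \<in> carrier M"
      using l r(1) by blast+
    obtain k :: nat where k: "k > 0" "\<And>x. x \<in> carrier M \<Longrightarrow> x [^] k \<otimes> x [^] k = x [^] k"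
      using uniform_idempotent_power by blast
    let ?g = "a \<otimes> c" and ?h = "d \<otimes> b"
    have gh: "?g \<in> carrier M" "?h \<in> carrier M" using cl by simp_all
    have lift: "(?g [^] j \<otimes> z \<otimes> ?h [^] j, x) \<in> R" for j :: nat
    proof (induction j)
      case (Suc j)
      have "?g [^] Suc j \<otimes> z \<otimes> ?h [^] Suc j =
        a \<otimes> (c \<otimes> (?g [^] j \<otimes> z \<otimes> ?h [^] j) \<otimes> d) \<otimes> b"
        unfolding nat_pow_Suc2[OF gh(1)] using cl by (simp add: m_assoc)
      then show ?case using r(4)[OF r(4)[OF l(1) r(4)[OF r(4)[OF l(3) Suc] l(4)]] l(2)] pq pq'
        by metis
    qed (use l(5) cl in simp)
    define e where "e = ?g [^] k \<otimes> z \<otimes> ?h [^] k"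
    let ?l = "?g [^] (k - 1) \<otimes> a" and ?r = "b \<otimes> ?h [^] (k - 1)"
    let ?e' = "c \<otimes> e \<otimes> d"
    have e: "e \<in> carrier M" "?e' \<in> carrier M" using cl by (simp_all add: e_def)
    have lr: "?l \<in> carrier M" "?r \<in> carrier M" using cl by simp_all
    have e': "(?e', y) \<in> R" using r(4)[OF r(4)[OF l(3) lift] l(4)] pq'(3) unfolding e_def by metis
    have "e = (?g [^] k \<otimes> ?g [^] k) \<otimes> z \<otimes> (?h [^] k \<otimes> ?h [^] k)"
      unfolding e_def using k(2) gh by simp
    also have "\<dots> = ?g [^] k \<otimes> e \<otimes> ?h [^] k"
      unfolding e_def using cl by (simp add: m_assoc)
    also have "?g [^] k = ?l \<otimes> c"
      using k(1) nat_pow_Suc[of ?g "k - 1"] cl by (simp add: m_assoc)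
    also have "?h [^] k = d \<otimes> ?r"
      using nat_pow_pred[OF k(1) gh(2)] cl by (simp add: m_assoc)
    also have "?l \<otimes> c \<otimes> e \<otimes> (d \<otimes> ?r) = ?l \<otimes> ?e' \<otimes> ?r"
      using cl e(1) by (simp add: m_assoc)
    finally have "e = ?l \<otimes> ?e' \<otimes> ?r" .
    then have "green_J M e ?e'" unfolding green_J_iff[OF e] using cl lr by blast
    then have "e = ?e'" using assms(1) e unfolding J_trivial_def by blast
    then show ?thesis using lift[of k] e' r(5) unfolding e_def by metis
  qed
  then show ?thesis by (simp add: J_trivial_def)
qed

end

lemma variety_R_division:
  "M \<in> variety_R m \<Longrightarrow> finite_monoid N \<Longrightarrow> division R N M \<Longrightarrow> N \<in> variety_R m"
proof (induction m arbitrary: M N R)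
  case (Suc m)
  show ?case
  proof (cases m)
    case 0
    interpret fin_monoid M using variety_R_finite[OF Suc.prems(1)] by unfold_locales
    show ?thesis using Suc.prems J_trivial_division 0 by (auto simp: variety_J_iff)
  next
    case m: (Suc k)
    note r = divisionD[OF Suc.prems(3)]
    have M: "finite_monoid M" using Suc.prems(1) by (rule variety_R_finite)
    interpret fin_monoid M by unfold_locales fact
    obtain M' q where M': "M' \<in> variety_L (Suc k)" and q: "surj_hom q M M'"
      "\<forall>x\<in>carrier M. \<forall>y\<in>carrier M. q x = q y \<longleftrightarrow> sim_K M x y"
      using variety_R_Suc[OF M, THEN iffD1, OF Suc.prems(1)[unfolded m]] by blast
    interpret N: fin_monoid N by unfold_locales fact
    obtain N' :: "nat monoid" and q' where q': "surj_hom q' N N'"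
      "\<forall>x\<in>carrier N. \<forall>y\<in>carrier N. q' x = q' y \<longleftrightarrow> sim_K N x y"
      by (rule N.nat_quotient[OF N.congruence_sim_K]) (rule that)
    note sq = surj_homD[OF q(1)] and sq' = surj_homD[OF q'(1)]
    \<comment> \<open>The division induced between the quotients by \<open>sim_K\<close>;
      \<open>sim_K_division\<close> makes it single-valued.\<close>
    let ?\<sigma> = "{(q x, q' y) | x y. (x, y) \<in> R}"
    have "division ?\<sigma> N' M'"
      unfolding division_def
    proof (intro conjI allI impI)
      show "?\<sigma> \<subseteq> carrier M' \<times> carrier N'" by (auto intro!: sq(1) sq'(1) dest: r(1) r(2))
      show "(\<one>\<^bsub>M'\<^esub>, \<one>\<^bsub>N'\<^esub>) \<in> ?\<sigma>" using sq(2) sq'(2) r(3) by force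
      show "carrier N' \<subseteq> Range ?\<sigma>"
      proof
        fix b assume "b \<in> carrier N'"
        then obtain y where "y \<in> carrier N" "b = q' y" using sq'(4) by metis
        moreover from this(1) obtain x where "(x, y) \<in> R" using r(6) by metis
        ultimately show "b \<in> Range ?\<sigma>" by auto
      qed
      fix a b assume "(a, b) \<in> ?\<sigma>"
      then obtain x y where xy: "(x, y) \<in> R" "a = q x" "b = q' y" by blast
      show "b = b'" if ab': "(a, b') \<in> ?\<sigma>" for b'
      proof -
        obtain x' y' where xy': "(x', y') \<in> R" "a = q x'" "b' = q' y'" using ab' by blast
        have "sim_K M x x'" using xy xy' q(2) r(1) by metis
        then have "sim_K N y y'" using sim_K_division[OF Suc.prems(2,3) xy(1) xy'(1)] by blast
        then show ?thesis using xy xy' q'(2) r(2) by metis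
      qed
      show "(a \<otimes>\<^bsub>M'\<^esub> a', b \<otimes>\<^bsub>N'\<^esub> b') \<in> ?\<sigma>" if ab': "(a', b') \<in> ?\<sigma>" for a' b'
      proof -
        obtain x' y' where xy': "(x', y') \<in> R" "a' = q x'" "b' = q' y'" using ab' by blast
        have "a \<otimes>\<^bsub>M'\<^esub> a' = q (x \<otimes>\<^bsub>M\<^esub> x')" "b \<otimes>\<^bsub>N'\<^esub> b' = q' (y \<otimes>\<^bsub>N\<^esub> y')"
          using sq(3)[of x x'] sq'(3)[of y y'] r(1,2)[OF xy(1)] r(1,2)[OF xy'(1)] xy xy'
            by simp_all
        then show ?thesis using r(4)[OF xy(1) xy'(1)] by blast
      qed
    qed
    moreover have "opposite M' \<in> variety_R m" using M' m variety_L_iff by blast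
    moreover have N': "finite_monoid N'" using finite_monoid_surj_hom[OF Suc.prems(2) q'(1)] .
    ultimately have "opposite N' \<in> variety_R m"
      using Suc.IH[of "opposite M'" "opposite N'"] division_opposite by fastforce
    then have "N' \<in> variety_L (Suc k)" using m variety_L_iff by blast
    then show ?thesis unfolding m variety_R_Suc[OF Suc.prems(2)] using q' by blast
  qed
qed simp

lemma variety_L_division:
  "M \<in> variety_L m \<Longrightarrow> finite_monoid N \<Longrightarrow> division R N M \<Longrightarrow> N \<in> variety_L m"
  using variety_R_division[of "opposite M" m "opposite N"] division_opposite variety_L_iff by auto

text \<open>Submonoids and homomorphic images in one condition, so that closure can be used along
  compositions of divisions. Products enter separately, for the join.\<close>

definition division_closed :: "monoid_class \<Rightarrow> bool" where
  "division_closed V \<longleftrightarrow> (\<forall>M\<in>V. \<forall>N R. finite_monoid M \<and> (finite_monoid N \<longrightarrow> division R N M \<longrightarrow> N \<in> V))"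

lemma division_closed_variety: "division_closed (variety_R m)" "division_closed (variety_L m)"
  unfolding division_closed_def
  using variety_R_division variety_L_division variety_R_finite variety_L_finite by blast+

lemma division_closed_Int: "division_closed V \<Longrightarrow> division_closed W \<Longrightarrow> division_closed (V \<inter> W)"
  unfolding division_closed_def by blast

lemma in_class_obtain:
  assumes "division_closed V" "in_class M V"
  obtains N f where "N \<in> V" "surj_hom f M N" "inj_on f (carrier M)"
proof -
  obtain N where "N \<in> V" "M \<cong> N" "finite_monoid M" using assms(2) unfolding in_class_def by blast
  then show ?thesis using that iso_iff_surj_hom assms(1)
    unfolding division_closed_def finite_monoid_def by blast
qed

lemma in_class_iff_copy:
  assumes "division_closed V" "finite_monoid M" "surj_hom f M N" "inj_on f (carrier M)"
  shows "in_class M V \<longleftrightarrow> N \<in> V"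
proof
  have M: "monoid M" using assms(2) by (simp add: finite_monoid_def)
  have N: "finite_monoid N" using finite_monoid_surj_hom assms by blast
  { assume "in_class M V"
    then obtain K g where K: "K \<in> V" "surj_hom g M K" "inj_on g (carrier M)"
      using in_class_obtain assms(1) by blast
    show "N \<in> V"
      using division_comp[OF division_inj[OF M K(2,3)] division_image[OF M assms(3)]] K(1) assms(1) N
      unfolding division_closed_def by blast }
  assume "N \<in> V"
  moreover have "M \<cong> N" using iso_iff_surj_hom M N assms(3,4) unfolding finite_monoid_def by blast
  ultimately show "in_class M V" unfolding in_class_def using assms(2) by blast
qed

lemma in_class_division:
  assumes "division_closed V" "in_class M V" "monoid N" "division R N M"
  shows "in_class N V"
proof -
  obtain M' f where M': "M' \<in> V" "surj_hom f M M'" "inj_on f (carrier M)"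
    using in_class_obtain assms(1,2) by blast
  have M: "finite_monoid M" using assms(2) by (simp add: in_class_def)
  have N: "finite_monoid N" using division_finite assms(3,4) M by blast
  interpret N: fin_monoid N by unfold_locales fact
  obtain N' :: "nat monoid" and g where g: "surj_hom g N N'" "inj_on g (carrier N)"
    using N.nat_copy by blast
  have "division ({(f x, x) | x. x \<in> carrier M} O R O {(x, g x) | x. x \<in> carrier N}) N' M'"
    using division_comp[OF division_inj[OF _ M'(2,3)] division_comp[OF assms(4) division_image[OF assms(3) g(1)]]]
      M by (simp add: finite_monoid_def)
  then have "N' \<in> V" using M'(1) assms(1) finite_monoid_surj_hom[OF N g(1)]
    unfolding division_closed_def by blast
  then show ?thesis using in_class_iff_copy[OF assms(1) N g] by simp
qed

section \<open>Recognition by the word relations\<close>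

text \<open>The monoids in \<open>DA\<close>: an idempotent absorbs every element lying \<open>\<J>\<close>-above it.\<close>

definition DA :: "'a monoid \<Rightarrow> bool" where
  "DA M \<longleftrightarrow> (\<forall>e\<in>idempotents M. \<forall>p\<in>carrier M. \<forall>y\<in>carrier M. \<forall>q\<in>carrier M.
     e = p \<otimes>\<^bsub>M\<^esub> y \<otimes>\<^bsub>M\<^esub> q \<longrightarrow> e \<otimes>\<^bsub>M\<^esub> y \<otimes>\<^bsub>M\<^esub> e = e)"

context fin_monoid
begin

lemma DA_opposite:
  assumes "DA M"
  shows "DA (opposite M)"
  unfolding DA_def opposite_simps
proof (intro ballI impI)
  fix e p y q assume *: "e \<in> idempotents M" "p \<in> carrier M" "y \<in> carrier M" "q \<in> carrier M"
    "e = q \<otimes> (y \<otimes> p)"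
  then have "e = q \<otimes> y \<otimes> p" by (simp add: m_assoc)
  then have "e \<otimes> y \<otimes> e = e" using assms * unfolding DA_def by blast
  then show "e \<otimes> (y \<otimes> e) = e" using * by (simp add: m_assoc idempotents_def)
qed

text \<open>Some idempotent \<open>e\<close> with \<open>s e = s\<close> has \<open>a\<close> as a
  factor. In \<open>DA\<close> this gives \<open>e a e = e\<close>, so \<open>e\<close> leads from
  \<open>s a\<close> back to \<open>s\<close>.\<close>

lemma DA_r_stable:
  assumes "DA M" "s \<otimes> (p \<otimes> a \<otimes> q) = s"
    and c: "s \<in> carrier M" "p \<in> carrier M" "a \<in> carrier M" "q \<in> carrier M"
  shows "r_stable M s a"
proof -
  have "r_stable M s (p \<otimes> a \<otimes> q)"
    unfolding r_stable_def using assms by (intro bexI[of _ \<one>]) simp_all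
  moreover have "p \<otimes> a \<otimes> q \<in> carrier M" using c by simp
  ultimately obtain e y where e: "e \<in> idempotents M" "e \<in> carrier M" "y \<in> carrier M"
    "e = p \<otimes> a \<otimes> q \<otimes> y" "s \<otimes> e = s"
    using r_stable_obtain_idempotent[of s "p \<otimes> a \<otimes> q"] c(1) by blast
  have "e = p \<otimes> a \<otimes> (q \<otimes> y)" using e(3,4) c by (simp add: m_assoc)
  moreover have "q \<otimes> y \<in> carrier M" using e(3) c by simp
  ultimately have "e \<otimes> a \<otimes> e = e" using assms(1) e(1) c unfolding DA_def by blast
  then have "s \<otimes> e \<otimes> a \<otimes> e = s \<otimes> e" using e(2) c by (simp add: m_assoc)
  then show ?thesis unfolding r_stable_def using e(2,5) by auto
qed

text \<open>The element \<open>s x a z\<close> can be led back to \<open>s\<close> and from there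
  through \<open>x a z\<close> again, so it is fixed by a product containing \<open>a\<close>. Read
  contrapositively, a letter that has been read before cannot cause a descent.\<close>

lemma DA_r_stable_factor:
  assumes "DA M" "r_stable M s (x \<otimes> a \<otimes> z)"
    and c: "s \<in> carrier M" "x \<in> carrier M" "a \<in> carrier M" "z \<in> carrier M"
  shows "r_stable M s (x \<otimes> a \<otimes> z \<otimes> a)"
proof -
  obtain y where y: "y \<in> carrier M" "s \<otimes> (x \<otimes> a \<otimes> z) \<otimes> y = s"
    using assms(2) by (auto simp: r_stable_def)
  let ?w = "x \<otimes> a \<otimes> z"
  have w: "?w \<in> carrier M" using c by simp
  have "s \<otimes> ?w \<otimes> ((y \<otimes> x) \<otimes> a \<otimes> z) = s \<otimes> ?w \<otimes> y \<otimes> ?w" using c y(1) by (simp add: m_assoc)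
  then have "r_stable M (s \<otimes> ?w) a"
    using y c w by (intro DA_r_stable[OF assms(1), of _ "y \<otimes> x" _ z]) simp_all
  then show ?thesis using r_stable_comp[OF assms(2) _ c(1) w c(3)] by simp
qed

lemma DA_r_stable_iff:
  assumes "DA M" "e \<in> idempotents M" "z \<in> carrier M"
  shows "r_stable M e z \<longleftrightarrow> e \<otimes> z \<otimes> e = e"
proof -
  have e: "e \<in> carrier M" using assms(2) by (simp add: idempotents_def)
  show ?thesis
  proof
    assume "r_stable M e z"
    then obtain y where "y \<in> carrier M" "e = e \<otimes> z \<otimes> y" by (auto simp: r_stable_def)
    then show "e \<otimes> z \<otimes> e = e" using assms e unfolding DA_def by blast
  next
    assume "e \<otimes> z \<otimes> e = e"
    then show "r_stable M e z" using e by (auto simp: r_stable_def)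
  qed
qed

text \<open>The size of the principal right ideal of \<open>s\<close>. It drops strictly at each
  descent and so bounds the number of descents.\<close>

definition rank :: "'a \<Rightarrow> nat" where
  "rank s = card ((\<lambda>x. s \<otimes> x) ` carrier M)"

lemma rank_less:
  assumes "\<not> r_stable M s z" "s \<in> carrier M" "z \<in> carrier M"
  shows "rank (s \<otimes> z) < rank s"
  unfolding rank_def
proof (rule psubset_card_mono)
  show "finite ((\<lambda>x. s \<otimes> x) ` carrier M)" using finite_carrier by simp
  have "s \<otimes> z \<otimes> x = s \<otimes> (z \<otimes> x)" if "x \<in> carrier M" for x using that assms by (simp add: m_assoc)
  then have "(\<lambda>x. s \<otimes> z \<otimes> x) ` carrier M \<subseteq> (\<lambda>x. s \<otimes> x) ` carrier M"
    using assms(3) by (auto intro!: imageI)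
  moreover have "s \<in> (\<lambda>x. s \<otimes> x) ` carrier M" using assms(2) by (force intro: image_eqI[of _ _ \<one>])
  moreover have "s \<notin> (\<lambda>x. s \<otimes> z \<otimes> x) ` carrier M" using assms(1) by (auto simp: r_stable_def)
  ultimately show "(\<lambda>x. s \<otimes> z \<otimes> x) ` carrier M \<subset> (\<lambda>x. s \<otimes> x) ` carrier M" by blast
qed

end

context fin_monoid
begin

text \<open>From \<open>e = e p y q\<close> the elements \<open>e\<close> and \<open>e p\<close> are
  multiples of each other, so \<open>e = e p\<close>. Now \<open>e = e y q\<close>, and the same
  argument gives \<open>e = e y\<close>.\<close>

lemma DA_if_J_trivial:
  assumes "J_trivial M"
  shows "DA M"
proof -
  have J: "x = y" if xy: "x \<in> carrier M" "y \<in> carrier M" and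
    ex: "\<exists>p\<in>carrier M. \<exists>q\<in>carrier M. x = p \<otimes> y \<otimes> q"
    "\<exists>p\<in>carrier M. \<exists>q\<in>carrier M. y = p \<otimes> x \<otimes> q" for x y
    using ex assms xy green_J_iff[OF xy] unfolding J_trivial_def by blast
  show ?thesis unfolding DA_def
  proof (intro ballI impI)
    fix e p y q
    assume e: "e \<in> idempotents M" and c: "p \<in> carrier M" "y \<in> carrier M" "q \<in> carrier M"
      and eq: "e = p \<otimes> y \<otimes> q"
    have ee: "e \<in> carrier M" "e \<otimes> e = e" using e by (auto simp: idempotents_def)
    have 1: "e = e \<otimes> p \<otimes> y \<otimes> q"
    proof -
      have "e = e \<otimes> (p \<otimes> y \<otimes> q)" using ee eq by simp
      then show ?thesis using c ee(1) by (simp add: m_assoc)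
    qed
    have "e = e \<otimes> p"
    proof (rule J)
      have "e = \<one> \<otimes> (e \<otimes> p) \<otimes> (y \<otimes> q)"
        using 1 c ee(1) by (simp add: m_assoc)
      then show "\<exists>a\<in>carrier M. \<exists>b\<in>carrier M. e = a \<otimes> (e \<otimes> p) \<otimes> b"
        using c by blast
      have "e \<otimes> p = \<one> \<otimes> e \<otimes> p" using ee by simp
      then show "\<exists>a\<in>carrier M. \<exists>b\<in>carrier M. e \<otimes> p = a \<otimes> e \<otimes> b"
        using c by blast
    qed (use ee c in auto)
    with 1 have 2: "e = e \<otimes> y \<otimes> q" by simp
    have "e = e \<otimes> y"
    proof (rule J)
      have "e = \<one> \<otimes> (e \<otimes> y) \<otimes> q" using 2 c ee(1) by simp
      then show "\<exists>a\<in>carrier M. \<exists>b\<in>carrier M. e = a \<otimes> (e \<otimes> y) \<otimes> b"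
        using c by blast
      have "e \<otimes> y = \<one> \<otimes> e \<otimes> y" using ee by simp
      then show "\<exists>a\<in>carrier M. \<exists>b\<in>carrier M. e \<otimes> y = a \<otimes> e \<otimes> b"
        using c by blast
    qed (use ee c in auto)
    then show "e \<otimes> y \<otimes> e = e" using ee by simp
  qed
qed

text \<open>The identity \<open>e y e = e\<close> holds modulo \<open>sim_K\<close>. Evaluated at
  \<open>e\<close>, which is trivially stable under itself, it becomes an equality in
  \<open>M\<close>.\<close>

lemma DA_if_quotient_DA:
  assumes "surj_hom q M N" "DA N"
    and ker: "\<forall>x\<in>carrier M. \<forall>y\<in>carrier M. q x = q y \<longleftrightarrow> sim_K M x y"
  shows "DA M"
proof -
  note q = surj_homD[OF assms(1)]
  show ?thesis unfolding DA_def
  proof (intro ballI impI)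
    fix e p y r
    assume e: "e \<in> idempotents M" and c: "p \<in> carrier M" "y \<in> carrier M" "r \<in> carrier M"
      and eq: "e = p \<otimes> y \<otimes> r"
    have ee: "e \<in> carrier M" "e \<otimes> e = e" using e by (auto simp: idempotents_def)
    have "q e \<in> idempotents N" using ee q(1,3)
      by (metis (mono_tags, lifting) idempotents_def mem_Collect_eq)
    moreover have "q e = q p \<otimes>\<^bsub>N\<^esub> q y \<otimes>\<^bsub>N\<^esub> q r" using eq c q(3) by simp
    ultimately have "q e \<otimes>\<^bsub>N\<^esub> q y \<otimes>\<^bsub>N\<^esub> q e = q e"
      using assms(2) q(1) c unfolding DA_def by blast
    then have "q (e \<otimes> y \<otimes> e) = q e" using q(3) ee(1) c by simp
    then have "sim_K M (e \<otimes> y \<otimes> e) e" using ker ee(1) c by (meson m_closed)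
    moreover have "r_stable M e e" using ee by (auto simp: r_stable_def)
    ultimately have "e \<otimes> (e \<otimes> y \<otimes> e) = e \<otimes> e"
      using sim_K_D[of "e \<otimes> y \<otimes> e" e e] ee(1) c by blast
    moreover have "e \<otimes> (e \<otimes> y \<otimes> e) = (e \<otimes> e) \<otimes> y \<otimes> e"
      using ee(1) c by (simp add: m_assoc)
    ultimately show "e \<otimes> y \<otimes> e = e" using ee by simp
  qed
qed

end

lemma variety_R_SucE:
  assumes "M \<in> variety_R (Suc (Suc m))"
  obtains N q where "N \<in> variety_L (Suc m)" "surj_hom q M N"
    "\<forall>x\<in>carrier M. \<forall>y\<in>carrier M. q x = q y \<longleftrightarrow> sim_K M x y"
  using variety_R_Suc[OF variety_R_finite[OF assms], THEN iffD1, OF assms] by blast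

lemma DA_variety_R: "M \<in> variety_R (Suc m) \<Longrightarrow> DA M"
proof (induction m arbitrary: M)
  case (Suc m)
  interpret fin_monoid M using variety_R_finite[OF Suc.prems] by unfold_locales
  obtain N q where N: "N \<in> variety_L (Suc m)" and q: "surj_hom q M N"
    "\<forall>x\<in>carrier M. \<forall>y\<in>carrier M. q x = q y \<longleftrightarrow> sim_K M x y"
    by (rule variety_R_SucE[OF Suc.prems])
  have "DA (opposite N)" using Suc.IH N variety_L_iff by blast
  moreover have "finite_monoid (opposite N)" using variety_L_finite[OF N] by simp
  ultimately have "DA N" using fin_monoid.DA_opposite[of "opposite N"]
    by (simp add: fin_monoid_def)
  then show ?case using DA_if_quotient_DA[OF q(1) _ q(2)] by simp
next
  case 0
  then interpret fin_monoid M by unfold_locales (simp add: variety_J_def)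
  show ?case using 0 DA_if_J_trivial by (simp add: variety_J_iff)
qed

section \<open>Evaluating words in monoids of \<open>DA\<close>\<close>

definition word_hom :: "'c set \<Rightarrow> ('c list \<Rightarrow> 'a) \<Rightarrow> 'a monoid \<Rightarrow> bool" where
  "word_hom A h M \<longleftrightarrow> (\<forall>u\<in>lists A. h u \<in> carrier M) \<and> h [] = \<one>\<^bsub>M\<^esub> \<and>
     (\<forall>u\<in>lists A. \<forall>v\<in>lists A. h (u @ v) = h u \<otimes>\<^bsub>M\<^esub> h v)"

lemma word_hom_comp: "word_hom A h M \<Longrightarrow> surj_hom q M N \<Longrightarrow> word_hom A (q \<circ> h) N"
  unfolding word_hom_def surj_hom_def by auto

lemma word_hom_rev: "word_hom A h M \<Longrightarrow> word_hom A (h \<circ> rev) (opposite M)"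
  unfolding word_hom_def by (simp add: in_lists_conv_set)

locale DA_recognizer = fin_monoid M for M :: "'a monoid" (structure) +
  fixes A :: "'c set" and h :: "'c list \<Rightarrow> 'a"
  assumes DA: "DA M" and hom: "word_hom A h M"
begin

definition letter :: "'c \<Rightarrow> 'a" where "letter a = h [a]"

lemma h_closed [simp]: "u \<in> lists A \<Longrightarrow> h u \<in> carrier M"
  and h_Nil [simp]: "h [] = \<one>"
  and h_append [simp]: "u \<in> lists A \<Longrightarrow> v \<in> lists A \<Longrightarrow> h (u @ v) = h u \<otimes> h v"
  using hom by (simp_all add: word_hom_def del: in_lists_conv_set)

lemma letter_closed [simp]: "a \<in> A \<Longrightarrow> letter a \<in> carrier M"
  by (simp add: letter_def)

lemma h_Cons [simp]: "a \<in> A \<Longrightarrow> v \<in> lists A \<Longrightarrow> h (a # v) = letter a \<otimes> h v"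
  using h_append[of "[a]" v] by (simp add: letter_def)

declare in_lists_conv_set [simp del]

lemma in_lists_append [simp]: "u @ v \<in> lists A \<longleftrightarrow> u \<in> lists A \<and> v \<in> lists A"
  by (auto simp: in_lists_conv_set)

lemma first_descent:
  assumes "s \<in> carrier M" "u \<in> lists A" "\<not> r_stable M s (h u)"
  obtains x a y where "u = x @ a # y" "a \<notin> set x" "a \<in> A" "x \<in> lists A" "y \<in> lists A"
    "r_stable M s (h x)" "\<not> r_stable M s (h x \<otimes> letter a)"
proof -
  have "\<exists>x a y. u = x @ a # y \<and> r_stable M s (h x) \<and> \<not> r_stable M s (h (x @ [a]))"
    using assms(2,3)
  proof (induction u rule: rev_induct)
    case Nil
    have "r_stable M s (h [])"
      unfolding r_stable_def using assms(1) by (intro bexI[of _ \<one>]) simp_all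
    then show ?case using Nil by simp
  next
    case (snoc b u)
    show ?case
    proof (cases "r_stable M s (h u)")
      case False
      then obtain x a y where "u = x @ a # y" "r_stable M s (h x)" "\<not> r_stable M s (h (x @ [a]))"
        using snoc by auto
      then show ?thesis by (intro exI[of _ x] exI[of _ a] exI[of _ "y @ [b]"]) simp
    qed (use snoc in blast)
  qed
  then obtain x a y where *: "u = x @ a # y" "r_stable M s (h x)" "\<not> r_stable M s (h (x @ [a]))"
    by blast
  have l: "x \<in> lists A" "a \<in> A" "y \<in> lists A" using assms(2) *(1) by auto
  \<comment> \<open>An earlier \<open>a\<close> in \<open>x\<close> would make the step with
    \<open>a\<close> stable, by \<open>DA_r_stable_factor\<close>.\<close>
  have "a \<notin> set x"
  proof
    assume "a \<in> set x"
    then obtain p q where x: "x = p @ a # q" by (meson split_list)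
    then have pq: "p \<in> lists A" "q \<in> lists A" using l by auto
    have "r_stable M s (h p \<otimes> letter a \<otimes> h q \<otimes> letter a)"
      using *(2) x pq l assms(1) by (intro DA_r_stable_factor[OF DA]) (simp_all add: m_assoc)
    then show False using *(3) x pq l by (simp add: m_assoc)
  qed
  then show ?thesis using that[OF *(1)] * l by simp
qed

text \<open>The depth \<open>Suc (n + rank s)\<close> pays one unit per descent, each of which
  lowers the rank, and keeps \<open>n\<close> in reserve for the stable stretch before the descent,
  where \<open>sim_K\<close> gives \<open>s h(x) = s h(x')\<close>.\<close>

lemma eq_X_recognizes:
  assumes n: "\<And>u v. u \<in> lists A \<Longrightarrow> v \<in> lists A \<Longrightarrow> eq_Y m n u v \<Longrightarrow> sim_K M (h u) (h v)"
  shows "s \<in> carrier M \<Longrightarrow> u \<in> lists A \<Longrightarrow> v \<in> lists A \<Longrightarrow> eq_X (Suc m) (Suc (n + rank s)) u v \<Longrightarrow>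
    s \<otimes> h u = s \<otimes> h v"
proof (induction "rank s" arbitrary: s u v rule: less_induct)
  case less
  note d = eq_XD[OF less.prems(4)]
  have K: "s \<otimes> h x = s \<otimes> h y"
    if "eq_Y m (n + rank s) x y" "r_stable M s (h x)" "x \<in> lists A" "y \<in> lists A" for x y
    using sim_K_D[OF n[OF that(3,4) eq_Y_mono[OF that(1)]]] that less.prems(1) by simp
  show ?case
  proof (cases "r_stable M s (h u)")
    case True
    then show ?thesis using K[OF d(2)] less.prems by blast
  next
    case False
    then obtain x a y where u: "u = x @ a # y" "a \<notin> set x" "a \<in> A" "x \<in> lists A" "y \<in> lists A"
      "r_stable M s (h x)" "\<not> r_stable M s (h x \<otimes> letter a)"
      by (rule first_descent[OF less.prems(1,2)])
    have au: "a \<in> set u" using u(1) by simp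
    then obtain x' y' where v: "v = x' @ a # y'" "a \<notin> set x'" using d(1) split_list_first by metis
    have l: "x' \<in> lists A" "y' \<in> lists A" using v(1) less.prems(3) by auto
    have x: "eq_Y m (n + rank s) x x'" and y: "eq_X (Suc m) (n + rank s) y y'"
      using d(3,4)[OF au] u(1,2) v by (simp_all add: X_decomp)
    let ?s = "s \<otimes> (h x \<otimes> letter a)"
    have r: "rank ?s < rank s" using rank_less[OF u(7)] less.prems(1) u by simp
    have "?s \<otimes> h y = ?s \<otimes> h y'"
      using less.hyps[OF r _ u(5) l(2) eq_X_mono[OF y]] r less.prems(1) u by simp
    moreover have "s \<otimes> h x = s \<otimes> h x'" using K[OF x] u l by simp
    ultimately show ?thesis using u v l less.prems(1) by (simp add: m_assoc[symmetric])
  qed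
qed

end

context DA_recognizer
begin

lemma DA_recognizer_opposite: "DA_recognizer (opposite M) A (h \<circ> rev)"
  using fin_monoid_opposite DA_opposite[OF DA] word_hom_rev[OF hom]
  by (simp add: DA_recognizer_def DA_recognizer_axioms_def)

lemma last_descent:
  assumes "t \<in> carrier M" "v \<in> lists A" "\<not> l_stable M (h v) t"
  obtains x b y where "v = x @ b # y" "b \<notin> set y" "b \<in> A" "x \<in> lists A" "y \<in> lists A"
    "l_stable M (h y) t" "\<not> l_stable M (letter b \<otimes> h y) t"
proof -
  interpret opp: DA_recognizer "opposite M" A "h \<circ> rev" by (rule DA_recognizer_opposite)
  have r: "rev v \<in> lists A" using assms(2) by (simp add: in_lists_conv_set)
  obtain y b x where *: "rev v = y @ b # x" "b \<notin> set y" "b \<in> A" "y \<in> lists A" "x \<in> lists A"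
    "l_stable M ((h \<circ> rev) y) t" "\<not> l_stable M (letter b \<otimes> (h \<circ> rev) y) t"
    using opp.first_descent[of t "rev v"] assms r unfolding opp.letter_def letter_def by auto
  have "v = rev x @ b # rev y" using *(1)
    by (metis append.assoc append_Cons append_Nil rev.simps(2) rev_append rev_rev_ident)
  then show ?thesis using that[of "rev x" b "rev y"] * by (simp add: in_lists_conv_set)
qed

lemma l_stable_mult:
  assumes "l_stable M (z' \<otimes> z) t" "z \<in> carrier M" "z' \<in> carrier M" "t \<in> carrier M"
  shows "l_stable M z t" "l_stable M z' (z \<otimes> t)"
  using fin_monoid.r_stable_mult[OF fin_monoid_opposite, of t z z'] assms by simp_all

abbreviation corank :: "'a \<Rightarrow> nat" where
  "corank t \<equiv> fin_monoid.rank (opposite M) t"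

lemma corank_less:
  "\<not> l_stable M z t \<Longrightarrow> t \<in> carrier M \<Longrightarrow> z \<in> carrier M \<Longrightarrow> corank (z \<otimes> t) < corank t"
  using fin_monoid.rank_less[OF fin_monoid_opposite, of t z] by simp

text \<open>Cut \<open>u\<close> where \<open>s h(p)\<close>, for growing prefixes \<open>p\<close>, first leaves the \<open>\<R>\<close>-class of \<open>s\<close> (a first
  occurrence of a letter \<open>a\<close>), and \<open>v\<close> where \<open>h(q) t\<close>, for growing suffixes \<open>q\<close>, first leaves the
  \<open>\<L>\<close>-class of \<open>t\<close> (a last occurrence of a letter \<open>b\<close>). The relation forces both cuts to occur in
  the same order in \<open>u\<close> and \<open>v\<close>. If
  \<open>a\<close> precedes \<open>b\<close>, then \<open>u = x a z b y\<close> and the claim follows from its instances for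
  \<open>z b y\<close>, \<open>x a z\<close> and \<open>z\<close>; otherwise the part between both cuts is related one level below.\<close>

lemma eq_WI_recognizes:
  assumes H: "\<And>s t u v. s \<in> carrier M \<Longrightarrow> t \<in> carrier M \<Longrightarrow> u \<in> lists A \<Longrightarrow> v \<in> lists A \<Longrightarrow>
      eq_WI m n u v \<Longrightarrow> r_stable M s (h u) \<Longrightarrow> l_stable M (h v) t \<Longrightarrow>
      s \<otimes> h u \<otimes> t = s \<otimes> h v \<otimes> t"
  shows "s \<in> carrier M \<Longrightarrow> t \<in> carrier M \<Longrightarrow> u \<in> lists A \<Longrightarrow> v \<in> lists A \<Longrightarrow>
    eq_WI (Suc m) (n + 2 + (rank s + corank t)) u v \<Longrightarrow> s \<otimes> h u \<otimes> t = s \<otimes> h v \<otimes> t"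
proof (induction "rank s + corank t" arbitrary: s t u v rule: less_induct)
  case less
  let ?r = "rank s + corank t"
  \<comment> \<open>Two nested factorizations occur below: at the last \<open>b\<close>, and then
    inside \<open>Y_left b\<close>, where the alphabet decides the order of the cuts. The summand 2
    makes room for them whatever \<open>n\<close> and the ranks are.\<close>
  define k where "k = Suc (n + ?r)"
  have kn: "n \<le> k" and k: "n + 2 + ?r = Suc k" by (simp_all add: k_def)
  note st [simp] = less.prems(1,2)
  have rel: "eq_WI (Suc m) (Suc k) u v" using less.prems(5) by (simp only: k)
  note d = eq_WID[OF rel]
  \<comment> \<open>Every exchange below takes place between a left context coming from
    \<open>u\<close> and a right context coming from \<open>v\<close>. This is why stability at
    \<open>s'\<close> is asked of \<open>h x\<close> and stability at \<open>t'\<close> of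
    \<open>h y\<close>.\<close>
  have H': "s' \<otimes> h x \<otimes> t' = s' \<otimes> h y \<otimes> t'"
    if "eq_WI m k x y" "r_stable M s' (h x)" "l_stable M (h y) t'"
      "s' \<in> carrier M" "t' \<in> carrier M" "x \<in> lists A" "y \<in> lists A" for s' t' x y
    using H[OF that(4-7) eq_WI_mono[OF that(1) kn] that(2,3)] .
  have IH: "s' \<otimes> h x \<otimes> t' = s' \<otimes> h y \<otimes> t'"
    if "rank s' + corank t' < ?r" "eq_WI (Suc m) l x y" "l \<ge> n + 2 + (rank s' + corank t')"
      "s' \<in> carrier M" "t' \<in> carrier M" "x \<in> lists A" "y \<in> lists A" for s' t' x y l
    using less.hyps[OF that(1,4-7) eq_WI_mono[OF that(2,3)]] .
  consider (stable) "r_stable M s (h u)" "l_stable M (h v) t"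
    | (R) "\<not> r_stable M s (h u)" "l_stable M (h v) t"
    | (L) "r_stable M s (h u)" "\<not> l_stable M (h v) t"
    | (both) "\<not> r_stable M s (h u)" "\<not> l_stable M (h v) t" by blast
  then show ?case
  proof cases
    case stable
    then show ?thesis using H'[OF eq_WI_mono1[OF eq_WI_level1[OF rel]]] less.prems by blast
  next
    case R
    obtain x a y where u: "u = x @ a # y" "a \<notin> set x" "a \<in> A" "x \<in> lists A" "y \<in> lists A"
      "r_stable M s (h x)" "\<not> r_stable M s (h x \<otimes> letter a)"
      by (rule first_descent[OF less.prems(1,3) R(1)])
    have au: "a \<in> set u" using u(1) by simp
    then obtain x' y' where v: "v = x' @ a # y'" "a \<notin> set x'" using d(1) split_list_first by metis
    have l: "x' \<in> lists A" "y' \<in> lists A" using v(1) less.prems(4) by auto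
    have x: "eq_WI m k x x'" and y: "eq_WI (Suc m) k y y'"
      using d(2,3)[OF au] u(1,2) v by (simp_all add: X_decomp)
    note [simp] = u(3-5) l
    have r: "rank (s \<otimes> (h x \<otimes> letter a)) < rank s" using rank_less[OF u(7)] by simp
    have 1: "s \<otimes> (h x \<otimes> letter a) \<otimes> h y \<otimes> t = s \<otimes> (h x \<otimes> letter a) \<otimes> h y' \<otimes> t"
      by (rule IH[OF _ y]) (use r in \<open>simp_all add: k_def\<close>)
    have "l_stable M (h x' \<otimes> (letter a \<otimes> h y')) t" using R(2) v(1) by simp
    then have "l_stable M (h x') (letter a \<otimes> h y' \<otimes> t)" by (rule l_stable_mult(2)) simp_all
    then have 2: "s \<otimes> h x \<otimes> (letter a \<otimes> h y' \<otimes> t) = s \<otimes> h x' \<otimes> (letter a \<otimes> h y' \<otimes> t)"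
      by (intro H'[OF x u(6)]) simp_all
    show ?thesis using 1 2 by (simp add: u(1) v(1) m_assoc)
  next
    case L
    obtain x' b y' where v: "v = x' @ b # y'" "b \<notin> set y'" "b \<in> A" "x' \<in> lists A" "y' \<in> lists A"
      "l_stable M (h y') t" "\<not> l_stable M (letter b \<otimes> h y') t"
      by (rule last_descent[OF less.prems(2,4) L(2)])
    have bu: "b \<in> set u" using v(1) d(1) by simp
    then obtain x y where u: "u = x @ b # y" "b \<notin> set y" using split_list_last by metis
    have l: "x \<in> lists A" "y \<in> lists A" using u(1) less.prems(3) by auto
    have x: "eq_WI (Suc m) k x x'" and y: "eq_WI m k y y'"
      using d(4,5)[OF bu] v(1,2) u by (simp_all add: Y_decomp)
    note [simp] = v(3-5) l
    have r: "corank (letter b \<otimes> h y' \<otimes> t) < corank t" using corank_less[OF v(7)] by simp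
    have 1: "s \<otimes> h x \<otimes> (letter b \<otimes> h y' \<otimes> t) = s \<otimes> h x' \<otimes> (letter b \<otimes> h y' \<otimes> t)"
      by (rule IH[OF _ x]) (use r in \<open>simp_all add: k_def\<close>)
    have "r_stable M s ((h x \<otimes> letter b) \<otimes> h y)" using L(1) u(1) by (simp add: m_assoc)
    then have "r_stable M (s \<otimes> (h x \<otimes> letter b)) (h y)"
      by (rule r_stable_mult(2)) simp_all
    then have 2: "s \<otimes> (h x \<otimes> letter b) \<otimes> h y \<otimes> t = s \<otimes> (h x \<otimes> letter b) \<otimes> h y' \<otimes> t"
      by (intro H'[OF y _ v(6)]) simp_all
    show ?thesis using 1 2 by (simp add: u(1) v(1) m_assoc)
  next
    case both
    obtain p a q where u: "u = p @ a # q" "a \<notin> set p" "a \<in> A" "p \<in> lists A" "q \<in> lists A"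
      "r_stable M s (h p)" "\<not> r_stable M s (h p \<otimes> letter a)"
      by (rule first_descent[OF less.prems(1,3) both(1)])
    obtain q' b p' where v: "v = q' @ b # p'" "b \<notin> set p'" "b \<in> A" "q' \<in> lists A" "p' \<in> lists A"
      "l_stable M (h p') t" "\<not> l_stable M (letter b \<otimes> h p') t"
      by (rule last_descent[OF less.prems(2,4) both(2)])
    have au: "a \<in> set u" "a \<in> set v" and bu: "b \<in> set u" "b \<in> set v" using u(1) v(1) d(1) by auto
    note [simp] = u(3-5) v(3-5)
    have rs: "rank (s \<otimes> (h p \<otimes> letter a)) < rank s" using rank_less[OF u(7)] by simp
    have rt: "corank (letter b \<otimes> h p' \<otimes> t) < corank t" using corank_less[OF v(7)] by simp
    have Yb: "eq_WI (Suc m) (Suc (n + ?r)) (Y_left b u) (Y_left b v)"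
      using d(4)[OF bu(1)] by (simp only: k_def)
    note sets = eq_WID(1)[OF Yb]
    show ?thesis
    proof (cases "a = b \<or> a \<in> set (Y_left b u)")
      case False
      obtain x c y where du: "u = x @ b # c @ a # y" "b \<notin> set c" "b \<notin> set y" "a \<notin> set x"
        "a \<notin> set c" "C_mid a b u = Some c"
        by (rule C_mid_Some[OF au(1) bu(1)]) (use False in auto)
      obtain x' c' y' where dv: "v = x' @ b # c' @ a # y'" "b \<notin> set c'" "b \<notin> set y'" "a \<notin> set x'"
        "a \<notin> set c'" "C_mid a b v = Some c'"
        by (rule C_mid_Some[OF au(2) bu(2)]) (use False sets in auto)
      have ab: "a \<noteq> b" using False by simp
      have l: "x \<in> lists A" "c \<in> lists A" "y \<in> lists A" "x' \<in> lists A" "c' \<in> lists A" "y' \<in> lists A"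
        using less.prems(3,4) by (auto simp: du(1) dv(1))
      note [simp] = l
      have p: "p = x @ b # c" "q = y"
        using X_decomp[of a p q] X_decomp[of a "x @ b # c" y] u(1,2) du ab by simp_all
      have p': "p' = c' @ a # y'" "q' = x'"
        using Y_decomp[of b p' q'] Y_decomp[of b "c' @ a # y'" x'] v(1,2) dv ab by simp_all
      have "eq_WI (Suc m) k y y'"
        using d(3)[OF au(1)] X_decomp[of a "x @ b # c" y] X_decomp[of a "x' @ b # c'" y'] du dv ab
          by simp
      then have 1: "s \<otimes> (h p \<otimes> letter a) \<otimes> h y \<otimes> t = s \<otimes> (h p \<otimes> letter a) \<otimes> h y' \<otimes> t"
        by (rule IH[rotated]) (use rs in \<open>simp_all add: k_def\<close>)
      have "eq_WI (Suc m) k x x'"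
        using d(4)[OF bu(1)] Y_decomp[of b "c @ a # y" x] Y_decomp[of b "c' @ a # y'" x'] du dv ab
          by simp
      then have 2: "s \<otimes> h x \<otimes> (letter b \<otimes> h p' \<otimes> t) = s \<otimes> h x' \<otimes> (letter b \<otimes> h p' \<otimes> t)"
        by (rule IH[rotated]) (use rt in \<open>simp_all add: k_def\<close>)
      have c: "eq_WI m k c c'" using d(6)[OF au(1) bu(1)] du(6) dv(6) by simp
      have "r_stable M s ((h x \<otimes> letter b) \<otimes> h c)" using u(6) p(1) by (simp add: m_assoc)
      then have "r_stable M (s \<otimes> (h x \<otimes> letter b)) (h c)"
        by (rule r_stable_mult(2)) simp_all
      moreover have "l_stable M (h c' \<otimes> (letter a \<otimes> h y')) t" using v(6) p'(1) by simp
      then have "l_stable M (h c') (letter a \<otimes> h y' \<otimes> t)"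
        by (rule l_stable_mult(2)) simp_all
      ultimately have 3: "s \<otimes> (h x \<otimes> letter b) \<otimes> h c \<otimes> (letter a \<otimes> h y' \<otimes> t) =
        s \<otimes> (h x \<otimes> letter b) \<otimes> h c' \<otimes> (letter a \<otimes> h y' \<otimes> t)"
        by (intro H'[OF c]) simp_all
      show ?thesis using 1 2 3 by (simp add: du(1) dv(1) p(1) p'(1) m_assoc)
    next
      case True
      show ?thesis
      proof (cases "a \<in> set (Y_left b u)")
        case False
        then have ab: "b = a" using True by simp
        \<comment> \<open>With \<open>a = b\<close> and no \<open>a\<close> before the last one,
          this letter occurs exactly once, in \<open>u\<close> as in \<open>v\<close>, so both
          factorizations cut at the same place.\<close>
        have Y: "Y_left a w = X_left a w \<and> Y_right a w = X_right a w"
          if "a \<notin> set (Y_left a w)" "a \<in> set w" for w :: "'c list"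
          using Y_split[OF that(2)] that(1) by (metis X_decomp)
        have nu: "a \<notin> set (Y_left a u)" "a \<notin> set (Y_left a v)" using False ab sets by simp_all
        have u': "Y_left a u = p" "X_right a u = q" using Y[OF nu(1) au(1)] u(1,2)
          by (simp_all add: X_decomp)
        have v': "Y_left a v = q'" "X_right a v = p'"
          using Y[OF nu(2) au(2)] v(1,2) ab by (metis Y_decomp)+
        have 1: "s \<otimes> (h p \<otimes> letter a) \<otimes> h q \<otimes> t = s \<otimes> (h p \<otimes> letter a) \<otimes> h p' \<otimes> t"
          by (rule IH[OF _ d(3)[OF au(1), unfolded u' v']]) (use rs in \<open>simp_all add: k_def\<close>)
        have 2: "s \<otimes> h p \<otimes> (letter b \<otimes> h p' \<otimes> t) = s \<otimes> h q' \<otimes> (letter b \<otimes> h p' \<otimes> t)"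
          by (rule IH[OF _ d(4)[OF au(1), unfolded u' v']]) (use rt in \<open>simp_all add: k_def\<close>)
        show ?thesis using 1 2 by (simp add: u(1) v(1) ab m_assoc)
      next
        case ay: True
        define y where "y = Y_right b u"
        define z where "z = X_right a (Y_left b u)"
        define x' where "x' = X_left a (Y_left b v)"
        define z' where "z' = X_right a (Y_left b v)"
        have ay': "a \<in> set (Y_left b v)" using ay sets by simp
        have v': "Y_left b v = q'" "Y_right b v = p'" using v(1,2) by (simp_all add: Y_decomp)
        have "u = Y_left b u @ b # y" using Y_split(1)[OF bu(1)] by (simp add: y_def)
        moreover have l: "Y_left b u = X_left a (Y_left b u) @ a # z" "a \<notin> set (X_left a (Y_left b u))"
          using X_split[OF ay] by (simp_all add: z_def)
        ultimately have u2: "u = X_left a (Y_left b u) @ a # (z @ b # y)"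
          by (metis append.assoc append_Cons)
        then have p: "X_left a (Y_left b u) = p" "q = z @ b # y"
          using X_decomp[OF u(2), of q] X_decomp[OF l(2), of "z @ b # y"]
          unfolding u(1)[symmetric] u2[symmetric] by simp_all
        have Yu: "Y_left b u = p @ a # z" using l(1) p(1) by simp
        have q': "q' = x' @ a # z'" "a \<notin> set x'" using X_split[OF ay']
          by (simp_all add: x'_def z'_def v')
        have v2: "v = x' @ a # (z' @ b # p')" using v(1) q' by simp
        have lists: "z \<in> lists A" "y \<in> lists A" "x' \<in> lists A" "z' \<in> lists A"
          using u(5) v(4) p(2) q'(1) by simp_all
        note [simp] = lists
        have "eq_WI (Suc m) k q (z' @ b # p')"
          using d(3)[OF au(1)] X_decomp[OF u(2), of q] X_decomp[OF q'(2), of "z' @ b # p'"]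
          unfolding u(1)[symmetric] v2[symmetric] by simp
        then have 1: "s \<otimes> (h p \<otimes> letter a) \<otimes> h q \<otimes> t = s \<otimes> (h p \<otimes> letter a) \<otimes> h (z' @ b # p') \<otimes> t"
          by (rule IH[rotated]) (use rs in \<open>simp_all add: k_def\<close>)
        have 2: "s \<otimes> h (p @ a # z) \<otimes> (letter b \<otimes> h p' \<otimes> t) = s \<otimes> h q' \<otimes> (letter b \<otimes> h p' \<otimes> t)"
          by (rule IH[OF _ d(4)[OF bu(1), unfolded Yu v']]) (use rt in \<open>simp_all add: k_def\<close>)
        \<comment> \<open>Two units of depth have been spent, but \<open>z\<close> is cut off on
          both sides, so \<open>rank\<close> and \<open>corank\<close> both drop. The equation
          serves to turn \<open>z'\<close> back into \<open>z\<close>, so that the whole prefix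
          \<open>p @ a # z\<close> before the last \<open>b\<close> can be exchanged at
          once.\<close>
        have "eq_WI (Suc m) (n + ?r) z z'" using eq_WID(3)[OF Yb ay] by (simp add: z_def z'_def)
        then have 3: "s \<otimes> (h p \<otimes> letter a) \<otimes> h z \<otimes> (letter b \<otimes> h p' \<otimes> t) =
          s \<otimes> (h p \<otimes> letter a) \<otimes> h z' \<otimes> (letter b \<otimes> h p' \<otimes> t)"
          by (rule IH[rotated]) (use rs rt in simp_all)
        have "s \<otimes> h u \<otimes> t = s \<otimes> (h p \<otimes> letter a) \<otimes> h q \<otimes> t" by (simp add: u(1) m_assoc)
        also have "\<dots> = s \<otimes> (h p \<otimes> letter a) \<otimes> h z' \<otimes> (letter b \<otimes> h p' \<otimes> t)"
          unfolding 1 by (simp add: m_assoc)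
        also have "\<dots> = s \<otimes> h (p @ a # z) \<otimes> (letter b \<otimes> h p' \<otimes> t)"
          unfolding 3[symmetric] by (simp add: m_assoc)
        also have "\<dots> = s \<otimes> h v \<otimes> t" unfolding 2 by (simp add: v(1) m_assoc)
        finally show ?thesis .
      qed
    qed
  qed
qed

end

section \<open>The join of \<open>sim_K\<close> and \<open>sim_D\<close>\<close>

definition sim_KD :: "'a monoid \<Rightarrow> 'a \<Rightarrow> 'a \<Rightarrow> bool" where
  "sim_KD M = (\<lambda>x y. x \<in> carrier M \<and> y \<in> carrier M \<and> (sim_K M x y \<or> sim_D M x y))\<^sup>*\<^sup>*"

context fin_monoid
begin

lemma congruence_sim_KD: "congruence M (sim_KD M)"
proof -
  define s where "s = (\<lambda>x y. x \<in> carrier M \<and> y \<in> carrier M \<and> (sim_K M x y \<or> sim_D M x y))"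
  have sym: "s y x" if "s x y" for x y
    using that congruenceD(2)[OF congruence_sim_K] congruenceD(2)[OF congruence_sim_D]
    unfolding s_def by blast
  have "symp s\<^sup>*\<^sup>*" by (rule symp_rtranclp) (use sym in \<open>blast intro: sympI\<close>)
  then have 1: "s\<^sup>*\<^sup>* y x" if "s\<^sup>*\<^sup>* x y" for x y using that by (rule sympD)
  have mult: "s (x \<otimes> z) (y \<otimes> z)" "s (z \<otimes> x) (z \<otimes> y)" if "s x y" "z \<in> carrier M" for x y z
    using that congruenceD(4,5)[OF congruence_sim_K] congruenceD(4,5)[OF congruence_sim_D]
    unfolding s_def by (meson m_closed)+
  have 2: "s\<^sup>*\<^sup>* (x \<otimes> z) (y \<otimes> z) \<and> s\<^sup>*\<^sup>* (z \<otimes> x) (z \<otimes> y)"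
    if xy: "s\<^sup>*\<^sup>* x y" and z: "z \<in> carrier M" for x y z
    using xy
  proof (induction rule: rtranclp_induct)
    case (step y w)
    then show ?case using mult(1)[OF step(2) z]
      mult(2)[OF step(2) z]
      by (meson rtranclp.rtrancl_into_rtrancl)
  qed simp
  show ?thesis unfolding congruence_def sim_KD_def s_def[symmetric]
    using 1 2 by (blast intro: rtranclp_trans)
qed

lemma sim_K_absorb:
  assumes "DA M" "sim_K M x y" "x \<in> carrier M" "y \<in> carrier M" "e \<in> idempotents M" "e \<otimes> x \<otimes> e = e"
  shows "e \<otimes> y \<otimes> e = e"
proof -
  have "e \<in> carrier M" using assms(5) by (simp add: idempotents_def)
  then show ?thesis
    using sim_K_D[OF assms(2-4), of e] DA_r_stable_iff[OF assms(1,5,3)] assms(6)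
    by simp
qed

text \<open>In \<open>DA\<close>, \<open>e x \<R> e\<close> is equivalent to \<open>e x e = e\<close>, a condition that is self-dual; hence both
  \<^const>\<open>sim_K\<close> and \<^const>\<open>sim_D\<close> preserve stability on either side.\<close>

lemma sim_D_r_stable:
  assumes "DA M" "sim_D M x y" and c: "x \<in> carrier M" "y \<in> carrier M" "s \<in> carrier M"
    and st: "r_stable M s x"
  shows "r_stable M s y"
proof -
  interpret opp: fin_monoid "opposite M" by (rule fin_monoid_opposite)
  obtain e where e: "e \<in> idempotents M" "e \<in> carrier M" "s \<otimes> e = s" "r_stable M e x"
    using r_stable_obtain_idempotent[OF st c(3,1)] by blast
  have "e \<otimes> x \<otimes> e = e" using DA_r_stable_iff assms(1) e c by blast
  then have "e \<otimes> y \<otimes> e = e"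
    using opp.sim_K_absorb[OF DA_opposite[OF assms(1)], of x y e] assms(2) e c
    by (simp add: sim_D_eq m_assoc)
  then have "s \<otimes> e \<otimes> y \<otimes> e = s \<otimes> e" using e(2) c by (simp add: m_assoc)
  then show ?thesis unfolding r_stable_def using e by auto
qed

lemma sim_K_l_stable:
  assumes "DA M" "sim_K M x y" "x \<in> carrier M" "y \<in> carrier M" "t \<in> carrier M" "l_stable M x t"
  shows "l_stable M y t"
  using fin_monoid.sim_D_r_stable[OF fin_monoid_opposite DA_opposite[OF assms(1)], of x y t] assms
  by (simp add: sim_D_eq)

text \<open>Along a chain from \<open>x\<close> to \<open>y\<close>, stability at \<open>s\<close>
  is passed on forwards from \<open>x\<close> and stability at \<open>t\<close> backwards from
  \<open>y\<close>; the induction therefore keeps the latter as a premise. At each link both are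
  available: a \<open>sim_K\<close> link does not change the product with \<open>s\<close>, a
  \<open>sim_D\<close> link not the one with \<open>t\<close>.\<close>

lemma sim_KD_sandwich:
  assumes "DA M" "sim_KD M x y" and x: "x \<in> carrier M" and c: "s \<in> carrier M" "t \<in> carrier M"
    and "r_stable M s x" "l_stable M y t"
  shows "s \<otimes> x \<otimes> t = s \<otimes> y \<otimes> t"
proof -
  interpret opp: fin_monoid "opposite M" by (rule fin_monoid_opposite)
  have "y \<in> carrier M \<and> r_stable M s y \<and> (l_stable M y t \<longrightarrow> s \<otimes> x \<otimes> t = s \<otimes> y \<otimes> t)"
    using assms(2) unfolding sim_KD_def
  proof (induction rule: rtranclp_induct)
    case (step y z)
    then have yz: "y \<in> carrier M" "z \<in> carrier M" "r_stable M s y" by auto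
    consider (K) "sim_K M y z" | (D) "sim_D M y z" using step by blast
    then show ?case
    proof cases
      case K
      have eq: "s \<otimes> y = s \<otimes> z" using sim_K_D[OF K] yz c by blast
      have "l_stable M y t" if "l_stable M z t"
        using sim_K_l_stable[OF assms(1) congruenceD(2)[OF congruence_sim_K K]] yz c that
          by blast
      then show ?thesis using step.IH yz eq r_stable_cong[OF eq] by auto
    next
      case D
      have "s \<otimes> y \<otimes> t = s \<otimes> z \<otimes> t \<and> l_stable M y t" if z: "l_stable M z t"
      proof -
        have eq: "y \<otimes> t = z \<otimes> t"
          using opp.sim_K_D[of y z t] D yz c z by (simp add: sim_D_eq)
        then show ?thesis using z opp.r_stable_cong[of t y z] yz c by (simp add: m_assoc)
      qed
      then show ?thesis using step.IH yz sim_D_r_stable[OF assms(1) D] c by auto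
    qed
  qed (use x assms in auto)
  then show ?thesis using assms(7) by blast
qed

end

section \<open>\<open>R\<close>-trivial monoids and the first level\<close>

definition r_trivial :: "'a monoid \<Rightarrow> bool" where
  "r_trivial M \<longleftrightarrow> (\<forall>s\<in>carrier M. \<forall>z\<in>carrier M. r_stable M s z \<longrightarrow> s \<otimes>\<^bsub>M\<^esub> z = s)"

lemma (in fin_monoid) J_trivial_mult:
  assumes "J_trivial M" "s \<in> carrier M" "z \<in> carrier M" "y \<in> carrier M" "s \<otimes> z \<otimes> y = s"
  shows "s \<otimes> z = s"
proof -
  have c: "s \<otimes> z \<in> carrier M" using assms by simp
  have "s = \<one> \<otimes> (s \<otimes> z) \<otimes> y" using assms by simp
  moreover have "s \<otimes> z = \<one> \<otimes> s \<otimes> z" using assms by simp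
  ultimately have "green_J M (s \<otimes> z) s"
    unfolding green_J_iff[OF c assms(2)] using assms(3,4) one_closed by blast
  then show ?thesis using assms(1,2) c unfolding J_trivial_def by blast
qed

lemma r_trivial_variety_J: "M \<in> variety_J \<Longrightarrow> r_trivial M"
  unfolding r_trivial_def r_stable_def variety_J_iff
  using fin_monoid.J_trivial_mult by (metis fin_monoid.intro)

text \<open>If \<open>e z\<close> is \<open>R\<close>-equivalent to an idempotent \<open>e\<close>,
  their images in the \<open>J\<close>-trivial quotient coincide, so \<open>sim_K\<close> relates
  \<open>e z\<close> to \<open>e\<close>, and evaluating at \<open>e\<close> gives equality. With
  the dual statement this starts the induction for the intersection.\<close>

lemma r_trivial_variety_R_2:
  assumes "M \<in> variety_R (Suc (Suc 0))"
  shows "r_trivial M"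
proof -
  interpret fin_monoid M using variety_R_finite[OF assms] by unfold_locales
  obtain N q where N: "N \<in> variety_L (Suc 0)" and q: "surj_hom q M N"
    "\<forall>x\<in>carrier M. \<forall>y\<in>carrier M. q x = q y \<longleftrightarrow> sim_K M x y"
    by (rule variety_R_SucE[OF assms])
  note sq = surj_homD[OF q(1)]
  show ?thesis unfolding r_trivial_def
  proof (intro ballI impI)
    fix s z assume sz: "s \<in> carrier M" "z \<in> carrier M" "r_stable M s z"
    obtain e where e: "e \<in> idempotents M" "e \<in> carrier M" "s \<otimes>\<^bsub>M\<^esub> e = s" "r_stable M e z"
      using r_stable_obtain_idempotent[OF sz(3,1,2)] by blast
    obtain y where y: "y \<in> carrier M" "e \<otimes>\<^bsub>M\<^esub> z \<otimes>\<^bsub>M\<^esub> y = e" using e(4)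
      by (auto simp: r_stable_def)
    have "q e \<otimes>\<^bsub>N\<^esub> q z \<otimes>\<^bsub>N\<^esub> q y = q e" using y e(2) sz(2) sq(3) by (metis m_closed)
    then have "q e \<otimes>\<^bsub>N\<^esub> q z = q e"
      using fin_monoid.J_trivial_mult[of N "q e" "q z" "q y"] N sq(1) e(2) sz(2) y(1)
      by (simp add: variety_J_iff fin_monoid_def)
    then have "q (e \<otimes>\<^bsub>M\<^esub> z) = q e" using sq(3) e(2) sz(2) by simp
    then have "sim_K M (e \<otimes>\<^bsub>M\<^esub> z) e" using q(2) e(2) sz(2) by simp
    moreover have ee: "e \<otimes>\<^bsub>M\<^esub> e = e" using e(1) by (simp add: idempotents_def)
    moreover have "r_stable M e e" using ee e(2) by (auto simp: r_stable_def)
    ultimately have "e \<otimes>\<^bsub>M\<^esub> (e \<otimes>\<^bsub>M\<^esub> z) = e" using sim_K_D[of "e \<otimes>\<^bsub>M\<^esub> z" e e] e(2) sz(2) by simp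
    then have "e \<otimes>\<^bsub>M\<^esub> z = e" using ee e(2) sz(2) by (simp flip: m_assoc)
    then have "s \<otimes>\<^bsub>M\<^esub> e \<otimes>\<^bsub>M\<^esub> z = s \<otimes>\<^bsub>M\<^esub> e" using e(2) sz by (simp add: m_assoc)
    then show "s \<otimes>\<^bsub>M\<^esub> z = s" using e(3) by simp
  qed
qed

definition refines_kernel ::
    "'c set \<Rightarrow> (nat \<Rightarrow> 'c list \<Rightarrow> 'c list \<Rightarrow> bool) \<Rightarrow> ('c list \<Rightarrow> 'a) \<Rightarrow> bool" where
  "refines_kernel A r h \<longleftrightarrow> (\<exists>n. \<forall>u\<in>lists A. \<forall>v\<in>lists A. r n u v \<longrightarrow> h u = h v)"

context DA_recognizer
begin

lemma eq_WI_refines_kernel: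
  assumes H: "\<And>s t u v. s \<in> carrier M \<Longrightarrow> t \<in> carrier M \<Longrightarrow> u \<in> lists A \<Longrightarrow> v \<in> lists A \<Longrightarrow>
      eq_WI m n u v \<Longrightarrow> r_stable M s (h u) \<Longrightarrow> l_stable M (h v) t \<Longrightarrow>
      s \<otimes> h u \<otimes> t = s \<otimes> h v \<otimes> t"
  shows "refines_kernel A (eq_WI (Suc m)) h"
  unfolding refines_kernel_def
proof (intro exI ballI impI)
  fix u v assume "u \<in> lists A" "v \<in> lists A" "eq_WI (Suc m) (n + 2 + (rank \<one> + corank \<one>)) u v"
  then show "h u = h v"
    using eq_WI_recognizes[where s = \<one> and t = \<one> and u = u and v = v, OF H] by simp
qed

text \<open>A stable factor is absorbed by its context: \<open>s h(u) = s\<close> and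
  \<open>h(v) t = t\<close>. So nothing has to be known about \<open>u\<close> and \<open>v\<close>
  between the cuts, and level zero suffices there. Combined with \<open>eq_WI_1_if_eq_X_1\<close>,
  this is the hard direction of Simon's theorem.\<close>

lemma eq_WI_1_refines_kernel:
  assumes "r_trivial M" "r_trivial (opposite M)"
  shows "refines_kernel A (eq_WI (Suc 0)) h"
proof (rule eq_WI_refines_kernel)
  fix s t u v assume c: "s \<in> carrier M" "t \<in> carrier M" "u \<in> lists A" "v \<in> lists A"
    and st: "r_stable M s (h u)" "l_stable M (h v) t"
  have "s \<otimes> h u = s" using assms(1) c st(1) by (simp add: r_trivial_def)
  moreover have "h v \<otimes> t = t" using assms(2) c st(2) by (simp add: r_trivial_def)
  ultimately show "s \<otimes> h u \<otimes> t = s \<otimes> h v \<otimes> t" using c by (simp add: m_assoc)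
qed

end

lemma DA_recognizer_variety_R:
  "M \<in> variety_R (Suc m) \<Longrightarrow> word_hom A h M \<Longrightarrow> DA_recognizer M A h"
  using variety_R_finite DA_variety_R
  by (simp add: DA_recognizer_def DA_recognizer_axioms_def fin_monoid_def)

lemma eq_WI_refines_kernel_variety:
  assumes "M \<in> variety_R (Suc (Suc m))" "M \<in> variety_L (Suc (Suc m))" "word_hom A h M"
  shows "refines_kernel A (eq_WI (Suc m)) h"
  using assms
proof (induction m arbitrary: M h)
  case 0
  interpret DA_recognizer M A h by (rule DA_recognizer_variety_R) fact+
  show ?case
    using eq_WI_1_refines_kernel r_trivial_variety_R_2 0(1,2) variety_L_iff by blast
next
  case (Suc m)
  interpret DA_recognizer M A h by (rule DA_recognizer_variety_R) fact+
  obtain N :: "nat monoid" and q where q: "surj_hom q M N"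
    "\<forall>x\<in>carrier M. \<forall>y\<in>carrier M. q x = q y \<longleftrightarrow> sim_KD M x y"
    by (rule nat_quotient[OF congruence_sim_KD]) (rule that)
  have N: "finite_monoid N" by (rule finite_monoid_surj_hom[OF finite_monoid q(1)])
  \<comment> \<open>Used for the quotient by \<open>sim_K\<close> and for the one by
    \<open>sim_D\<close>: \<open>N\<close> is an image of both and inherits the variety of
    each.\<close>
  have dvd: "\<exists>R. division R N K"
    if K: "surj_hom p M K" "\<forall>x\<in>carrier M. \<forall>y\<in>carrier M. p x = p y \<longrightarrow> sim_K M x y \<or> sim_D M x y"
    for K :: "nat monoid" and p
  proof -
    have "q x = q y" if "x \<in> carrier M" "y \<in> carrier M" "p x = p y" for x y
    proof -
      have "sim_KD M x y" unfolding sim_KD_def using that K(2) by (intro r_into_rtranclp) blast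
      then show ?thesis using q(2) that by blast
    qed
    then show ?thesis using division_factor[OF monoid_axioms q(1) surj_homD(1-3)[OF K(1)]]
      by blast
  qed
  obtain K p where K: "K \<in> variety_L (Suc (Suc m))" "surj_hom p M K"
    "\<forall>x\<in>carrier M. \<forall>y\<in>carrier M. p x = p y \<longleftrightarrow> sim_K M x y"
    by (rule variety_R_SucE[OF Suc.prems(1)])
  obtain R where "division R N K" using dvd K(2,3) by blast
  then have NL: "N \<in> variety_L (Suc (Suc m))" using variety_L_division K(1) N by blast
  have "opposite M \<in> variety_R (Suc (Suc (Suc m)))" using Suc.prems(2) variety_L_iff by blast
  then obtain K' p' where K': "K' \<in> variety_L (Suc (Suc m))" "surj_hom p' (opposite M) K'"
    "\<forall>x\<in>carrier (opposite M). \<forall>y\<in>carrier (opposite M). p' x = p' y \<longleftrightarrow> sim_K (opposite M) x y"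
    by (rule variety_R_SucE)
  have "surj_hom p' M (opposite K')" using surj_hom_opposite[OF K'(2)] by simp
  then obtain R' where "division R' N (opposite K')"
    using dvd K'(3) unfolding sim_D_eq opposite_simps by blast
  moreover have "opposite K' \<in> variety_R (Suc (Suc m))" using K'(1) variety_L_iff by blast
  ultimately have NR: "N \<in> variety_R (Suc (Suc m))" using variety_R_division N by blast
  obtain n where n: "\<forall>u\<in>lists A. \<forall>v\<in>lists A. eq_WI (Suc m) n u v \<longrightarrow> (q \<circ> h) u = (q \<circ> h) v"
    using Suc.IH[OF NR NL word_hom_comp[OF Suc.prems(3) q(1)]] unfolding refines_kernel_def
      by blast
  show ?case
  proof (rule eq_WI_refines_kernel)
    fix s t u v assume c: "s \<in> carrier M" "t \<in> carrier M" "u \<in> lists A" "v \<in> lists A"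
      and st: "eq_WI (Suc m) n u v" "r_stable M s (h u)" "l_stable M (h v) t"
    have "sim_KD M (h u) (h v)" using n q(2) c st(1) by simp
    then show "s \<otimes>\<^bsub>M\<^esub> h u \<otimes>\<^bsub>M\<^esub> t = s \<otimes>\<^bsub>M\<^esub> h v \<otimes>\<^bsub>M\<^esub> t"
      using sim_KD_sandwich[OF DA] c st by simp
  qed
qed

lemma eq_X_refines_kernel_variety:
  assumes "M \<in> variety_R (Suc m)" "word_hom A h M"
  shows "refines_kernel A (eq_X (Suc m)) h"
  using assms
proof (induction m arbitrary: M h)
  case 0
  interpret DA_recognizer M A h by (rule DA_recognizer_variety_R) fact+
  have "r_trivial M" "r_trivial (opposite M)"
    using 0(1) r_trivial_variety_J variety_J_opposite by auto
  then show ?case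
    using eq_WI_1_refines_kernel eq_WI_1_if_eq_X_1 unfolding refines_kernel_def by blast
next
  case (Suc m)
  interpret DA_recognizer M A h by (rule DA_recognizer_variety_R) fact+
  obtain N q where N: "N \<in> variety_L (Suc m)" and q: "surj_hom q M N"
    "\<forall>x\<in>carrier M. \<forall>y\<in>carrier M. q x = q y \<longleftrightarrow> sim_K M x y"
    by (rule variety_R_SucE[OF Suc.prems(1)])
  \<comment> \<open>The induction hypothesis speaks about \<open>variety_R\<close> and
    \<open>eq_X\<close>. It is applied to the opposite of \<open>N\<close> with reversed words and
    read back as a statement on \<open>eq_Y\<close>.\<close>
  have "opposite N \<in> variety_R (Suc m)" using N variety_L_iff by blast
  then obtain n where n: "\<forall>u\<in>lists A. \<forall>v\<in>lists A. eq_X (Suc m) n u v \<longrightarrow>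
      (q \<circ> h \<circ> rev) u = (q \<circ> h \<circ> rev) v"
    using Suc.IH[OF _ word_hom_rev[OF word_hom_comp[OF Suc.prems(2) q(1)]]]
    unfolding refines_kernel_def by blast
  have K: "sim_K M (h u) (h v)" if uv: "u \<in> lists A" "v \<in> lists A" "eq_Y (Suc m) n u v" for u v
  proof -
    have "rev u \<in> lists A" "rev v \<in> lists A" using uv by (simp_all add: in_lists_conv_set)
    then have "q (h u) = q (h v)" using n uv(3) eq_X_rev[of "Suc m" n u v] by fastforce
    then show ?thesis using q(2) uv by simp
  qed
  show ?case unfolding refines_kernel_def
  proof (intro exI ballI impI)
    fix u v assume "u \<in> lists A" "v \<in> lists A" "eq_X (Suc (Suc m)) (Suc (n + rank \<one>\<^bsub>M\<^esub>)) u v"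
    then show "h u = h v"
      using eq_X_recognizes[where s = "\<one>\<^bsub>M\<^esub>" and u = u and v = v, OF K] by simp
  qed
qed

lemma eq_Y_refines_kernel_variety:
  assumes "M \<in> variety_L (Suc m)" "word_hom A h M"
  shows "refines_kernel A (eq_Y (Suc m)) h"
proof -
  obtain n where n: "\<forall>u\<in>lists A. \<forall>v\<in>lists A. eq_X (Suc m) n u v \<longrightarrow> (h \<circ> rev) u = (h \<circ> rev) v"
    using eq_X_refines_kernel_variety[OF _ word_hom_rev[OF assms(2)]] assms(1) variety_L_iff
    unfolding refines_kernel_def by blast
  have "h u = h v" if "u \<in> lists A" "v \<in> lists A" "eq_Y (Suc m) n u v" for u v
    using n[rule_format, of "rev u" "rev v"] that by (simp add: eq_X_rev in_lists_conv_set)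
  then show ?thesis unfolding refines_kernel_def by blast
qed

section \<open>Quotients of the free monoid\<close>

lemma free_monoid_simps [simp]:
  "carrier (free_monoid A) = lists A" "u \<otimes>\<^bsub>free_monoid A\<^esub> v = u @ v" "\<one>\<^bsub>free_monoid A\<^esub> = []"
  by (simp_all add: free_monoid_def)

lemma monoid_free_monoid: "monoid (free_monoid A)"
  by (rule monoidI) auto

definition word_congruence :: "('a list \<Rightarrow> 'a list \<Rightarrow> bool) \<Rightarrow> bool" where
  "word_congruence r \<longleftrightarrow> reflp r \<and> symp r \<and> transp r \<and> (\<forall>u v x. r u v \<longrightarrow> r (u @ x) (v @ x) \<and> r (x @ u) (x @ v))"

lemma congruence_word_congruence: "word_congruence r \<Longrightarrow> congruence (free_monoid A) r"
  unfolding word_congruence_def congruence_def free_monoid_simps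
  by (blast dest: reflpD sympD transpD)

lemma word_congruence_eq:
  "word_congruence (eq_X m n)" "word_congruence (eq_Y m n)"
  "word_congruence (eq_XY m n)" "word_congruence (eq_WI m n)"
proof -
  show X: "word_congruence (eq_X m n)"
    unfolding word_congruence_def
    by (intro conjI allI impI reflpI sympI transpI)
      (use eq_refl eq_sym eq_trans eq_X_append_left eq_X_append_right in metis)+
  show Y: "word_congruence (eq_Y m n)"
    unfolding word_congruence_def
    by (intro conjI allI impI reflpI sympI transpI)
      (use eq_refl eq_sym eq_trans eq_Y_append_left eq_Y_append_right in metis)+
  show "word_congruence (eq_XY m n)"
    using X Y unfolding word_congruence_def reflp_def symp_def transp_def eq_XY_def by meson
  show "word_congruence (eq_WI m n)"
    unfolding word_congruence_def
    by (intro conjI allI impI reflpI sympI transpI)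
      (use eq_WI_refl eq_WI_sym eq_WI_trans eq_WI_append_left eq_WI_append_right in metis)+
qed

lemma finite_index_eq_XY:
  assumes "finite A"
  shows "finite_index A (eq_XY m n)"
proof -
  obtain f g :: "'a list \<Rightarrow> nat" where "finite (f ` lists A)" "finite (g ` lists A)"
    and "\<forall>u\<in>lists A. \<forall>v\<in>lists A. f u = f v \<longrightarrow> eq_X m n u v"
      "\<forall>u\<in>lists A. \<forall>v\<in>lists A. g u = g v \<longrightarrow> eq_Y m n u v"
    using finite_index_eq[OF assms, of m n] unfolding finite_index_def by blast
  then show ?thesis unfolding eq_XY_def
    by (intro finite_indexI[of "\<lambda>u. (f u, g u)" _ "f ` lists A \<times> g ` lists A"]) auto
qed

section \<open>Monoids presented by a word relation, and their place in the hierarchy\<close>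

definition presents :: "('a list \<Rightarrow> 'b) \<Rightarrow> 'a set \<Rightarrow> ('a list \<Rightarrow> 'a list \<Rightarrow> bool) \<Rightarrow> 'b monoid \<Rightarrow> bool" where
  "presents p A r N \<longleftrightarrow> surj_hom p (free_monoid A) N \<and>
     (\<forall>u\<in>lists A. \<forall>v\<in>lists A. p u = p v \<longleftrightarrow> r u v)"

lemma presentsD:
  assumes "presents p A r N"
  shows "surj_hom p (free_monoid A) N" "u \<in> lists A \<Longrightarrow> p u \<in> carrier N" "p [] = \<one>\<^bsub>N\<^esub>"
    "u \<in> lists A \<Longrightarrow> v \<in> lists A \<Longrightarrow> p (u @ v) = p u \<otimes>\<^bsub>N\<^esub> p v"
    "u \<in> lists A \<Longrightarrow> v \<in> lists A \<Longrightarrow> p u = p v \<longleftrightarrow> r u v"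
    "x \<in> carrier N \<Longrightarrow> \<exists>u\<in>lists A. p u = x"
proof -
  show "surj_hom p (free_monoid A) N" using assms unfolding presents_def by blast
  from surj_homD[OF this] show "u \<in> lists A \<Longrightarrow> p u \<in> carrier N" "p [] = \<one>\<^bsub>N\<^esub>"
    "u \<in> lists A \<Longrightarrow> v \<in> lists A \<Longrightarrow> p (u @ v) = p u \<otimes>\<^bsub>N\<^esub> p v"
    "x \<in> carrier N \<Longrightarrow> \<exists>u\<in>lists A. p u = x"
    unfolding free_monoid_simps by simp_all
  show "u \<in> lists A \<Longrightarrow> v \<in> lists A \<Longrightarrow> p u = p v \<longleftrightarrow> r u v" using assms unfolding presents_def by blast
qed

lemma presents_quotient:
  assumes "word_congruence r"
  obtains p where "presents p A r (quotient_monoid (free_monoid A) r)"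
proof -
  obtain p where "surj_hom p (free_monoid A) (quotient_monoid (free_monoid A) r)"
    "\<And>u v. u \<in> carrier (free_monoid A) \<Longrightarrow> v \<in> carrier (free_monoid A) \<Longrightarrow> p u = p v \<longleftrightarrow> r u v"
    using quotient_monoid_proj[OF monoid_free_monoid congruence_word_congruence[OF assms]]
      by blast
  then have "presents p A r (quotient_monoid (free_monoid A) r)" by (simp add: presents_def)
  then show ?thesis by (rule that)
qed

lemma monoid_presents: "presents p A r N \<Longrightarrow> monoid N"
  using monoid_surj_hom[OF monoid_free_monoid] presentsD(1) by blast

lemma finite_monoid_presents:
  assumes "presents p A r N" "finite_index A r"
  shows "finite_monoid N"
proof -
  note p = presentsD[OF assms(1)]
  obtain f :: "'a list \<Rightarrow> nat" where f: "finite (f ` lists A)"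
    "\<forall>u\<in>lists A. \<forall>v\<in>lists A. f u = f v \<longrightarrow> r u v" using assms(2) unfolding finite_index_def by blast
  have "carrier N \<subseteq> (\<lambda>k. p (SOME u. u \<in> lists A \<and> f u = k)) ` (f ` lists A)"
  proof
    fix x assume "x \<in> carrier N"
    then obtain u where u: "u \<in> lists A" "p u = x" using p(6) by blast
    let ?v = "SOME v. v \<in> lists A \<and> f v = f u"
    have "?v \<in> lists A \<and> f ?v = f u" by (rule someI[of _ u]) (use u in simp)
    then have "p ?v = x" using f(2) p(5) u by metis
    then show "x \<in> (\<lambda>k. p (SOME u. u \<in> lists A \<and> f u = k)) ` (f ` lists A)" using u(1) by blast
  qed
  then have "finite (carrier N)" using f(1) finite_surj by blast
  then show ?thesis using monoid_presents[OF assms(1)] by (simp add: finite_monoid_def)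
qed

lemma presents_rev:
  assumes "presents p A r N"
  shows "presents (p \<circ> rev) A (\<lambda>u v. r (rev u) (rev v)) (opposite N)"
proof -
  note p = presentsD[OF assms]
  have [simp]: "rev u \<in> lists A \<longleftrightarrow> u \<in> lists A" for u by (simp add: in_lists_conv_set)
  have "(p \<circ> rev) ` lists A = carrier N"
  proof (intro equalityI subsetI)
    fix x assume "x \<in> carrier N"
    then obtain u where "u \<in> lists A" "p u = x" using p(6) by blast
    then show "x \<in> (p \<circ> rev) ` lists A" by (intro image_eqI[of _ _ "rev u"]) simp_all
  next
    fix x assume "x \<in> (p \<circ> rev) ` lists A"
    then obtain u where "rev u \<in> lists A" "x = p (rev u)" by (auto simp del: in_lists_conv_set)
    then show "x \<in> carrier N" using p(2) by blast
  qed
  then show ?thesis unfolding presents_def surj_hom_def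
    using p(3,4,5) by (simp del: in_lists_conv_set)
qed

lemma presents_copy:
  assumes "presents p A r Q" "surj_hom f Q N" "inj_on f (carrier Q)"
  shows "presents (f \<circ> p) A r N"
proof -
  note p = presentsD[OF assms(1)]
  have "(f \<circ> p) u = (f \<circ> p) v \<longleftrightarrow> r u v" if "u \<in> lists A" "v \<in> lists A" for u v
    using p(2,5) that inj_on_eq_iff[OF assms(3)] by simp
  then show ?thesis unfolding presents_def using surj_hom_comp[OF p(1) assms(2)] by blast
qed

lemma presents_nat:
  assumes "word_congruence r" "finite_index A r"
  obtains N :: "nat monoid" and p where "presents p A r N"
proof -
  obtain q where q: "presents q A r (quotient_monoid (free_monoid A) r)"
    by (rule presents_quotient[OF assms(1)])
  interpret fin_monoid "quotient_monoid (free_monoid A) r"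
    by unfold_locales (rule finite_monoid_presents[OF q assms(2)])
  show ?thesis by (rule nat_copy) (rule that, rule presents_copy[OF q])
qed

lemma presents_nat_eq:
  assumes "finite A"
  shows "(\<And>N p. presents p A (eq_X m n) (N :: nat monoid) \<Longrightarrow> thesis) \<Longrightarrow> thesis"
    "(\<And>N p. presents p A (eq_Y m n) (N :: nat monoid) \<Longrightarrow> thesis) \<Longrightarrow> thesis"
  using presents_nat word_congruence_eq finite_index_eq[OF assms] by metis+

text \<open>For an idempotent \<open>e\<close> represented by \<open>f\<close>, also \<open>f\<^sup>k\<close> represents \<open>e\<close>, and \<open>e u \<R> e\<close> forces the
  letters of \<open>u\<close> to occur in \<open>f\<close>.\<close>

lemma sim_K_if_eq_after_power:
  assumes N: "finite_monoid N" and "presents p A r N" "k > 0"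
    and sets: "\<And>u v. r u v \<Longrightarrow> set u = set v" "set u = set v"
    and after: "\<And>f. set u \<subseteq> set f \<Longrightarrow> set v \<subseteq> set f \<Longrightarrow> r (power_word f k @ u) (power_word f k @ v)"
    and uv: "u \<in> lists A" "v \<in> lists A"
  shows "sim_K N (p u) (p v)"
proof -
  interpret fin_monoid N by unfold_locales fact
  note p = presentsD[OF assms(2)]
  show ?thesis unfolding sim_K_def
  proof (intro ballI impI)
    fix e assume e: "e \<in> idempotents N"
      and "green_R N (e \<otimes>\<^bsub>N\<^esub> p u) e \<or> green_R N (e \<otimes>\<^bsub>N\<^esub> p v) e"
    moreover have ee: "e \<in> carrier N" "e \<otimes>\<^bsub>N\<^esub> e = e" using e by (auto simp: idempotents_def)
    ultimately obtain x where x: "x \<in> {u, v}" "r_stable N e (p x)"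
      using green_R_iff_r_stable p(2) uv by blast
    obtain f where f: "f \<in> lists A" "p f = e" using p(6) ee(1) by blast
    obtain y where y: "y \<in> carrier N" "e \<otimes>\<^bsub>N\<^esub> p x \<otimes>\<^bsub>N\<^esub> y = e" using x(2)
      by (auto simp: r_stable_def)
    obtain w where w: "w \<in> lists A" "p w = y" using p(6) y(1) by blast
    have xl: "x \<in> lists A" using x(1) uv by blast
    have "p (f @ x @ w) = p f"
      using y f w xl ee(1) p(2) by (simp add: p(4) m_assoc del: in_lists_conv_set)
    moreover have "f @ x @ w \<in> lists A" using f(1) w(1) xl by simp
    ultimately have "r (f @ x @ w) f" using p(5) f(1) by blast
    then have "set (f @ x @ w) = set f" by (rule sets(1))
    then have sub: "set u \<subseteq> set f" "set v \<subseteq> set f" using x(1) sets(2) by auto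
    have pow: "power_word f j \<in> lists A" for j using f(1) set_power_word[of j f]
      by (auto simp: in_lists_conv_set)
    have "p (power_word f (Suc j)) = e" for j
    proof (induction j)
      case (Suc j)
      have "p (power_word f (Suc (Suc j))) = p f \<otimes>\<^bsub>N\<^esub> p (power_word f (Suc j))"
        using p(4)[OF f(1) pow[of "Suc j"]] by simp
      then show ?case using Suc f(2) ee(2) by simp
    qed (use f in simp)
    then have pk: "p (power_word f k) = e" using assms(3) by (metis Suc_pred')
    have "p (power_word f k @ u) = p (power_word f k @ v)"
      using after[OF sub] p(5) pow uv by (metis append_in_lists_conv)
    then show "e \<otimes>\<^bsub>N\<^esub> p u = e \<otimes>\<^bsub>N\<^esub> p v" using p(4)[OF pow] uv pk by simp
  qed
qed

text \<open>Extending a word on both sides can only add subwords. So if \<open>p u\<close> is a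
  two-sided multiple of \<open>p v\<close>, the short subwords of \<open>v\<close> are subwords of
  \<open>u\<close>, and \<open>J\<close>-equivalence gives both inclusions.\<close>

lemma variety_J_presents:
  assumes "finite A" "presents p A (eq_X (Suc 0) n) N"
  shows "N \<in> variety_J"
proof -
  note p = presentsD[OF assms(2)]
  have fin: "finite_monoid N"
    using finite_monoid_presents[OF assms(2)] finite_index_eq[OF assms(1)] by blast
  then interpret fin_monoid N by unfold_locales
  have step: "subseq w u"
    if "x \<in> carrier N" "z \<in> carrier N" "p u = x \<otimes>\<^bsub>N\<^esub> p v \<otimes>\<^bsub>N\<^esub> z" "length w \<le> n" "subseq w v"
      "u \<in> lists A" "v \<in> lists A" for x z u v w
  proof -
    obtain a b where ab: "a \<in> lists A" "b \<in> lists A" "p a = x" "p b = z"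
      using p(6) \<open>x \<in> _\<close> \<open>z \<in> _\<close> by metis
    have "p (a @ v @ b) = p u" using ab that p(2)
      by (simp add: p(4) m_assoc del: in_lists_conv_set)
    then have "eq_X (Suc 0) n (a @ v @ b) u" using p(5) ab that by (metis append_in_lists_conv)
    moreover have "subseq w (a @ v @ b)" using that(5)
      by (simp add: list_emb_append2 subseq_rev_drop_many)
    ultimately show ?thesis using that(4) by (simp add: eq_X_1_iff_subseq)
  qed
  have "x = y" if xy: "x \<in> carrier N" "y \<in> carrier N" "green_J N x y" for x y
  proof -
    obtain u v where uv: "u \<in> lists A" "v \<in> lists A" "p u = x" "p v = y" using p(6) xy(1,2)
      by metis
    obtain a a' where a: "a \<in> carrier N" "a' \<in> carrier N" "x = a \<otimes>\<^bsub>N\<^esub> y \<otimes>\<^bsub>N\<^esub> a'"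
      using xy(3) green_J_iff[OF xy(1,2)] by blast
    obtain b b' where b: "b \<in> carrier N" "b' \<in> carrier N" "y = b \<otimes>\<^bsub>N\<^esub> x \<otimes>\<^bsub>N\<^esub> b'"
      using xy(3) green_J_iff[OF xy(1,2)] by blast
    have "p u = a \<otimes>\<^bsub>N\<^esub> p v \<otimes>\<^bsub>N\<^esub> a'" "p v = b \<otimes>\<^bsub>N\<^esub> p u \<otimes>\<^bsub>N\<^esub> b'"
      using a(3) b(3) uv(3,4) by simp_all
    then have "subseq w u = subseq w v" if "length w \<le> n" for w
      using step[OF a(1,2) _ that _ uv(1,2)] step[OF b(1,2) _ that _ uv(2,1)] by metis
    then have "eq_X (Suc 0) n u v" by (simp add: eq_X_1_iff_subseq)
    then show ?thesis using p(5) uv by blast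
  qed
  then show ?thesis using fin by (simp add: variety_J_def)
qed

text \<open>The hypothesis on \<open>s\<close> makes the quotient of \<open>N\<close> by
  \<open>sim_K\<close> an image of \<open>K\<close>, so that it stays in the variety of
  \<open>K\<close>.\<close>

lemma variety_R_if_eq_Y_sim_K:
  fixes N :: "nat monoid"
  assumes "finite_monoid N" "presents p A r N" "K \<in> variety_L (Suc m)" "presents q A s K"
    and s: "\<And>u v. u \<in> lists A \<Longrightarrow> v \<in> lists A \<Longrightarrow> s u v \<Longrightarrow> sim_K N (p u) (p v)"
  shows "N \<in> variety_R (Suc (Suc m))"
proof -
  interpret fin_monoid N by unfold_locales fact
  note p = presentsD[OF assms(2)] and q = presentsD[OF assms(4)]
  obtain N' :: "nat monoid" and g where g: "surj_hom g N N'"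
    "\<forall>x\<in>carrier N. \<forall>y\<in>carrier N. g x = g y \<longleftrightarrow> sim_K N x y"
    by (rule nat_quotient[OF congruence_sim_K]) (rule that)
  have "division {(q u, (g \<circ> p) u) | u. u \<in> carrier (free_monoid A)} N' K"
    by (rule division_factor[OF monoid_free_monoid surj_hom_comp[OF p(1) g(1)] surj_homD(1-3)[OF q(1)]])
      (use g(2) s p(2) q(5) in \<open>simp_all del: in_lists_conv_set\<close>)
  then have "N' \<in> variety_L (Suc m)"
    using variety_L_division assms(3) finite_monoid_surj_hom[OF assms(1) g(1)] by blast
  then show ?thesis unfolding variety_R_Suc[OF assms(1)] using g by blast
qed

lemma variety_R_presents:
  fixes N :: "nat monoid"
  assumes "finite A"
  shows "presents p A (eq_X (Suc m) n) N \<Longrightarrow> N \<in> variety_R (Suc m)"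
proof (induction m arbitrary: n N p)
  case 0
  then show ?case using variety_J_presents[OF assms] by simp
next
  case (Suc m)
  have N: "finite_monoid N"
    using finite_monoid_presents[OF Suc.prems] finite_index_eq[OF assms] by blast
  obtain K :: "nat monoid" and q where K: "presents q A (eq_Y (Suc m) n) K"
    by (rule presents_nat_eq(2)[OF assms]) (rule that)
  have "presents (q \<circ> rev) A (eq_X (Suc m) n) (opposite K)"
    using presents_rev[OF K] by (simp add: eq_Y_rev)
  then have "opposite K \<in> variety_R (Suc m)" by (rule Suc.IH)
  then have KL: "K \<in> variety_L (Suc m)" using variety_L_iff by blast
  have "sim_K N (p u) (p v)" if uv: "u \<in> lists A" "v \<in> lists A" "eq_Y (Suc m) n u v" for u v
  \<comment> \<open>Depth zero does not compare alphabets and is treated apart: there the relation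
    is total and \<open>p\<close> is constant on words over \<open>A\<close>.\<close>
  proof (cases n)
    case 0
    then have "p u = p v" using presentsD(5)[OF Suc.prems uv(1,2)] by simp
    then show ?thesis by (simp add: sim_K_def)
  next
    case (Suc l)
    have "eq_X (Suc (Suc m)) n (power_word f n @ u) (power_word f n @ v)"
      if "set u \<subseteq> set f" "set v \<subseteq> set f" for f
      using eq_X_after_power[OF that uv(3), of "[]"] by simp
    then show ?thesis
      using sim_K_if_eq_after_power[OF N Suc.prems, of n u v] uv eq_XD(1) eq_YD(1) Suc by blast
  qed
  then show ?case using variety_R_if_eq_Y_sim_K[OF N Suc.prems KL K] by blast
qed

lemma variety_L_presents:
  fixes N :: "nat monoid"
  assumes "finite A" "presents p A (eq_Y (Suc m) n) N"
  shows "N \<in> variety_L (Suc m)"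
  using variety_R_presents[OF assms(1), of "p \<circ> rev" m n "opposite N"] presents_rev[OF assms(2)]
  by (simp add: variety_L_iff eq_Y_rev)

text \<open>The comparison is with \<open>eq_Y\<close> on the same level \<open>m + 1\<close>. One
  level of the hierarchy is gained because \<open>sim_K\<close> tests words only behind powers. The
  depth \<open>n + 2\<close> and the exponent \<open>n + 1\<close> are those of
  \<open>eq_WI_after_power\<close>.\<close>

lemma variety_R_presents_WI:
  fixes N :: "nat monoid"
  assumes "finite A" "presents p A (eq_WI (Suc m) n) N"
  shows "N \<in> variety_R (Suc (Suc m))"
proof -
  have N: "finite_monoid N"
    using finite_monoid_presents[OF assms(2)] finite_index_eq_WI[OF assms(1)] by blast
  obtain K :: "nat monoid" and q where K: "presents q A (eq_Y (Suc m) (n + 2)) K"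
    by (rule presents_nat_eq(2)[OF assms(1)]) (rule that)
  have KL: "K \<in> variety_L (Suc m)" by (rule variety_L_presents[OF assms(1) K])
  have "sim_K N (p u) (p v)" if uv: "u \<in> lists A" "v \<in> lists A" "eq_Y (Suc m) (n + 2) u v" for u v
  proof (cases n)
    case 0
    then have "p u = p v" using presentsD(5)[OF assms(2) uv(1,2)] by simp
    then show ?thesis by (simp add: sim_K_def)
  next
    case (Suc l)
    have "set u = set v" using uv(3) eq_YD(1)[of m "Suc n" u v] by simp
    moreover have "eq_WI (Suc m) n (power_word f (Suc n) @ u) (power_word f (Suc n) @ v)"
      if "set u \<subseteq> set f" "set v \<subseteq> set f" for f
      using eq_WI_after_power[OF _ that uv(3), of "Suc n" "[]"] by simp
    ultimately show ?thesis
      using sim_K_if_eq_after_power[OF N assms(2), of "Suc n" u v] uv(1,2) eq_WID(1) Suc by blast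
  qed
  then show ?thesis using variety_R_if_eq_Y_sim_K[OF N assms(2) KL K] by blast
qed

lemma variety_L_presents_WI:
  fixes N :: "nat monoid"
  assumes "finite A" "presents p A (eq_WI (Suc m) n) N"
  shows "N \<in> variety_L (Suc (Suc m))"
proof -
  have "presents (p \<circ> rev) A (eq_WI (Suc m) n) (opposite N)"
    using presents_rev[OF assms(2)] by (simp add: eq_WI_rev)
  then have "opposite N \<in> variety_R (Suc (Suc m))" by (rule variety_R_presents_WI[OF assms(1)])
  then show ?thesis using variety_L_iff by blast
qed

section \<open>Products and the join\<close>

lemma monoid_product_group:
  assumes "\<And>i. i \<in> I \<Longrightarrow> monoid (F i)"
  shows "monoid (product_group I F)"
proof (rule monoidI)
  show "\<one>\<^bsub>product_group I F\<^esub> \<in> carrier (product_group I F)"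
    using assms by (auto simp: monoid.one_closed)
qed (use assms in \<open>auto simp: PiE_iff monoid.m_closed monoid.m_assoc monoid.l_one monoid.r_one
      extensional_def fun_eq_iff intro!: restrict_ext\<close>)

lemma division_closed_is_variety:
  assumes "is_variety V"
  shows "division_closed V"
  unfolding division_closed_def
proof (intro ballI allI conjI impI)
  fix M assume M: "M \<in> V"
  show "finite_monoid M" using assms M unfolding is_variety_def by blast
  then have m: "monoid M" by (simp add: finite_monoid_def)
  fix N :: "nat monoid" and R assume N: "finite_monoid N" "division R N M"
  have n: "monoid N" using N(1) by (simp add: finite_monoid_def)
  obtain H where "submonoid H M" "epi (M\<lparr>carrier := H\<rparr>) N \<noteq> {}"
    using N(2) monoid_divides_iff[OF m n] unfolding monoid_divides_def by blast
  moreover from this(1) have "M\<lparr>carrier := H\<rparr> \<in> V" using assms M unfolding is_variety_def by blast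
  ultimately show "N \<in> V" using assms n unfolding is_variety_def by blast
qed

lemma is_varietyI:
  assumes "division_closed V"
    "\<And>(I :: nat set) F. finite I \<Longrightarrow> (\<And>i. i \<in> I \<Longrightarrow> F i \<in> V) \<Longrightarrow> in_class (product_group I F) V"
  shows "is_variety V"
proof -
  have fin: "finite_monoid M" if "M \<in> V" for M using assms(1) that unfolding division_closed_def
    by blast
  have dvd: "N \<in> V" if MN: "M \<in> V" "monoid N" "monoid_divides N M" for M and N :: "nat monoid"
  proof -
    have "monoid M" using fin[OF MN(1)] by (simp add: finite_monoid_def)
    then obtain R where r: "division R N M" using monoid_divides_iff MN(2,3) by blast
    then have "finite_monoid N" using division_finite fin MN by blast
    then show ?thesis using assms(1) MN(1) r unfolding division_closed_def by blast
  qed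
  have "M\<lparr>carrier := H\<rparr> \<in> V" if M: "M \<in> V" "submonoid H M" for M H
  proof (rule dvd[OF M(1)])
    have "monoid M" using fin[OF M(1)] by (simp add: finite_monoid_def)
    then show "monoid (M\<lparr>carrier := H\<rparr>)" using submonoid.submonoid_is_monoid[OF M(2)] by blast
    have "(\<lambda>x. x) \<in> epi (M\<lparr>carrier := H\<rparr>) (M\<lparr>carrier := H\<rparr>)" by (simp add: epi_def hom_def)
    then show "monoid_divides (M\<lparr>carrier := H\<rparr>) M" unfolding monoid_divides_def using M(2)
      by blast
  qed
  moreover have "N \<in> V" if "M \<in> V" "monoid N" "epi M N \<noteq> {}" for M and N :: "nat monoid"
  proof (rule dvd[OF that(1,2)])
    have "monoid M" using fin[OF that(1)] by (simp add: finite_monoid_def)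
    then have "submonoid (carrier M) M"
      by (intro submonoid.intro) (auto simp: monoid.m_closed monoid.one_closed)
    then show "monoid_divides N M" unfolding monoid_divides_def using that(3)
      by (intro exI[of _ "carrier M"]) simp
  qed
  ultimately show ?thesis unfolding is_variety_def using fin assms(2) by blast
qed

text \<open>A homomorphism from words into \<open>N\<close> lifts to \<open>M\<close>: choose an
  element of \<open>M\<close> over the image of each letter. The lift stays over \<open>h\<close> on
  all words, and since the division is single-valued, equality of lifts implies equality under
  \<open>h\<close>.\<close>

lemma refines_kernel_division:
  assumes "division R N M" "monoid M" "\<And>h. word_hom A h M \<Longrightarrow> refines_kernel A r h" "word_hom A h N"
  shows "refines_kernel A r h"
proof -
  interpret monoid M by fact
  note d = divisionD[OF assms(1)]
  have "\<forall>a\<in>A. \<exists>x. (x, h [a]) \<in> R" using assms(4) d(6) unfolding word_hom_def by auto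
  from bchoice[OF this] obtain g where g: "\<And>a. a \<in> A \<Longrightarrow> (g a, h [a]) \<in> R" by blast
  define \<psi> where "\<psi> u = foldr (\<lambda>a x. g a \<otimes>\<^bsub>M\<^esub> x) u \<one>\<^bsub>M\<^esub>" for u
  have \<psi>: "(\<psi> u, h u) \<in> R" if "u \<in> lists A" for u
    using that
  proof (induction u)
    case Nil
    then show ?case using d(3) assms(4) by (simp add: \<psi>_def word_hom_def)
  next
    case (Cons a u)
    then have "h ([a] @ u) = h [a] \<otimes>\<^bsub>N\<^esub> h u"
      using assms(4) unfolding word_hom_def by (metis Cons_in_lists_iff lists.Nil)
    moreover have "a \<in> A" using Cons by simp
    ultimately show ?case using d(4)[OF g Cons.IH, of a] by (simp add: \<psi>_def)
  qed
  have closed: "\<psi> u \<in> carrier M" if "u \<in> lists A" for u using \<psi>[OF that] d(1) by blast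
  have "\<psi> (u @ v) = \<psi> u \<otimes>\<^bsub>M\<^esub> \<psi> v" if u: "u \<in> lists A" and v: "v \<in> lists A" for u v
    using u
  proof (induction u)
    case Nil
    then show ?case using closed[OF v] by (simp add: \<psi>_def)
  next
    case (Cons a u)
    have "g a \<in> carrier M" using g d(1) Cons by auto
    moreover have "\<psi> u \<in> carrier M" using closed Cons by auto
    ultimately show ?case using Cons closed[OF v] by (simp add: \<psi>_def m_assoc)
  qed
  then have "word_hom A \<psi> M" using closed by (simp add: word_hom_def \<psi>_def del: in_lists_conv_set)
  then obtain n where "\<forall>u\<in>lists A. \<forall>v\<in>lists A. r n u v \<longrightarrow> \<psi> u = \<psi> v"
    using assms(3) unfolding refines_kernel_def by blast
  then have "\<forall>u\<in>lists A. \<forall>v\<in>lists A. r n u v \<longrightarrow> h u = h v" using \<psi> d(5) by metis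
  then show ?thesis unfolding refines_kernel_def by blast
qed

definition recognized_class :: "'c set \<Rightarrow> (nat \<Rightarrow> 'c list \<Rightarrow> 'c list \<Rightarrow> bool) \<Rightarrow> monoid_class" where
  "recognized_class A r = {N. finite_monoid N \<and> (\<forall>h. word_hom A h N \<longrightarrow> refines_kernel A r h)}"

lemma division_closed_recognized_class: "division_closed (recognized_class A r)"
  unfolding division_closed_def
proof (intro ballI allI conjI impI)
  fix M :: "nat monoid" assume M: "M \<in> recognized_class A r"
  then show fin: "finite_monoid M" by (simp add: recognized_class_def)
  fix N :: "nat monoid" and R assume "finite_monoid N" "division R N M"
  then show "N \<in> recognized_class A r"
    using refines_kernel_division[of R N M A r] M fin
    by (auto simp: recognized_class_def finite_monoid_def)
qed

lemma is_variety_recognized_class: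
  assumes mono: "\<And>n k u v. r n u v \<Longrightarrow> k \<le> n \<Longrightarrow> r k u v"
  shows "is_variety (recognized_class A r)"
proof (rule is_varietyI[OF division_closed_recognized_class])
  fix I :: "nat set" and F :: "nat \<Rightarrow> nat monoid"
  assume I: "finite I" and F: "\<And>i. i \<in> I \<Longrightarrow> F i \<in> recognized_class A r"
  let ?P = "product_group I F"
  have fin: "finite_monoid (F i)" if "i \<in> I" for i using F[OF that]
    by (simp add: recognized_class_def)
  have P: "finite_monoid ?P"
    using monoid_product_group[of I F] fin I by (simp add: finite_monoid_def finite_PiE)
  interpret P: fin_monoid ?P by unfold_locales fact
  obtain N :: "nat monoid" and f where N: "surj_hom f ?P N" "inj_on f (carrier ?P)"
    by (rule P.nat_copy) (rule that)
  have rk: "refines_kernel A r h" if h: "word_hom A h ?P" for h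
  proof -
    have c: "h u \<in> (\<Pi>\<^sub>E i\<in>I. carrier (F i))" if "u \<in> lists A" for u
      using h that by (simp add: word_hom_def del: in_lists_conv_set)
    have "\<exists>n. \<forall>u\<in>lists A. \<forall>v\<in>lists A. r n u v \<longrightarrow> h u i = h v i" if i: "i \<in> I" for i
    proof -
      have "word_hom A (\<lambda>u. h u i) (F i)"
        using h i c by (auto simp: word_hom_def PiE_iff simp del: in_lists_conv_set)
      then show ?thesis using F[OF i] unfolding recognized_class_def refines_kernel_def by blast
    qed
    then obtain n where n: "\<And>i. i \<in> I \<Longrightarrow> \<forall>u\<in>lists A. \<forall>v\<in>lists A. r (n i) u v \<longrightarrow> h u i = h v i"
      by metis
    \<comment> \<open>The sum is merely a common upper bound of the finitely many depths;
      \<open>mono\<close> brings it down to each of them.\<close>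
    have "h u = h v" if uv: "u \<in> lists A" "v \<in> lists A" "r (sum n I) u v" for u v
    proof (rule PiE_ext[OF c[OF uv(1)] c[OF uv(2)]])
      fix i assume i: "i \<in> I"
      have "n i \<le> sum n I" using I i by (simp add: member_le_sum)
      then show "h u i = h v i" using n[OF i] mono[OF uv(3)] uv(1,2) by blast
    qed
    then show ?thesis unfolding refines_kernel_def by blast
  qed
  have "refines_kernel A r \<psi>" if "word_hom A \<psi> N" for \<psi>
    by (rule refines_kernel_division[OF division_image[OF P.monoid_axioms N(1)] P.monoid_axioms rk that])
  then have "N \<in> recognized_class A r"
    using finite_monoid_surj_hom[OF P N(1)] by (simp add: recognized_class_def)
  moreover have "?P \<cong> N"
    using iso_iff_surj_hom[OF P.monoid_axioms] N finite_monoid_surj_hom[OF P N(1)]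
    by (auto simp: finite_monoid_def)
  ultimately show "in_class ?P (recognized_class A r)" unfolding in_class_def using P by blast
qed

text \<open>The kernel \<open>eq_XY\<close> is the intersection of the kernels \<open>eq_X\<close>
  and \<open>eq_Y\<close>, so \<open>N\<close> divides the product of their two quotients, which
  lies in every variety containing both classes.\<close>

lemma variety_join_presents:
  fixes N :: "nat monoid"
  assumes "finite A" "presents p A (eq_XY (Suc m) n) N"
  shows "N \<in> variety_join (variety_R (Suc m)) (variety_L (Suc m))"
  unfolding variety_join_def
proof (intro InterI)
  fix U assume "U \<in> {U. is_variety U \<and> variety_R (Suc m) \<union> variety_L (Suc m) \<subseteq> U}"
  then have U: "is_variety U" "variety_R (Suc m) \<subseteq> U" "variety_L (Suc m) \<subseteq> U" by auto
  note closed = division_closed_is_variety[OF U(1)]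
  have N: "finite_monoid N"
    using finite_monoid_presents[OF assms(2)] finite_index_eq_XY[OF assms(1)] by blast
  obtain K :: "nat monoid" and f where K: "presents f A (eq_X (Suc m) n) K"
    by (rule presents_nat_eq(1)[OF assms(1)]) (rule that)
  obtain L :: "nat monoid" and g where L: "presents g A (eq_Y (Suc m) n) L"
    by (rule presents_nat_eq(2)[OF assms(1)]) (rule that)
  have KL: "K \<in> U" "L \<in> U"
    using variety_R_presents[OF assms(1) K] variety_L_presents[OF assms(1) L] U(2,3) by blast+
  define F where "F i = (if i = 0 then K else L)" for i :: nat
  define w where "w u = (\<lambda>i\<in>{0, 1 :: nat}. if i = 0 then f u else g u)" for u
  let ?P = "product_group {0, 1} F"
  have P: "in_class ?P U" using U(1) KL unfolding is_variety_def F_def by simp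
  note f = presentsD[OF K] and g = presentsD[OF L] and p = presentsD[OF assms(2)]
  have "division {(w u, p u) | u. u \<in> carrier (free_monoid A)} N ?P"
  proof (rule division_factor[OF monoid_free_monoid p(1)])
    fix u v assume uv: "u \<in> carrier (free_monoid A)" "v \<in> carrier (free_monoid A)"
    then have uv': "u \<in> lists A" "v \<in> lists A" by simp_all
    show "w u \<in> carrier ?P" using f(2) g(2) uv' by (auto simp: w_def F_def)
    show "w (u \<otimes>\<^bsub>free_monoid A\<^esub> v) = w u \<otimes>\<^bsub>?P\<^esub> w v"
      using f(4) g(4) uv' by (auto simp: w_def F_def fun_eq_iff)
    assume w: "w u = w v"
    have "f u = f v" using fun_cong[OF w, of 0] by (simp add: w_def)
    moreover have "g u = g v" using fun_cong[OF w, of 1] by (simp add: w_def)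
    ultimately show "p u = p v" using f(5) g(5) p(5) uv'
      by (simp add: eq_XY_def del: in_lists_conv_set)
  next
    show "w \<one>\<^bsub>free_monoid A\<^esub> = \<one>\<^bsub>?P\<^esub>" using f(3) g(3) by (auto simp: w_def F_def fun_eq_iff)
  qed
  moreover have "monoid N" using N by (simp add: finite_monoid_def)
  ultimately have "in_class N U" using in_class_division[OF closed P] by blast
  then show "N \<in> U"
    using in_class_iff_copy[OF closed N, of "\<lambda>x. x" N] by (simp add: surj_hom_def)
qed

lemma variety_join_recognized:
  "variety_join (variety_R (Suc m)) (variety_L (Suc m)) \<subseteq> recognized_class A (eq_XY (Suc m))"
proof -
  have "refines_kernel A (eq_XY (Suc m)) h"
    if "refines_kernel A (eq_X (Suc m)) h \<or> refines_kernel A (eq_Y (Suc m)) h"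
      for h :: "'a list \<Rightarrow> nat"
    using that unfolding refines_kernel_def eq_XY_def by blast
  then have "variety_R (Suc m) \<union> variety_L (Suc m) \<subseteq> recognized_class A (eq_XY (Suc m))"
    using eq_X_refines_kernel_variety eq_Y_refines_kernel_variety variety_R_finite variety_L_finite
    unfolding recognized_class_def by blast
  moreover have "is_variety (recognized_class A (eq_XY (Suc m)))"
    by (rule is_variety_recognized_class) (use eq_X_mono eq_Y_mono in \<open>auto simp: eq_XY_def\<close>)
  ultimately show ?thesis unfolding variety_join_def by blast
qed

lemma division_closed_join: "division_closed (variety_join (variety_R (Suc m)) (variety_L (Suc m)))"
  unfolding division_closed_def
proof (intro ballI allI conjI impI)
  let ?J = "variety_join (variety_R (Suc m)) (variety_L (Suc m))"
  fix M assume M: "M \<in> ?J"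
  \<comment> \<open>The join is an intersection, so its members are known to be finite once one
    variety above both classes is exhibited; \<open>recognized_class\<close> over the empty alphabet
    serves.\<close>
  then show "finite_monoid M"
    using variety_join_recognized[of m "{} :: nat set"] by (auto simp: recognized_class_def)
  fix N :: "nat monoid" and R assume N: "finite_monoid N" "division R N M"
  have "N \<in> U" if "is_variety U" "variety_R (Suc m) \<union> variety_L (Suc m) \<subseteq> U" for U
    using division_closed_is_variety[OF that(1)] M that N
      unfolding division_closed_def variety_join_def by blast
  then show "N \<in> ?J" unfolding variety_join_def by blast
qed

section \<open>Division of quotients of the free monoid\<close>

lemma in_class_if_divides_quotient:
  assumes "finite_monoid M" "division_closed V" "word_congruence r" "finite_index A r"
    "\<And>(N :: nat monoid) p. presents p A r N \<Longrightarrow> N \<in> V"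
    "monoid_divides M (quotient_monoid (free_monoid A) r)"
  shows "in_class M V"
proof -
  let ?Q = "quotient_monoid (free_monoid A) r"
  obtain q where q: "presents q A r ?Q" by (rule presents_quotient[OF assms(3)])
  have Q: "finite_monoid ?Q" by (rule finite_monoid_presents[OF q assms(4)])
  interpret Q: fin_monoid ?Q by unfold_locales fact
  have M: "monoid M" using assms(1) by (simp add: finite_monoid_def)
  obtain N :: "nat monoid" and f where f: "surj_hom f ?Q N" "inj_on f (carrier ?Q)"
    by (rule Q.nat_copy) (rule that)
  have "N \<in> V" using assms(5)[OF presents_copy[OF q f]] .
  then have "in_class ?Q V" using in_class_iff_copy[OF assms(2) Q f] by simp
  moreover obtain R where "division R M ?Q"
    using monoid_divides_iff[OF Q.monoid_axioms M] assms(6) by blast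
  ultimately show ?thesis using in_class_division[OF assms(2) _ M] by blast
qed

lemma divides_quotient_if_in_class:
  assumes "finite_monoid M" "epi (free_monoid A) M \<noteq> {}" "division_closed V" "in_class M V"
    "\<And>n. word_congruence (r n)"
    "\<And>N \<psi>. N \<in> V \<Longrightarrow> word_hom A \<psi> N \<Longrightarrow> refines_kernel A r \<psi>"
  shows "\<exists>n. monoid_divides M (quotient_monoid (free_monoid A) (r n))"
proof -
  have M: "monoid M" using assms(1) by (simp add: finite_monoid_def)
  obtain h where h: "surj_hom h (free_monoid A) M"
    using surj_hom_if_epi[OF monoid_free_monoid M] assms(2) by blast
  obtain N f where N: "N \<in> V" "surj_hom f M N" "inj_on f (carrier M)"
    by (rule in_class_obtain[OF assms(3,4)])
  have "word_hom A h M" using surj_homD(1-3)[OF h] by (simp add: word_hom_def)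
  then obtain n where n: "\<forall>u\<in>lists A. \<forall>v\<in>lists A. r n u v \<longrightarrow> (f \<circ> h) u = (f \<circ> h) v"
    using assms(6)[OF N(1) word_hom_comp[OF _ N(2)]] unfolding refines_kernel_def by blast
  let ?Q = "quotient_monoid (free_monoid A) (r n)"
  obtain q where q: "presents q A (r n) ?Q" by (rule presents_quotient[OF assms(5)])
  have "division {(q u, h u) | u. u \<in> carrier (free_monoid A)} M ?Q"
  proof (rule division_factor[OF monoid_free_monoid h surj_homD(1-3)[OF presentsD(1)[OF q]]])
    fix u v assume "u \<in> carrier (free_monoid A)" "v \<in> carrier (free_monoid A)" "q u = q v"
    then have "(f \<circ> h) u = (f \<circ> h) v" "u \<in> lists A" "v \<in> lists A" using n presentsD(5)[OF q]
      by auto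
    then show "h u = h v" using inj_onD[OF N(3)] surj_homD(1)[OF h] by auto
  qed
  then show ?thesis using monoid_divides_iff[OF monoid_presents[OF q] M] by blast
qed

text \<open>The passage from words to varieties holds for every \<open>M\<close>. The converses
  concern a fixed alphabet and assume that \<open>M\<close> is generated by images of its letters.
  Without such a bound they fail: over one letter every quotient of words, and every divisor of it,
  is commutative, whereas \<open>variety_J\<close> contains noncommutative monoids.\<close>

theorem theorem1:
  fixes \<Sigma> :: "'a set" and M :: "'b monoid" and m :: nat
  assumes "finite \<Sigma>" and "finite_monoid M" and "m \<ge> 1"
  shows
    "((\<exists>n. monoid_divides M (quotient_monoid (free_monoid \<Sigma>) (eq_X m n))) \<longrightarrow>
        in_class M (variety_R m)) \<and>
     ((\<exists>n. monoid_divides M (quotient_monoid (free_monoid \<Sigma>) (eq_Y m n))) \<longrightarrow>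
        in_class M (variety_L m)) \<and>
     ((\<exists>n. monoid_divides M (quotient_monoid (free_monoid \<Sigma>) (eq_XY m n))) \<longrightarrow>
        in_class M (variety_join (variety_R m) (variety_L m))) \<and>
     ((\<exists>n. monoid_divides M (quotient_monoid (free_monoid \<Sigma>) (eq_WI m n))) \<longrightarrow>
        in_class M (variety_R (m + 1) \<inter> variety_L (m + 1))) \<and>
     (epi (free_monoid \<Sigma>) M \<noteq> {} \<longrightarrow>
        ((\<exists>n. monoid_divides M (quotient_monoid (free_monoid \<Sigma>) (eq_X m n))) \<longleftrightarrow>
           in_class M (variety_R m)) \<and>
        ((\<exists>n. monoid_divides M (quotient_monoid (free_monoid \<Sigma>) (eq_Y m n))) \<longleftrightarrow>
           in_class M (variety_L m)) \<and>
        ((\<exists>n. monoid_divides M (quotient_monoid (free_monoid \<Sigma>) (eq_XY m n))) \<longleftrightarrow>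
           in_class M (variety_join (variety_R m) (variety_L m))) \<and>
        ((\<exists>n. monoid_divides M (quotient_monoid (free_monoid \<Sigma>) (eq_WI m n))) \<longleftrightarrow>
           in_class M (variety_R (m + 1) \<inter> variety_L (m + 1))))"
proof -
  obtain k where m: "m = Suc k" using assms(3) by (cases m) auto
  have WI: "variety_R (m + 1) \<inter> variety_L (m + 1) = variety_R (Suc (Suc k)) \<inter> variety_L (Suc (Suc k))"
    by (simp only: m Suc_eq_plus1)
  have closed: "division_closed (variety_R (Suc (Suc k)) \<inter> variety_L (Suc (Suc k)))"
    using division_closed_Int division_closed_variety by blast
  note only_if = in_class_if_divides_quotient[OF assms(2)]
  note "if" = divides_quotient_if_in_class[OF assms(2)]
  have X: "in_class M (variety_R m)"
    if "monoid_divides M (quotient_monoid (free_monoid \<Sigma>) (eq_X m n))" for n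
    by (rule only_if[OF division_closed_variety(1) word_congruence_eq(1) _ _ that])
      (use finite_index_eq[OF assms(1)] in blast, unfold m, rule variety_R_presents[OF assms(1)])
  have Y: "in_class M (variety_L m)"
    if "monoid_divides M (quotient_monoid (free_monoid \<Sigma>) (eq_Y m n))" for n
    by (rule only_if[OF division_closed_variety(2) word_congruence_eq(2) _ _ that])
      (use finite_index_eq[OF assms(1)] in blast, unfold m, rule variety_L_presents[OF assms(1)])
  have XY: "in_class M (variety_join (variety_R m) (variety_L m))"
    if "monoid_divides M (quotient_monoid (free_monoid \<Sigma>) (eq_XY m n))" for n
    unfolding m
    by (rule only_if[OF division_closed_join word_congruence_eq(3) finite_index_eq_XY[OF assms(1)] _ that])
      (unfold m, rule variety_join_presents[OF assms(1)])
  have W: "in_class M (variety_R (m + 1) \<inter> variety_L (m + 1))"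
    if "monoid_divides M (quotient_monoid (free_monoid \<Sigma>) (eq_WI m n))" for n
    unfolding WI
    by (rule only_if[OF closed word_congruence_eq(4) finite_index_eq_WI[OF assms(1)] _ that])
      (unfold m, intro IntI variety_R_presents_WI[OF assms(1)] variety_L_presents_WI[OF assms(1)])
  have X': "\<exists>n. monoid_divides M (quotient_monoid (free_monoid \<Sigma>) (eq_X m n))"
    if "epi (free_monoid \<Sigma>) M \<noteq> {}" "in_class M (variety_R m)"
    by (rule "if"[OF that(1) division_closed_variety(1) that(2) word_congruence_eq(1)])
      (use eq_X_refines_kernel_variety m in blast)
  have Y': "\<exists>n. monoid_divides M (quotient_monoid (free_monoid \<Sigma>) (eq_Y m n))"
    if "epi (free_monoid \<Sigma>) M \<noteq> {}" "in_class M (variety_L m)"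
    by (rule "if"[OF that(1) division_closed_variety(2) that(2) word_congruence_eq(2)])
      (use eq_Y_refines_kernel_variety m in blast)
  have XY': "\<exists>n. monoid_divides M (quotient_monoid (free_monoid \<Sigma>) (eq_XY m n))"
    if "epi (free_monoid \<Sigma>) M \<noteq> {}" "in_class M (variety_join (variety_R m) (variety_L m))"
    unfolding m
    by (rule "if"[OF that(1) division_closed_join that(2)[unfolded m] word_congruence_eq(3)])
      (use variety_join_recognized in \<open>auto simp: recognized_class_def\<close>)
  have W': "\<exists>n. monoid_divides M (quotient_monoid (free_monoid \<Sigma>) (eq_WI m n))"
    if "epi (free_monoid \<Sigma>) M \<noteq> {}" "in_class M (variety_R (m + 1) \<inter> variety_L (m + 1))"
    unfolding m
    by (rule "if"[OF that(1) closed that(2)[unfolded WI] word_congruence_eq(4)])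
      (use eq_WI_refines_kernel_variety in blast)
  show ?thesis using X Y XY W X' Y' XY' W' by blast
qed

end
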